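(* Fix $T>0$ and consider the Gaussian feedback channel over $[0,T]$ $$Y(t)=\int_0^t g(s,M,Y_0^s)\,ds+B(t),\qquad t\in[0,T].$$ Assume: (d) (uniform Lipschitz condition) there exists a constant $L>0$ such that for all $0\le s_1,s_2,t_1,t_2\le T$, all $m\in\mathcal{M}$ and all $\varphi,\psi\in C[0,T]$, $|g(s_1,m,\varphi_0^{s_2})-g(t_1,m,\psi_0^{t_2})|\le L\left(|s_1-t_1|+\|\varphi_0^{s_2}-\psi_0^{t_2}\|\right)$; (e) (uniform linear growth condition) there exists a constant $L>0$ such that for all $t\in[0,T]$, all $m\in\mathcal{M}$ and all $\varphi\in C[0,T]$, $|g(t,m,\varphi_0^t)|\le L(1+\|\varphi_0^t\|)$. For each $n\in\mathbb{N}$ let $\Delta_n=\{t^{(n)}_0,\dots,t^{(n)}_n\}$ be chosen time points with $0=t^{(n)}_0<t^{(n)}_1<\dots<t^{(n)}_n=T$. Let $Y^{(n)}$ be the Euler–Maruyama approximation of $Y$ with respect to $\Delta_n$, and let $Y^{(n)}(\Delta_n)=\{Y^{(n)}(t^{(n)}_0),\dots,Y^{(n)}(t^{(n)}_n)\}$. Then $$\lim_{n\to\infty}I(M;Y^{(n)}(\Delta_n))=I(M;Y_0^T).$$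
   Context: $(\Omega,\mathcal{F},\mathbb{P})$ is a probability space with a filtration satisfying the usual conditions and carrying a standard Brownian motion $\{B(t)\}$. $M$ (the message) is a random variable taking values in a finite alphabet $\mathcal{M}$, independent of $B$. $g$ is a real-valued deterministic function; $g(s,m,\varphi_0^t)$ depends on the time $s\in[0,T]$, on $m\in\mathcal{M}$, and on the continuous path $\varphi_0^t=\{\varphi(r):0\le r\le t\}$, which is identified with the stopped path $r\mapsto\varphi(r\wedge t)$ (so $s$ and $t$ may differ). The output $Y$ starts at $Y(0)=0$, and $Y_0^s=\{Y(r):0\le r\le s\}$; under (d)-(e) the equation has a unique strong solution. $C[0,T]$ is the space of continuous functions on $[0,T]$. Norms: $\|\varphi_0^t\|=\sup_{0\le r\le t}|\varphi(r)|$, and $\|\varphi_0^s-\psi_0^t\|=\sup_{r}|\varphi(r\wedge s)-\psi(r\wedge t)|$. Euler–Maruyama approximation with respect to $\Delta_n$: set $Y^{(n)}(0)=0$ and recursively, for $i=0,1,\dots,n-1$, $$Y^{(n)}(t^{(n)}_{i+1})=Y^{(n)}(t^{(n)}_i)+\int_{t^{(n)}_i}^{t^{(n)}_{i+1}}g\big(s,M,Y_0^{(n),t^{(n)}_i}\big)\,ds+B(t^{(n)}_{i+1})-B(t^{(n)}_i),$$ $$Y^{(n)}(t)=Y^{(n)}(t^{(n)}_i)+\frac{t-t^{(n)}_i}{t^{(n)}_{i+1}-t^{(n)}_i}\big(Y^{(n)}(t^{(n)}_{i+1})-Y^{(n)}(t^{(n)}_i)\big),\quad t^{(n)}_i\le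 t\le t^{(n)}_{i+1},$$ where $Y_0^{(n),t}=\{Y^{(n)}(r):0\le r\le t\}$. $I(X;Z)$ denotes mutual information of general random elements (possibly vector- or path-valued): the supremum over finite partitions $\xi=\{A_i\}$ from $\sigma(X)$ and $\zeta=\{B_j\}$ from $\sigma(Z)$ of $\sum_{i,j}\mathbb{P}(A_i\cap B_j)\log\frac{\mathbb{P}(A_i\cap B_j)}{\mathbb{P}(A_i)\mathbb{P}(B_j)}$; equivalently $\mathbb{E}\left[\log\frac{d\mu_{X,Z}}{d(\mu_X\times\mu_Z)}(X,Z)\right]$ if this Radon–Nikodym derivative exists and $\infty$ otherwise, where $\mu$ denotes the distribution of the indicated random element. In $I(M;Y_0^T)$, $Y_0^T$ is regarded as a $C[0,T]$-valued random element.
   Formalization: The formal theorem additionally assumes that the largest step of the time points Δ_n tends to 0 as n→∞; without this the claim fails, e.g. for g(s,m,φ)=m·h(s) with h of zero integral supported in [1/2,1] and no interior time points in (1/2,1), T=1. *)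

theory Defs
  imports "HOL-Probability.Probability"
begin

section \<open>Paths\<close>

text \<open>
  The path \<open>\<phi>\<^sub>0\<^sup>t\<close> is represented by the stopped path \<open>r \<mapsto> \<phi> (min r t)\<close>.  It is frozen at
  \<open>\<phi> 0\<close> for negative \<open>r\<close>, so that it depends on nothing but the values of \<open>\<phi>\<close> on \<open>{0..t}\<close>.
\<close>

definition stop_path :: "real \<Rightarrow> (real \<Rightarrow> real) \<Rightarrow> real \<Rightarrow> real" where
  "stop_path t \<phi> = (\<lambda>r. \<phi> (max 0 (min r t)))"

definition path_norm :: "real \<Rightarrow> (real \<Rightarrow> real) \<Rightarrow> real" where
  "path_norm t \<phi> = (SUP r\<in>{0..t}. \<bar>\<phi> r\<bar>)"

definition path_dist :: "real \<Rightarrow> real \<Rightarrow> (real \<Rightarrow> real) \<Rightarrow> real \<Rightarrow> (real \<Rightarrow> real) \<Rightarrow> real" where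
  "path_dist T s \<phi> t \<psi> = (SUP r\<in>{0..T}. \<bar>stop_path s \<phi> r - stop_path t \<psi> r\<bar>)"

text \<open>
  \<open>C[0,T]\<close> with the supremum norm is identified with the closed subspace of \<open>real \<Rightarrow>\<^sub>C real\<close>
  of functions that are constant on each side of \<open>{0..T}\<close>; the embedding is isometric, so
  the Borel sets of \<open>real \<Rightarrow>\<^sub>C real\<close> induce exactly the Borel sets of \<open>C[0,T]\<close>.
\<close>

definition C_path :: "real \<Rightarrow> (real \<Rightarrow> real) \<Rightarrow> real \<Rightarrow>\<^sub>C real" where
  "C_path T \<phi> = Bcontfun (stop_path T \<phi>)"

lemma apply_C_path:
  assumes "0 \<le> T" "continuous_on {0..T} \<phi>"
  shows "apply_bcontfun (C_path T \<phi>) = stop_path T \<phi>"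
proof -
  have "continuous_on UNIV (stop_path T \<phi>)"
    unfolding stop_path_def using assms
    by (intro continuous_on_compose2[OF assms(2)] continuous_intros) auto
  moreover have "bounded (range (stop_path T \<phi>))"
  proof (rule bounded_subset)
    show "bounded (\<phi> ` {0..T})"
      using assms(2) by (intro compact_imp_bounded compact_continuous_image) auto
    show "range (stop_path T \<phi>) \<subseteq> \<phi> ` {0..T}"
      using assms(1) by (auto simp: stop_path_def)
  qed
  ultimately show ?thesis
    unfolding C_path_def by (intro Bcontfun_inverse) (simp add: bcontfun_def)
qed


section \<open>The drift functional\<close>

definition uniform_Lipschitz ::
  "real \<Rightarrow> 'm set \<Rightarrow> (real \<Rightarrow> 'm \<Rightarrow> (real \<Rightarrow> real) \<Rightarrow> real) \<Rightarrow> bool" where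
  "uniform_Lipschitz T A g \<longleftrightarrow>
    (\<exists>L>0. \<forall>s1\<in>{0..T}. \<forall>s2\<in>{0..T}. \<forall>t1\<in>{0..T}. \<forall>t2\<in>{0..T}. \<forall>m\<in>A. \<forall>\<phi> \<psi>.
      continuous_on {0..T} \<phi> \<longrightarrow> continuous_on {0..T} \<psi> \<longrightarrow>
      \<bar>g s1 m (stop_path s2 \<phi>) - g t1 m (stop_path t2 \<psi>)\<bar>
        \<le> L * (\<bar>s1 - t1\<bar> + path_dist T s2 \<phi> t2 \<psi>))"

definition uniform_linear_growth ::
  "real \<Rightarrow> 'm set \<Rightarrow> (real \<Rightarrow> 'm \<Rightarrow> (real \<Rightarrow> real) \<Rightarrow> real) \<Rightarrow> bool" where
  "uniform_linear_growth T A g \<longleftrightarrow>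
    (\<exists>L>0. \<forall>t\<in>{0..T}. \<forall>m\<in>A. \<forall>\<phi>. continuous_on {0..T} \<phi> \<longrightarrow>
      \<bar>g t m (stop_path t \<phi>)\<bar> \<le> L * (1 + path_norm t \<phi>))"


section \<open>Stochastic basis and Brownian motion\<close>

definition usual_conditions :: "'a measure \<Rightarrow> (real \<Rightarrow> 'a measure) \<Rightarrow> bool" where
  "usual_conditions P F \<longleftrightarrow>
    filtration (space P) F \<and> (\<forall>t. sets (F t) \<subseteq> sets P) \<and>
    complete_measure P \<and> null_sets P \<subseteq> sets (F 0) \<and>
    (\<forall>t\<ge>0. sets (F t) = (\<Inter>u\<in>{t<..}. sets (F u)))"

definition brownian_motion ::
  "'a measure \<Rightarrow> (real \<Rightarrow> 'a measure) \<Rightarrow> (real \<Rightarrow> 'a \<Rightarrow> real) \<Rightarrow> bool" where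
  "brownian_motion P F B \<longleftrightarrow>
    (\<forall>t\<ge>0. B t \<in> borel_measurable (F t)) \<and>
    (AE \<omega> in P. B 0 \<omega> = 0) \<and>
    (AE \<omega> in P. continuous_on {0..} (\<lambda>t. B t \<omega>)) \<and>
    (\<forall>s t. 0 \<le> s \<and> s < t \<longrightarrow>
      prob_space.indep_set P (sets (F s))
        (sets (vimage_algebra (space P) (\<lambda>\<omega>. B t \<omega> - B s \<omega>) borel)) \<and>
      distributed P lborel (\<lambda>\<omega>. B t \<omega> - B s \<omega>) (normal_density 0 (sqrt (t - s))))"

definition independent_of_process ::
  "'a measure \<Rightarrow> 'm measure \<Rightarrow> ('a \<Rightarrow> 'm) \<Rightarrow> (real \<Rightarrow> 'a \<Rightarrow> real) \<Rightarrow> bool" where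
  "independent_of_process P S X B \<longleftrightarrow>
    prob_space.indep_set P (sets (vimage_algebra (space P) X S))
      (sets (vimage_algebra (space P) (\<lambda>\<omega>. \<lambda>t\<in>{0..}. B t \<omega>) (Pi\<^sub>M {0..} (\<lambda>_. borel))))"


section \<open>The channel output\<close>

text \<open>
  The initial information is the message, so a strong solution is adapted to the completion
  of the filtration generated by \<open>X\<close> and \<open>B\<close>.
\<close>

definition augmented_filtration ::
  "'a measure \<Rightarrow> 'm measure \<Rightarrow> ('a \<Rightarrow> 'm) \<Rightarrow> (real \<Rightarrow> 'a \<Rightarrow> real) \<Rightarrow> real \<Rightarrow> 'a measure" where
  "augmented_filtration P S X B t = sigma (space P)
    (sets (vimage_algebra (space P) X S) \<union>
     (\<Union>r\<in>{0..t}. sets (vimage_algebra (space P) (B r) borel)) \<union> null_sets P)"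

definition strong_solution ::
  "'a measure \<Rightarrow> real \<Rightarrow> 'm measure \<Rightarrow> (real \<Rightarrow> 'm \<Rightarrow> (real \<Rightarrow> real) \<Rightarrow> real) \<Rightarrow>
    ('a \<Rightarrow> 'm) \<Rightarrow> (real \<Rightarrow> 'a \<Rightarrow> real) \<Rightarrow> (real \<Rightarrow> 'a \<Rightarrow> real) \<Rightarrow> bool" where
  "strong_solution P T S g X B Y \<longleftrightarrow>
    (\<forall>\<omega>\<in>space P. continuous_on {0..T} (\<lambda>t. Y t \<omega>)) \<and>
    (\<forall>t\<in>{0..T}. Y t \<in> borel_measurable (augmented_filtration P S X B t)) \<and>
    (AE \<omega> in P. Y 0 \<omega> = 0 \<and>
      (\<forall>t\<in>{0..T}. Y t \<omega> =
        (LBINT s:{0..t}. g s (X \<omega>) (stop_path s (\<lambda>r. Y r \<omega>))) + B t \<omega>))"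


section \<open>Euler--Maruyama approximation\<close>

definition time_points :: "real \<Rightarrow> nat \<Rightarrow> (nat \<Rightarrow> real) \<Rightarrow> bool" where
  "time_points T n \<tau> \<longleftrightarrow> \<tau> 0 = 0 \<and> \<tau> n = T \<and> (\<forall>i<n. \<tau> i < \<tau> (Suc i))"

definition mesh :: "nat \<Rightarrow> (nat \<Rightarrow> real) \<Rightarrow> real" where
  "mesh n \<tau> = Max ((\<lambda>i. \<tau> (Suc i) - \<tau> i) ` {..<n})"

text \<open>\<open>y\<close> is the approximating path for the message \<open>m\<close> and the noise path \<open>b\<close>.\<close>

definition euler_maruyama ::
  "(real \<Rightarrow> 'm \<Rightarrow> (real \<Rightarrow> real) \<Rightarrow> real) \<Rightarrow> nat \<Rightarrow> (nat \<Rightarrow> real) \<Rightarrow> 'm \<Rightarrow>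
    (real \<Rightarrow> real) \<Rightarrow> (real \<Rightarrow> real) \<Rightarrow> bool" where
  "euler_maruyama g n \<tau> m b y \<longleftrightarrow>
    y 0 = 0 \<and>
    (\<forall>i<n.
      y (\<tau> (Suc i)) = y (\<tau> i)
        + (LBINT s:{\<tau> i..\<tau> (Suc i)}. g s m (stop_path (\<tau> i) y))
        + b (\<tau> (Suc i)) - b (\<tau> i) \<and>
      (\<forall>t\<in>{\<tau> i..\<tau> (Suc i)}.
        y t = y (\<tau> i) + (t - \<tau> i) / (\<tau> (Suc i) - \<tau> i) * (y (\<tau> (Suc i)) - y (\<tau> i))))"


section \<open>Mutual information of general random elements\<close>

definition finite_partition ::
  "'a measure \<Rightarrow> 'b measure \<Rightarrow> ('a \<Rightarrow> 'b) \<Rightarrow> 'a set set \<Rightarrow> bool" where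
  "finite_partition P S X \<xi> \<longleftrightarrow>
    finite \<xi> \<and> partition_on (space P) \<xi> \<and> \<xi> \<subseteq> sets (vimage_algebra (space P) X S)"

text \<open>
  Natural logarithm.  Summands with \<open>measure P (a \<inter> b) = 0\<close> vanish, which is the convention
  \<open>0 log 0 = 0\<close>.  The supremum is taken in \<open>ereal\<close>, so the value may be \<open>\<infinity>\<close>.
\<close>

definition mutual_info ::
  "'a measure \<Rightarrow> 'b measure \<Rightarrow> 'c measure \<Rightarrow> ('a \<Rightarrow> 'b) \<Rightarrow> ('a \<Rightarrow> 'c) \<Rightarrow> ereal" where
  "mutual_info P S U X Z =
    (SUP (\<xi>, \<zeta>) \<in> {\<xi>. finite_partition P S X \<xi>} \<times> {\<zeta>. finite_partition P U Z \<zeta>}.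
      ereal (\<Sum>a\<in>\<xi>. \<Sum>b\<in>\<zeta>.
        measure P (a \<inter> b) * ln (measure P (a \<inter> b) / (measure P a * measure P b))))"

end

(*
  Only total variation matters for a finite message: mutual information is uniformly continuous in
  the joint law, over all finite partitions at once.  On the grid, Y solves the Euler recursion
  exactly if the noise B is replaced by B plus the integral of the difference between the true and
  the frozen drift.  By continuity of the path of Y this difference is eventually below any e > 0,
  so it may be clipped at e.  A discrete Girsanov transform on a refined grid shows that adding a
  clipped adapted drift changes the joint law of message and noise by at most
  sqrt (exp (e^2 T) - 1) in total variation; hence the grid values of Y and of Y^(n), together with
  the message, have asymptotically equal laws.  The grid values of Y carry at most the information
  of the path, and asymptotically all of it, since their interpolations converge to the path.
*)

theory Submission
  imports Defs
begin

section \<open>Mutual information of labelled partitions\<close>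

text \<open>Convergence of Y^(n) to \<open>Y\<close> along paths would give only weak convergence of
  the laws, and mutual information is merely lower semicontinuous for that; the upper bound calls
  for total variation. The Girsanov transform cannot be made on the grid itself: inside a step the
  drift of \<open>Y\<close> depends on the noise of that same step, so its integral is not known
  when the step begins. On a grid refined \<open>N\<close> times the integral becomes a left Riemann
  sum with predictable terms, and the resulting bound sees the refined steps only through their
  total length \<open>T\<close>, so \<open>N\<close> may tend to infinity for fixed
  \<open>n\<close>. That limit is pointwise, and probabilities of a fixed Borel event need not
  converge along it; the event is therefore approximated along the sequence. Clipping is needed
  because the threshold for \<open>n\<close> depends on the sample point: with a uniform bound on
  the drift, a second moment of the likelihood suffices.\<close>

definition label_sum :: "'a measure \<Rightarrow> 'a set set \<Rightarrow> nat \<Rightarrow> ('a \<Rightarrow> nat) \<Rightarrow> real" where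
  "label_sum P \<xi> k l = (\<Sum>a\<in>\<xi>. \<Sum>j<k. let b = {\<omega>\<in>space P. l \<omega> = j} in
     measure P (a \<inter> b) * ln (measure P (a \<inter> b) / (measure P a * measure P b)))"

text \<open>Output partitions are handled as label functions because one label can be applied to two
  different outputs and the two sums compared cell by cell. A label value may be unattained, whereas
  a block of a partition may not be empty.\<close>

lemma label_sum_le_mutual_info:
  assumes \<xi>: "finite_partition P S X \<xi>"
    and Z: "Z \<in> measurable P U" and e: "e \<in> measurable U (count_space UNIV)"
    and k: "\<And>\<omega>. \<omega> \<in> space P \<Longrightarrow> e (Z \<omega>) < k"
  shows "ereal (label_sum P \<xi> k (\<lambda>\<omega>. e (Z \<omega>))) \<le> mutual_info P S U X Z"
proof -
  define b where "b j = {\<omega>\<in>space P. e (Z \<omega>) = j}" for j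
  \<comment> \<open>Only attained labels give blocks. On them \<open>b\<close> is injective, and the
    other labels contribute 0.\<close>
  define J where "J = {j. j < k \<and> b j \<noteq> {}}"
  define G where "G a c = measure P (a \<inter> c) * ln (measure P (a \<inter> c) / (measure P a * measure P c))" for a c
  have inj: "inj_on b J"
    by (auto simp: inj_on_def J_def b_def)
  have b_eq: "b j = Z -` (e -` {j} \<inter> space U) \<inter> space P" for j
    using measurable_space[OF Z] by (auto simp: b_def)
  have "b j \<in> sets (vimage_algebra (space P) Z U)" for j
    unfolding b_eq using e by (intro in_vimage_algebra) (auto intro: measurable_sets)
  moreover have "partition_on (space P) (b ` J)"
    using k by (auto simp: partition_on_def J_def b_def disjoint_def)
  ultimately have fp: "finite_partition P U Z (b ` J)"
    unfolding finite_partition_def by (auto simp: J_def)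
  have "label_sum P \<xi> k (\<lambda>\<omega>. e (Z \<omega>)) = (\<Sum>a\<in>\<xi>. \<Sum>j<k. G a (b j))"
    by (simp add: label_sum_def G_def b_def Let_def)
  also have "\<dots> = (\<Sum>a\<in>\<xi>. \<Sum>j\<in>J. G a (b j))"
    by (intro sum.cong sum.mono_neutral_right refl) (auto simp: J_def G_def)
  also have "\<dots> = (\<Sum>a\<in>\<xi>. \<Sum>c\<in>b ` J. G a c)"
    using inj by (simp add: sum.reindex)
  finally have "ereal (label_sum P \<xi> k (\<lambda>\<omega>. e (Z \<omega>))) = ereal (\<Sum>a\<in>\<xi>. \<Sum>c\<in>b ` J. G a c)"
    by simp
  also have "\<dots> \<le> mutual_info P S U X Z"
    unfolding mutual_info_def G_def
    by (rule SUP_upper2[of "(\<xi>, b ` J)"]) (use \<xi> fp in auto)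
  finally show ?thesis .
qed

text \<open>The converse passage: a finite partition generated by the output comes from a measurable
  label on the value space of the output.\<close>

lemma finite_partition_label:
  assumes \<zeta>: "finite_partition P U Z \<zeta>" and Z: "Z \<in> measurable P U"
  obtains e and k :: nat where "e \<in> measurable U (count_space UNIV)" "\<forall>x. e x < k"
    "\<forall>\<xi>. label_sum P \<xi> k (\<lambda>\<omega>. e (Z \<omega>)) = (\<Sum>a\<in>\<xi>. \<Sum>b\<in>\<zeta>.
        measure P (a \<inter> b) * ln (measure P (a \<inter> b) / (measure P a * measure P b)))"
proof -
  have fin: "finite \<zeta>" and part: "partition_on (space P) \<zeta>"
    and sub: "\<zeta> \<subseteq> sets (vimage_algebra (space P) Z U)"
    using \<zeta> by (auto simp: finite_partition_def)
  obtain f where f: "bij_betw f {..<card \<zeta>} \<zeta>"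
    using ex_bij_betw_nat_finite[OF fin] by (auto simp: atLeast0LessThan)
  define q where "q = card \<zeta>"
  have "\<forall>j\<in>{..<q}. \<exists>E\<in>sets U. f j = Z -` E \<inter> space P"
  proof
    fix j assume "j \<in> {..<q}"
    then have "f j \<in> \<zeta>" using f by (auto simp: bij_betw_def q_def)
    with sub have "f j \<in> sets (vimage_algebra (space P) Z U)" by auto
    then show "\<exists>E\<in>sets U. f j = Z -` E \<inter> space P"
      by (subst (asm) sets_vimage_algebra2) (use measurable_space[OF Z] in auto)
  qed
  then obtain E where E: "\<And>j. j < q \<Longrightarrow> E j \<in> sets U" "\<And>j. j < q \<Longrightarrow> f j = Z -` E j \<inter> space P"
    by (metis lessThan_iff)
  \<comment> \<open>The sets \<open>E j\<close> are known to be disjoint only on the image of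
    \<open>Z\<close>, so the least index is taken. The default \<open>q\<close> is reached only off
    that image, which makes its class in the sample space empty.\<close>
  define e where "e x = (LEAST j. j < q \<and> x \<in> E j \<or> j = q)" for x
  have e_le: "e x \<le> q" for x
    unfolding e_def by (rule Least_le) simp
  have e_meas: "e \<in> measurable U (count_space UNIV)"
    unfolding e_def
  proof (rule measurable_Least)
    fix j
    show "(\<lambda>x. j < q \<and> x \<in> E j \<or> j = q) \<in> measurable U (count_space UNIV)"
    proof (cases "j < q")
      case True
      note E(1)[OF True, measurable]
      show ?thesis by measurable
    qed simp
  qed
  have pre: "{\<omega>\<in>space P. e (Z \<omega>) = j} = f j" if j: "j < q" for j
  proof -
    have "e (Z \<omega>) = j" if "\<omega> \<in> f j" for \<omega>
      unfolding e_def
    proof (rule Least_equality)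
      show "j < q \<and> Z \<omega> \<in> E j \<or> j = q" using that E(2)[OF j] j by auto
    next
      fix i assume i: "i < q \<and> Z \<omega> \<in> E i \<or> i = q"
      show "j \<le> i"
      proof (rule ccontr)
        assume "\<not> j \<le> i"
        then have "i < q" "Z \<omega> \<in> E i" "i \<noteq> j" using i j by auto
        moreover have "\<omega> \<in> space P" using that E(2)[OF j] by auto
        ultimately have "\<omega> \<in> f i" using E(2) by auto
        moreover have "f i \<in> \<zeta>" "f j \<in> \<zeta>" "f i \<noteq> f j"
          using f \<open>i < q\<close> j \<open>i \<noteq> j\<close> by (auto simp: bij_betw_def q_def inj_on_def)
        ultimately show False
          using part that by (auto simp: partition_on_def disjoint_def)
      qed
    qed
    moreover have "\<omega> \<in> f j" if "\<omega> \<in> space P" "e (Z \<omega>) = j" for \<omega>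
    proof -
      have "e (Z \<omega>) < q \<and> Z \<omega> \<in> E (e (Z \<omega>)) \<or> e (Z \<omega>) = q"
        unfolding e_def by (rule LeastI[of _ q]) simp
      with that j E(2)[OF j] show ?thesis by auto
    qed
    ultimately show ?thesis using E(2)[OF j] by auto
  qed
  have preq: "{\<omega>\<in>space P. e (Z \<omega>) = q} = {}"
  proof -
    have False if "\<omega> \<in> space P" "e (Z \<omega>) = q" for \<omega>
    proof -
      have "\<omega> \<in> \<Union>\<zeta>" using part that by (auto simp: partition_on_def)
      then obtain j where "j < q" "\<omega> \<in> f j" using f by (auto simp: bij_betw_def q_def)
      then show False using pre[of j] that by auto
    qed
    then show ?thesis by auto
  qed
  show ?thesis
  proof (rule that[of e "Suc q"])
    show "\<forall>\<xi>. label_sum P \<xi> (Suc q) (\<lambda>\<omega>. e (Z \<omega>)) = (\<Sum>a\<in>\<xi>. \<Sum>b\<in>\<zeta>.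
        measure P (a \<inter> b) * ln (measure P (a \<inter> b) / (measure P a * measure P b)))"
      unfolding label_sum_def Let_def
    proof (intro allI sum.cong refl)
      fix \<xi> :: "'a set set" and a
      let ?G = "\<lambda>b. measure P (a \<inter> b) * ln (measure P (a \<inter> b) / (measure P a * measure P b))"
      have "(\<Sum>j<Suc q. ?G {\<omega>\<in>space P. e (Z \<omega>) = j}) = (\<Sum>j<q. ?G (f j))"
        by (simp add: preq pre)
      also have "\<dots> = sum ?G \<zeta>"
        using f by (intro sum.reindex_bij_betw) (simp add: q_def)
      finally show "(\<Sum>j<Suc q. ?G {\<omega>\<in>space P. e (Z \<omega>) = j}) = sum ?G \<zeta>" .
    qed
  qed (use e_meas e_le in \<open>auto simp: less_Suc_eq_le\<close>)
qed

text \<open>Every error term is linear in the masses. Summed over the cells of an output partition,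
  \<open>\<eta> * t\<close> gives \<open>\<eta>\<close> and the differences give total variations,
  whatever the number of cells; this is the source of the uniformity over all partitions.\<close>

lemma mult_ln_ratio_le:
  fixes x y s t \<eta> :: real
  assumes "0 \<le> x" "x \<le> s" "0 \<le> y" "y \<le> t" "0 < \<eta>" "\<eta> < 1"
  shows "x * ln (x / s) \<le> y * ln (y / t) + \<eta> * t + (1 - ln \<eta> + \<eta>) * \<bar>x - y\<bar> + \<bar>s - t\<bar>"
proof -
  \<comment> \<open>Unlike \<open>x * ln (x / s)\<close>, its perturbation \<open>x * ln (x / s + \<eta>)\<close> is Lipschitz in \<open>(x, s)\<close>.\<close>
  have up: "x * ln (x / s) \<le> x * ln (x / s + \<eta>)"
    using assms by (cases "x = 0") (auto intro!: mult_left_mono simp: add_pos_pos)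
  have down: "y * ln (y / t + \<eta>) \<le> y * ln (y / t) + \<eta> * t"
  proof (cases "y = 0")
    case False
    then have y: "y > 0" "t > 0" using assms by auto
    have "y / t + \<eta> = (y / t) * (1 + \<eta> * t / y)" using y by (simp add: field_simps)
    then have "ln (y / t + \<eta>) = ln (y / t) + ln (1 + \<eta> * t / y)"
      using y assms by (simp only: ln_mult_pos divide_pos_pos add_pos_pos mult_pos_pos zero_less_one)
    also have "\<dots> \<le> ln (y / t) + \<eta> * t / y"
      using y assms by (intro add_left_mono ln_add_one_self_le_self) auto
    finally have "y * ln (y / t + \<eta>) \<le> y * (ln (y / t) + \<eta> * t / y)"
      using y by (intro mult_left_mono) auto
    also have "\<dots> = y * ln (y / t) + \<eta> * t"
      using y by (simp add: distrib_left)
    finally show ?thesis .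
  qed (use assms in auto)
  define u v where "u = x / s" and "v = y / t"
  have u: "0 \<le> u" "u \<le> 1" and v: "0 \<le> v" "v \<le> 1"
    using assms by (auto simp: u_def v_def divide_le_eq_1)
  have us: "u * s = x" and vt: "v * t = y"
    using assms by (auto simp: u_def v_def)
  have ln1: "\<bar>ln (u + \<eta>)\<bar> \<le> - ln \<eta> + \<eta>"
  proof -
    have "ln \<eta> \<le> ln (u + \<eta>)" using u assms by simp
    moreover have "ln (u + \<eta>) \<le> ln (1 + \<eta>)" using u assms by simp
    moreover have "ln (1 + \<eta>) \<le> \<eta>" using assms by (intro ln_add_one_self_le_self) auto
    moreover have "ln \<eta> \<le> 0" using assms by simp
    ultimately show ?thesis using assms by linarith
  qed
  have "y * (ln (u + \<eta>) - ln (v + \<eta>)) \<le> \<bar>x - y\<bar> + \<bar>s - t\<bar>"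
  proof -
    have "ln (u + \<eta>) - ln (v + \<eta>) \<le> ((u + \<eta>) - (v + \<eta>)) / (v + \<eta>)"
      using u v assms by (intro ln_diff_le) auto
    then have "y * (ln (u + \<eta>) - ln (v + \<eta>)) \<le> y * ((u - v) / (v + \<eta>))"
      using assms by (intro mult_left_mono) auto
    \<comment> \<open>The factor \<open>y = v * t\<close> absorbs the denominator, since
      \<open>v / (v + \<eta>)\<close> is at most 1. Hence the coefficient of
      \<open>\<bar>s - t\<bar>\<close> does not grow as \<open>\<eta>\<close> shrinks.\<close>
    also have "\<dots> \<le> max 0 (t * (u - v))"
    proof (cases "u \<le> v")
      case True
      then have "y * ((u - v) / (v + \<eta>)) \<le> 0"
        using assms v by (intro mult_nonneg_nonpos divide_nonpos_pos) auto
      then show ?thesis by simp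
    next
      case False
      have "y * ((u - v) / (v + \<eta>)) = t * (u - v) * (v / (v + \<eta>))"
        using vt by (simp add: field_simps)
      also have "\<dots> \<le> t * (u - v) * 1"
        using v assms False by (intro mult_left_mono) (auto simp: divide_le_eq_1)
      finally show ?thesis by simp
    qed
    also have "t * (u - v) = (x - y) + u * (t - s)"
      using us vt by (simp add: algebra_simps)
    also have "\<dots> \<le> \<bar>x - y\<bar> + \<bar>s - t\<bar>"
    proof -
      have "u * (t - s) \<le> \<bar>u * (t - s)\<bar>" by simp
      also have "\<dots> \<le> 1 * \<bar>t - s\<bar>" unfolding abs_mult using u by (intro mult_right_mono) auto
      also have "\<dots> = \<bar>s - t\<bar>" by (simp add: abs_minus_commute)
      finally show ?thesis by (intro add_mono) auto
    qed
    finally show ?thesis by simp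
  qed
  moreover have "(x - y) * ln (u + \<eta>) \<le> \<bar>x - y\<bar> * (- ln \<eta> + \<eta>)"
  proof -
    have "(x - y) * ln (u + \<eta>) \<le> \<bar>(x - y) * ln (u + \<eta>)\<bar>" by simp
    also have "\<dots> \<le> \<bar>x - y\<bar> * (- ln \<eta> + \<eta>)" unfolding abs_mult by (intro mult_left_mono ln1) auto
    finally show ?thesis .
  qed
  ultimately have "x * ln (u + \<eta>) \<le> y * ln (v + \<eta>) + (1 - ln \<eta> + \<eta>) * \<bar>x - y\<bar> + \<bar>s - t\<bar>"
    by (simp add: algebra_simps)
  with up down show ?thesis by (simp add: u_def v_def)
qed

text \<open>Hahn decomposition: the labels split by the sign of the difference, and on each half the
  sum is a difference of probabilities of a single event type, at most \<open>c\<close>. Hence the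
  factor 2.\<close>

lemma (in prob_space) sum_abs_label_diff_le:
  assumes l: "l \<in> measurable M (count_space UNIV)" and l': "l' \<in> measurable M (count_space UNIV)"
    and a: "a \<in> events"
    and tv: "\<And>J. \<bar>prob {\<omega>\<in>a. l \<omega> \<in> J} - prob {\<omega>\<in>a. l' \<omega> \<in> J}\<bar> \<le> c"
  shows "(\<Sum>j<k::nat. \<bar>prob {\<omega>\<in>a. l \<omega> = j} - prob {\<omega>\<in>a. l' \<omega> = j}\<bar>) \<le> 2 * c"
proof -
  define d where "d j = prob {\<omega>\<in>a. l \<omega> = j} - prob {\<omega>\<in>a. l' \<omega> = j}" for j
  define Jp where "Jp = {j. j < k \<and> d j \<ge> 0}"
  define Jn where "Jn = {j. j < k \<and> d j < 0}"
  have ms: "{\<omega>\<in>a. l \<omega> = j} \<in> events" "{\<omega>\<in>a. l' \<omega> = j} \<in> events" for j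
  proof -
    have "{\<omega>\<in>a. l \<omega> = j} = a \<inter> (l -` {j} \<inter> space M)" "{\<omega>\<in>a. l' \<omega> = j} = a \<inter> (l' -` {j} \<inter> space M)"
      using sets.sets_into_space[OF a] by auto
    then show "{\<omega>\<in>a. l \<omega> = j} \<in> events" "{\<omega>\<in>a. l' \<omega> = j} \<in> events"
      using a measurable_sets[OF l] measurable_sets[OF l'] by auto
  qed
  have sum_eq: "(\<Sum>j\<in>J. d j) = prob {\<omega>\<in>a. l \<omega> \<in> J} - prob {\<omega>\<in>a. l' \<omega> \<in> J}" if "finite J" for J
  proof -
    have "prob (\<Union>j\<in>J. {\<omega>\<in>a. l \<omega> = j}) = (\<Sum>j\<in>J. prob {\<omega>\<in>a. l \<omega> = j})"
      using that ms by (intro finite_measure_finite_Union) (auto simp: disjoint_family_on_def)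
    moreover have "prob (\<Union>j\<in>J. {\<omega>\<in>a. l' \<omega> = j}) = (\<Sum>j\<in>J. prob {\<omega>\<in>a. l' \<omega> = j})"
      using that ms by (intro finite_measure_finite_Union) (auto simp: disjoint_family_on_def)
    moreover have "(\<Union>j\<in>J. {\<omega>\<in>a. l \<omega> = j}) = {\<omega>\<in>a. l \<omega> \<in> J}" "(\<Union>j\<in>J. {\<omega>\<in>a. l' \<omega> = j}) = {\<omega>\<in>a. l' \<omega> \<in> J}"
      by auto
    ultimately show ?thesis by (simp add: d_def sum_subtractf)
  qed
  have "(\<Sum>j<k. \<bar>d j\<bar>) = (\<Sum>j\<in>Jp \<union> Jn. \<bar>d j\<bar>)"
    by (intro sum.cong) (auto simp: Jp_def Jn_def)
  also have "\<dots> = (\<Sum>j\<in>Jp. \<bar>d j\<bar>) + (\<Sum>j\<in>Jn. \<bar>d j\<bar>)"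
    by (rule sum.union_disjoint) (auto simp: Jp_def Jn_def)
  also have "\<dots> = (\<Sum>j\<in>Jp. d j) + (\<Sum>j\<in>Jn. - d j)"
    by (intro arg_cong2[where f="(+)"] sum.cong refl) (auto simp: Jp_def Jn_def)
  also have "\<dots> \<le> c + c"
    using tv[of Jp] tv[of Jn] by (intro add_mono) (auto simp: sum_negf sum_eq Jp_def Jn_def)
  finally show ?thesis by (simp add: d_def)
qed

text \<open>The cells of \<open>\<xi>\<close> are treated one by one, which costs the factor
  \<open>N\<close>; the number \<open>k\<close> of labels does not enter. The whole space is among
  the test events because the marginal law of the label changes too. The coefficient of
  \<open>c\<close> collects \<open>2 * (1 - ln \<eta> + \<eta>)\<close> from the joint probabilities
  and 2 from the marginals.\<close>

lemma (in prob_space) label_sum_le: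
  assumes l: "l \<in> measurable M (count_space UNIV)" and l': "l' \<in> measurable M (count_space UNIV)"
    and k: "\<And>\<omega>. \<omega> \<in> space M \<Longrightarrow> l \<omega> < k" "\<And>\<omega>. \<omega> \<in> space M \<Longrightarrow> l' \<omega> < k"
    and \<xi>: "finite \<xi>" "\<xi> \<subseteq> events" "card \<xi> \<le> N"
    and \<eta>: "0 < \<eta>" "\<eta> < 1" and c: "0 \<le> c"
    and tv: "\<And>a J. a \<in> insert (space M) \<xi> \<Longrightarrow>
      \<bar>prob {\<omega>\<in>a. l \<omega> \<in> J} - prob {\<omega>\<in>a. l' \<omega> \<in> J}\<bar> \<le> c"
  shows "label_sum M \<xi> k l \<le> label_sum M \<xi> k l' + N * (\<eta> + 2 * (2 - ln \<eta> + \<eta>) * c)"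
proof -
  define b b' where "b j = {\<omega>\<in>space M. l \<omega> = j}" and "b' j = {\<omega>\<in>space M. l' \<omega> = j}" for j
  have bm: "b j \<in> events" "b' j \<in> events" for j
    using measurable_sets[OF l, of "{j}"] measurable_sets[OF l', of "{j}"]
    by (auto simp: b_def b'_def vimage_def Int_def conj_commute)
  define D where "D a = (\<Sum>j<k. \<bar>prob (a \<inter> b j) - prob (a \<inter> b' j)\<bar>)" for a
  have D: "D a \<le> 2 * c" if "a \<in> insert (space M) \<xi>" for a
  proof -
    have a: "a \<in> events" using that \<xi> by auto
    have "a \<inter> b j = {\<omega>\<in>a. l \<omega> = j}" "a \<inter> b' j = {\<omega>\<in>a. l' \<omega> = j}" for j
      using sets.sets_into_space[OF a] by (auto simp: b_def b'_def)
    then show ?thesis unfolding D_def using sum_abs_label_diff_le[OF l l' a tv[OF that]] by simp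
  qed
  have inner: "(\<Sum>j<k. prob (a \<inter> b j) * ln (prob (a \<inter> b j) / (prob a * prob (b j))))
     \<le> (\<Sum>j<k. prob (a \<inter> b' j) * ln (prob (a \<inter> b' j) / (prob a * prob (b' j))))
       + (\<eta> + 2 * (2 - ln \<eta> + \<eta>) * c)" if a: "a \<in> \<xi>" for a
  proof -
    have ae: "a \<in> events" using a \<xi> by auto
    \<comment> \<open>Takes \<open>prob a\<close> out of the logarithm. Summed over the labels this
      part is \<open>prob a * ln (prob a)\<close> for both labels and cancels.\<close>
    have split: "prob (a \<inter> d) * ln (prob (a \<inter> d) / (prob a * prob d)) =
        prob (a \<inter> d) * ln (prob (a \<inter> d) / prob d) - prob (a \<inter> d) * ln (prob a)"
      if d: "d \<in> events" for d
    proof (cases "prob (a \<inter> d) = 0")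
      case False
      have "prob (a \<inter> d) \<le> prob a" "prob (a \<inter> d) \<le> prob d"
        using ae d by (auto intro!: finite_measure_mono)
      then have pos: "prob (a \<inter> d) > 0" "prob a > 0" "prob d > 0"
        using False measure_nonneg[of M "a \<inter> d"] by linarith+
      have "prob (a \<inter> d) / (prob a * prob d) = prob (a \<inter> d) / prob d / prob a" by simp
      then have "ln (prob (a \<inter> d) / (prob a * prob d)) = ln (prob (a \<inter> d) / prob d) - ln (prob a)"
        using pos by (simp add: ln_div ln_mult)
      then show ?thesis by (simp add: right_diff_distrib)
    qed simp
    have tot: "(\<Sum>j<k. prob (a \<inter> d j)) = prob a"
      if "\<And>j. d j \<in> events" "disjoint_family d" "(\<Union>j<k. d j) = space M" for d
    proof -
      have "prob (\<Union>j<k. a \<inter> d j) = (\<Sum>j<k. prob (a \<inter> d j))"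
        using that ae by (intro finite_measure_finite_Union) (auto simp: disjoint_family_on_def)
      moreover have "(\<Union>j<k. a \<inter> d j) = a" using that(3) sets.sets_into_space[OF ae] by auto
      ultimately show ?thesis by simp
    qed
    have tb: "(\<Sum>j<k. prob (a \<inter> b j)) = prob a"
      by (rule tot) (use bm k in \<open>auto simp: disjoint_family_on_def b_def\<close>)
    have tb': "(\<Sum>j<k. prob (a \<inter> b' j)) = prob a"
      by (rule tot) (use bm k in \<open>auto simp: disjoint_family_on_def b'_def\<close>)
    have t1': "(\<Sum>j<k. prob (b' j)) = 1"
    proof -
      have "prob (\<Union>j<k. b' j) = (\<Sum>j<k. prob (b' j))"
        using bm by (intro finite_measure_finite_Union) (auto simp: disjoint_family_on_def b'_def)
      moreover have "(\<Union>j<k. b' j) = space M" using k by (auto simp: b'_def)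
      ultimately show ?thesis by (simp add: prob_space)
    qed
    have ds: "(\<Sum>j<k. \<bar>prob (b j) - prob (b' j)\<bar>) = D (space M)"
      unfolding D_def using sets.sets_into_space[OF bm(1)] sets.sets_into_space[OF bm(2)]
      by (simp add: Int_absorb1)
    have "(\<Sum>j<k. prob (a \<inter> b j) * ln (prob (a \<inter> b j) / prob (b j)))
      \<le> (\<Sum>j<k. prob (a \<inter> b' j) * ln (prob (a \<inter> b' j) / prob (b' j)) + \<eta> * prob (b' j)
          + (1 - ln \<eta> + \<eta>) * \<bar>prob (a \<inter> b j) - prob (a \<inter> b' j)\<bar> + \<bar>prob (b j) - prob (b' j)\<bar>)"
      using \<eta> bm ae by (intro sum_mono mult_ln_ratio_le) (auto intro!: finite_measure_mono)
    also have "\<dots> = (\<Sum>j<k. prob (a \<inter> b' j) * ln (prob (a \<inter> b' j) / prob (b' j))) + \<eta>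
        + (1 - ln \<eta> + \<eta>) * D a + D (space M)"
      unfolding sum.distrib sum_distrib_left[symmetric] t1' ds by (simp add: D_def)
    also have "\<dots> \<le> (\<Sum>j<k. prob (a \<inter> b' j) * ln (prob (a \<inter> b' j) / prob (b' j))) + \<eta>
        + (1 - ln \<eta> + \<eta>) * (2 * c) + 2 * c"
    proof -
      have "ln \<eta> \<le> 0" using \<eta> by simp
      then have "0 \<le> 1 - ln \<eta> + \<eta>" using \<eta>(1) by linarith
      then show ?thesis using D a by (intro add_mono mult_left_mono) auto
    qed
    finally show ?thesis
      unfolding split[OF bm(1)] split[OF bm(2)] sum_subtractf sum_distrib_right[symmetric] tb tb'
      by (simp add: algebra_simps)
  qed
  have nn: "0 \<le> \<eta> + 2 * (2 - ln \<eta> + \<eta>) * c"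
  proof -
    have "ln \<eta> \<le> 0" using \<eta> by simp
    then have "0 \<le> 2 - ln \<eta> + \<eta>" using \<eta>(1) by linarith
    then show ?thesis using \<eta> c by (intro add_nonneg_nonneg[OF _ mult_nonneg_nonneg[OF mult_nonneg_nonneg]]) auto
  qed
  have "label_sum M \<xi> k l \<le> (\<Sum>a\<in>\<xi>. (\<Sum>j<k. prob (a \<inter> b' j) * ln (prob (a \<inter> b' j) / (prob a * prob (b' j))))
       + (\<eta> + 2 * (2 - ln \<eta> + \<eta>) * c))"
    unfolding label_sum_def Let_def b_def[symmetric] by (intro sum_mono inner)
  also have "\<dots> = label_sum M \<xi> k l' + card \<xi> * (\<eta> + 2 * (2 - ln \<eta> + \<eta>) * c)"
    by (simp add: label_sum_def Let_def b'_def sum.distrib)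
  also have "\<dots> \<le> label_sum M \<xi> k l' + N * (\<eta> + 2 * (2 - ln \<eta> + \<eta>) * c)"
    using \<xi>(3) nn by (intro add_left_mono mult_right_mono) auto
  finally show ?thesis .
qed

text \<open>A modulus of continuity in total variation: a single \<open>c\<close> has to serve all
  pairs of labels, all \<open>k\<close>, and all partitions with at most \<open>N\<close>
  cells.\<close>

definition (in prob_space) label_sum_modulus :: "nat \<Rightarrow> real \<Rightarrow> real \<Rightarrow> bool" where
  "label_sum_modulus N \<epsilon> c \<longleftrightarrow> (\<forall>(l :: 'a \<Rightarrow> nat) l' k \<xi>.
      l \<in> measurable M (count_space UNIV) \<longrightarrow> l' \<in> measurable M (count_space UNIV) \<longrightarrow>
      (\<forall>\<omega>\<in>space M. l \<omega> < k) \<longrightarrow> (\<forall>\<omega>\<in>space M. l' \<omega> < k) \<longrightarrow>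
      finite \<xi> \<longrightarrow> \<xi> \<subseteq> events \<longrightarrow> card \<xi> \<le> N \<longrightarrow>
      (\<forall>a\<in>insert (space M) \<xi>. \<forall>J. \<bar>prob {\<omega>\<in>a. l \<omega> \<in> J} - prob {\<omega>\<in>a. l' \<omega> \<in> J}\<bar> \<le> c) \<longrightarrow>
      label_sum M \<xi> k l \<le> label_sum M \<xi> k l' + \<epsilon>)"

lemma (in prob_space) label_sum_modulusD:
  assumes "label_sum_modulus N \<epsilon> c"
    and "l \<in> measurable M (count_space UNIV)" "l' \<in> measurable M (count_space UNIV)"
    and "\<And>\<omega>. \<omega> \<in> space M \<Longrightarrow> l \<omega> < k" "\<And>\<omega>. \<omega> \<in> space M \<Longrightarrow> l' \<omega> < k"
    and "finite \<xi>" "\<xi> \<subseteq> events" "card \<xi> \<le> N"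
    and "\<And>a J. a \<in> insert (space M) \<xi> \<Longrightarrow>
      \<bar>prob {\<omega>\<in>a. l \<omega> \<in> J} - prob {\<omega>\<in>a. l' \<omega> \<in> J}\<bar> \<le> c"
  shows "label_sum M \<xi> k l \<le> label_sum M \<xi> k l' + \<epsilon>"
  by (rule assms(1)[unfolded label_sum_modulus_def, rule_format]) (use assms(2-) in blast)+

lemma (in prob_space) label_sum_modulus_exists:
  assumes "0 < \<epsilon>"
  obtains c where "0 < c" "label_sum_modulus N \<epsilon> c"
proof -
  \<comment> \<open>\<open>\<eta>\<close> is fixed before \<open>c\<close> because the coefficient
    of \<open>c\<close> contains \<open>- ln \<eta>\<close>; each of the two error terms then gets
    half of \<open>\<epsilon>\<close>. The 1 added to \<open>N\<close> covers
    \<open>N = 0\<close>.\<close>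
  define \<eta> where "\<eta> = min (1/2) (\<epsilon> / (2 * (real N + 1)))"
  have \<eta>: "0 < \<eta>" "\<eta> < 1" "\<eta> \<le> \<epsilon> / (2 * (real N + 1))" using assms by (auto simp: \<eta>_def)
  define K where "K = 2 * (2 - ln \<eta> + \<eta>)"
  have "ln \<eta> < 0" using \<eta> by simp
  then have K: "K > 0" unfolding K_def using \<eta>(1) by (intro mult_pos_pos) linarith+
  define c where "c = \<epsilon> / (2 * (real N + 1) * K)"
  have c: "c > 0" using assms K by (simp add: c_def)
  have "real N * (\<eta> + K * c) \<le> real N * (\<epsilon> / (2 * (real N + 1)) + \<epsilon> / (2 * (real N + 1)))"
    using \<eta> K by (intro mult_left_mono add_mono) (auto simp: c_def)
  also have "\<dots> = real N * (\<epsilon> / (real N + 1))"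
    using field_sum_of_halves[of "\<epsilon> / (real N + 1)"] by (simp add: mult.commute)
  also have "\<dots> \<le> \<epsilon>" using assms by (simp add: field_simps)
  finally have le: "real N * (\<eta> + 2 * (2 - ln \<eta> + \<eta>) * c) \<le> \<epsilon>" by (simp add: K_def)
  have "label_sum_modulus N \<epsilon> c"
    unfolding label_sum_modulus_def
  proof (intro allI impI)
    fix l l' :: "'a \<Rightarrow> nat" and k \<xi>
    assume *: "l \<in> measurable M (count_space UNIV)" "l' \<in> measurable M (count_space UNIV)"
      "\<forall>\<omega>\<in>space M. l \<omega> < k" "\<forall>\<omega>\<in>space M. l' \<omega> < k"
      "finite \<xi>" "\<xi> \<subseteq> events" "card \<xi> \<le> N"
      "\<forall>a\<in>insert (space M) \<xi>. \<forall>J. \<bar>prob {\<omega>\<in>a. l \<omega> \<in> J} - prob {\<omega>\<in>a. l' \<omega> \<in> J}\<bar> \<le> c"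
    have "label_sum M \<xi> k l \<le> label_sum M \<xi> k l' + real N * (\<eta> + 2 * (2 - ln \<eta> + \<eta>) * c)"
      by (rule label_sum_le[OF *(1,2) _ _ *(5-7) \<eta>(1,2) less_imp_le[OF c]]) (use *(3,4,8) in blast)+
    with le show "label_sum M \<xi> k l \<le> label_sum M \<xi> k l' + \<epsilon>" by linarith
  qed
  with c show ?thesis by (rule that)
qed


section \<open>Approximation of events along convergent sequences\<close>

lemma (in prob_space) prob_tendsto_0_if_eventually_notin:
  assumes [measurable]: "\<And>n. D n \<in> events"
    and "AE \<omega> in M. \<forall>\<^sub>F n in sequentially. \<omega> \<notin> D n"
  shows "(\<lambda>n. prob (D n)) \<longlonglongrightarrow> 0"
proof -
  have "(\<lambda>n. \<integral>\<omega>. indicator (D n) \<omega> \<partial>M) \<longlonglongrightarrow> (\<integral>\<omega>. 0 \<partial>M :: real)"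
  proof (rule integral_dominated_convergence[where w="\<lambda>_. 1"])
    show "AE \<omega> in M. (\<lambda>n. indicator (D n) \<omega> :: real) \<longlonglongrightarrow> 0"
      using assms(2)
    proof eventually_elim
      case (elim \<omega>)
      then show ?case
        by (intro tendsto_eventually) (auto elim!: eventually_mono)
    qed
  qed (auto simp: indicator_def)
  then show ?thesis by simp
qed

lemma borel_measurable_infdist:
  "(\<lambda>x::'b::metric_space. infdist x S) \<in> borel_measurable borel"
  by (intro borel_measurable_continuous_onI continuous_on_infdist continuous_on_id)

text \<open>The sequence may lie in \<open>U\<close> while its limit sits on the boundary, so
  \<open>U\<close> is shrunk to the points at distance more than \<open>1 / Suc j\<close> from its
  complement. Off the shell \<open>D j\<close>, the distance of the limit is strictly on one side of
  \<open>1 / Suc j\<close>, so the sequence ends up on that side; the probability of the shell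
  vanishes with \<open>j\<close>. As \<open>infdist\<close> to the empty set is 0,
  \<open>U = UNIV\<close> has to be singled out.\<close>

lemma (in prob_space) eventually_prob_symdiff_open:
  fixes Z :: "'a \<Rightarrow> 'b::metric_space"
  assumes [measurable]: "\<And>n. Zn n \<in> borel_measurable M" "Z \<in> borel_measurable M"
    and lim: "\<And>\<omega>. \<omega> \<in> space M \<Longrightarrow> (\<lambda>n. Zn n \<omega>) \<longlonglongrightarrow> Z \<omega>"
    and U: "open U" and \<eta>: "0 < \<eta>"
  shows "\<forall>\<^sub>F j in sequentially. \<forall>\<^sub>F n in sequentially.
    prob {\<omega>\<in>space M. (Z \<omega> \<in> U) \<noteq> (infdist (Zn n \<omega>) (- U) > 1 / Suc j \<or> U = UNIV)} < \<eta>"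
proof (cases "U = UNIV")
  case False
  have [measurable]: "U \<in> sets borel" using U by simp
  note [measurable] = borel_measurable_infdist[of "- U"]
  define D where "D j = {\<omega>\<in>space M. Z \<omega> \<in> U \<and> infdist (Z \<omega>) (- U) \<le> 1 / Suc j}" for j
  have [measurable]: "D j \<in> events" for j unfolding D_def by measurable
  have pos: "infdist x (- U) > 0 \<longleftrightarrow> x \<in> U" for x
  proof -
    have "infdist x (- U) = 0 \<longleftrightarrow> x \<in> - U"
      using U False by (intro in_closed_iff_infdist_zero[symmetric]) (auto simp: closed_def)
    then show ?thesis using infdist_nonneg[of x "- U"] by auto
  qed
  have "(\<lambda>j. prob (D j)) \<longlonglongrightarrow> 0"
  proof (rule prob_tendsto_0_if_eventually_notin)
    show "AE \<omega> in M. \<forall>\<^sub>F j in sequentially. \<omega> \<notin> D j"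
    proof (rule AE_I2)
      fix \<omega> assume "\<omega> \<in> space M"
      show "\<forall>\<^sub>F j in sequentially. \<omega> \<notin> D j"
      proof (cases "Z \<omega> \<in> U")
        case True
        then have "infdist (Z \<omega>) (- U) > 0" using pos by auto
        then have "\<forall>\<^sub>F j in sequentially. 1 / Suc j < infdist (Z \<omega>) (- U)"
          using LIMSEQ_inverse_real_of_nat[THEN order_tendstoD(2)] by (simp add: inverse_eq_divide)
        then show ?thesis by eventually_elim (auto simp: D_def)
      qed (auto simp: D_def)
    qed
  qed auto
  then have "\<forall>\<^sub>F j in sequentially. prob (D j) < \<eta> / 2"
    using \<eta> by (auto dest: order_tendstoD(2)[where a="\<eta>/2"])
  then show ?thesis
  proof eventually_elim
    case (elim j)
    define S where "S n = {\<omega>\<in>space M. \<omega> \<notin> D j \<and> (Z \<omega> \<in> U) \<noteq> (infdist (Zn n \<omega>) (- U) > 1 / Suc j)}" for n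
    have [measurable]: "S n \<in> events" for n unfolding S_def by measurable
    have "(\<lambda>n. prob (S n)) \<longlonglongrightarrow> 0"
    proof (rule prob_tendsto_0_if_eventually_notin)
      show "AE \<omega> in M. \<forall>\<^sub>F n in sequentially. \<omega> \<notin> S n"
      proof (rule AE_I2)
        fix \<omega> assume \<omega>: "\<omega> \<in> space M"
        have t: "(\<lambda>n. infdist (Zn n \<omega>) (- U)) \<longlonglongrightarrow> infdist (Z \<omega>) (- U)"
          by (intro tendsto_infdist lim \<omega>)
        show "\<forall>\<^sub>F n in sequentially. \<omega> \<notin> S n"
        proof (cases "\<omega> \<in> D j")
          case nD: False
          show ?thesis
          proof (cases "Z \<omega> \<in> U")
            case True
            then have "infdist (Z \<omega>) (- U) > 1 / Suc j" using nD \<omega> by (auto simp: D_def)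
            from order_tendstoD(1)[OF t this] show ?thesis
              by eventually_elim (use True in \<open>auto simp: S_def\<close>)
          next
            case F: False
            then have "infdist (Z \<omega>) (- U) \<le> 0" using pos[of "Z \<omega>"] by simp
            then have "infdist (Z \<omega>) (- U) < 1 / Suc j"
              by (rule le_less_trans) simp
            from order_tendstoD(2)[OF t this] show ?thesis
              by eventually_elim (use F in \<open>auto simp: S_def\<close>)
          qed
        qed (auto simp: S_def)
      qed
    qed auto
    then have "\<forall>\<^sub>F n in sequentially. prob (S n) < \<eta> / 2"
      using \<eta> by (auto dest: order_tendstoD(2)[where a="\<eta>/2"])
    then show ?case
    proof eventually_elim
      case (elim n)
      have "prob {\<omega>\<in>space M. (Z \<omega> \<in> U) \<noteq> (infdist (Zn n \<omega>) (- U) > 1 / Suc j \<or> U = UNIV)} \<le> prob (D j \<union> S n)"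
        using False by (intro finite_measure_mono) (auto simp: S_def)
      also have "\<dots> \<le> prob (D j) + prob (S n)" by (intro measure_Un_le) auto
      finally show ?case using elim \<open>prob (D j) < \<eta> / 2\<close> by linarith
    qed
  qed
qed (use \<eta> in auto)

text \<open>Two sequences are treated at once because the same approximating set has to serve both.\<close>

lemma (in prob_space) borel_set_approx_along_convergent:
  fixes Z W :: "'a \<Rightarrow> 'b::metric_space"
  assumes Zm[measurable]: "\<And>n. Zn n \<in> borel_measurable M" "Z \<in> borel_measurable M"
    and Wm[measurable]: "\<And>n. Wn n \<in> borel_measurable M" "W \<in> borel_measurable M"
    and lim: "\<And>\<omega>. \<omega> \<in> space M \<Longrightarrow> (\<lambda>n. Zn n \<omega>) \<longlonglongrightarrow> Z \<omega>"
      "\<And>\<omega>. \<omega> \<in> space M \<Longrightarrow> (\<lambda>n. Wn n \<omega>) \<longlonglongrightarrow> W \<omega>"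
    and E: "E \<in> sets borel" and \<eta>: "0 < \<eta>"
  shows "\<exists>E'\<in>sets borel. \<forall>\<^sub>F n in sequentially.
    prob {\<omega>\<in>space M. (Z \<omega> \<in> E) \<noteq> (Zn n \<omega> \<in> E')} < \<eta> \<and>
    prob {\<omega>\<in>space M. (W \<omega> \<in> E) \<noteq> (Wn n \<omega> \<in> E')} < \<eta>"
proof -
  \<comment> \<open>The sets that can be approximated to every tolerance form a sigma-algebra, so it
    is enough to treat open sets.\<close>
  have "E \<in> sigma_sets UNIV {S. open S}" using E by (simp add: borel_def)
  then show ?thesis using \<eta>
  proof (induction arbitrary: \<eta>)
    case (Basic U)
    then have U: "open U" by simp
    have "\<forall>\<^sub>F j in sequentially. (\<forall>\<^sub>F n in sequentially.
      prob {\<omega>\<in>space M. (Z \<omega> \<in> U) \<noteq> (infdist (Zn n \<omega>) (- U) > 1 / Suc j \<or> U = UNIV)} < \<eta>) \<and>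
      (\<forall>\<^sub>F n in sequentially.
      prob {\<omega>\<in>space M. (W \<omega> \<in> U) \<noteq> (infdist (Wn n \<omega>) (- U) > 1 / Suc j \<or> U = UNIV)} < \<eta>)"
      using eventually_prob_symdiff_open[OF Zm lim(1) U \<open>0 < \<eta>\<close>]
        eventually_prob_symdiff_open[OF Wm lim(2) U \<open>0 < \<eta>\<close>]
      by (rule eventually_conj)
    then obtain j where j: "\<forall>\<^sub>F n in sequentially.
      prob {\<omega>\<in>space M. (Z \<omega> \<in> U) \<noteq> (infdist (Zn n \<omega>) (- U) > 1 / Suc j \<or> U = UNIV)} < \<eta>"
      "\<forall>\<^sub>F n in sequentially.
      prob {\<omega>\<in>space M. (W \<omega> \<in> U) \<noteq> (infdist (Wn n \<omega>) (- U) > 1 / Suc j \<or> U = UNIV)} < \<eta>"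
      using eventually_happens' sequentially_bot by blast
    note [measurable] = borel_measurable_infdist[of "- U"]
    have m: "{x. infdist x (- U) > 1 / Suc j \<or> U = UNIV} \<in> sets borel"
      by measurable
    show ?case
      by (rule bexI[OF _ m]) (use eventually_conj[OF j] in simp)
  next
    case Empty
    then show ?case by (intro bexI[of _ "{}"]) auto
  next
    case (Compl E)
    then obtain E' where "E' \<in> sets borel" "\<forall>\<^sub>F n in sequentially.
      prob {\<omega>\<in>space M. (Z \<omega> \<in> E) \<noteq> (Zn n \<omega> \<in> E')} < \<eta> \<and>
      prob {\<omega>\<in>space M. (W \<omega> \<in> E) \<noteq> (Wn n \<omega> \<in> E')} < \<eta>" by meson
    then show ?case by (intro bexI[of _ "- E'"]) auto
  next
    case (Union A)
    have Am[measurable]: "A i \<in> sets borel" for i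
      using Union(1)[of i] by (simp add: borel_def)
    \<comment> \<open>The countable union is cut off after \<open>K\<close> sets at the cost of
      \<open>tail\<close>; the \<open>K\<close> remaining errors, each below
      \<open>\<delta>\<close>, use the other half of the tolerance.\<close>
    define tail where "tail X K = {\<omega>\<in>space M. (\<exists>i. X \<omega> \<in> A i) \<and> (\<forall>i<K. X \<omega> \<notin> A i)}" for X K
    have [measurable]: "tail X K \<in> events" if [measurable]: "X \<in> borel_measurable M" for X K
      unfolding tail_def by measurable
    have t0: "(\<lambda>K. prob (tail X K)) \<longlonglongrightarrow> 0" if [measurable]: "X \<in> borel_measurable M" for X
    proof (rule prob_tendsto_0_if_eventually_notin)
      show "AE \<omega> in M. \<forall>\<^sub>F K in sequentially. \<omega> \<notin> tail X K"
      proof (rule AE_I2)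
        fix \<omega>
        show "\<forall>\<^sub>F K in sequentially. \<omega> \<notin> tail X K"
        proof (cases "\<exists>i. X \<omega> \<in> A i")
          case True
          then obtain i where "X \<omega> \<in> A i" ..
          from eventually_ge_at_top[of "Suc i"] show ?thesis
            by eventually_elim (use \<open>X \<omega> \<in> A i\<close> in \<open>auto simp: tail_def Suc_le_eq\<close>)
        qed (auto simp: tail_def)
      qed
    qed (use that in auto)
    have "\<forall>\<^sub>F K in sequentially. prob (tail Z K) < \<eta> / 2 \<and> prob (tail W K) < \<eta> / 2"
      using \<open>0 < \<eta>\<close> t0[OF Zm(2)] t0[OF Wm(2)]
      by (intro eventually_conj order_tendstoD(2)) auto
    then obtain K where K: "prob (tail Z K) < \<eta> / 2" "prob (tail W K) < \<eta> / 2"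
      by (auto simp: eventually_sequentially)
    define \<delta> where "\<delta> = \<eta> / (2 * (real K + 1))"
    have \<delta>: "\<delta> > 0" "real K * \<delta> \<le> \<eta> / 2" using \<open>0 < \<eta>\<close> by (auto simp: \<delta>_def field_simps)
    have "\<forall>i. \<exists>E'. E' \<in> sets borel \<and> (\<forall>\<^sub>F n in sequentially.
      prob {\<omega>\<in>space M. (Z \<omega> \<in> A i) \<noteq> (Zn n \<omega> \<in> E')} < \<delta> \<and>
      prob {\<omega>\<in>space M. (W \<omega> \<in> A i) \<noteq> (Wn n \<omega> \<in> E')} < \<delta>)"
      using Union.IH[OF \<delta>(1)] unfolding Bex_def by (rule allI)
    then obtain E' where E': "\<And>i. E' i \<in> sets borel" "\<And>i. \<forall>\<^sub>F n in sequentially.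
      prob {\<omega>\<in>space M. (Z \<omega> \<in> A i) \<noteq> (Zn n \<omega> \<in> E' i)} < \<delta> \<and>
      prob {\<omega>\<in>space M. (W \<omega> \<in> A i) \<noteq> (Wn n \<omega> \<in> E' i)} < \<delta>"
      unfolding choice_iff by auto
    note [measurable] = E'(1)
    have bound: "prob {\<omega>\<in>space M. (X \<omega> \<in> (\<Union>i. A i)) \<noteq> (X' \<omega> \<in> (\<Union>i<K. E' i))} < \<eta>"
      if [measurable]: "X \<in> borel_measurable M" "X' \<in> borel_measurable M"
        and t: "prob (tail X K) < \<eta> / 2"
        and d: "\<And>i. i < K \<Longrightarrow> prob {\<omega>\<in>space M. (X \<omega> \<in> A i) \<noteq> (X' \<omega> \<in> E' i)} < \<delta>" for X X'
    proof -
      define Di where "Di i = {\<omega>\<in>space M. (X \<omega> \<in> A i) \<noteq> (X' \<omega> \<in> E' i)}" for i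
      have [measurable]: "Di i \<in> events" for i unfolding Di_def by measurable
      have "prob {\<omega>\<in>space M. (X \<omega> \<in> (\<Union>i. A i)) \<noteq> (X' \<omega> \<in> (\<Union>i<K. E' i))}
          \<le> prob (tail X K \<union> (\<Union>i<K. Di i))"
        by (intro finite_measure_mono) (auto simp: tail_def Di_def)
      also have "\<dots> \<le> prob (tail X K) + prob (\<Union>i<K. Di i)"
        by (intro measure_Un_le) auto
      also have "prob (\<Union>i<K. Di i) \<le> (\<Sum>i<K. prob (Di i))"
        by (intro finite_measure_subadditive_finite) auto
      also have "\<dots> \<le> (\<Sum>i<K. \<delta>)"
        using d by (intro sum_mono) (auto simp: Di_def intro: less_imp_le)
      finally show ?thesis using t \<delta>(2) by simp
    qed
    have "\<forall>\<^sub>F n in sequentially. \<forall>i\<in>{..<K}.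
      prob {\<omega>\<in>space M. (Z \<omega> \<in> A i) \<noteq> (Zn n \<omega> \<in> E' i)} < \<delta> \<and>
      prob {\<omega>\<in>space M. (W \<omega> \<in> A i) \<noteq> (Wn n \<omega> \<in> E' i)} < \<delta>"
      using E'(2) by (intro eventually_ball_finite) auto
    then have "\<forall>\<^sub>F n in sequentially.
      prob {\<omega>\<in>space M. (Z \<omega> \<in> (\<Union>i. A i)) \<noteq> (Zn n \<omega> \<in> (\<Union>i<K. E' i))} < \<eta> \<and>
      prob {\<omega>\<in>space M. (W \<omega> \<in> (\<Union>i. A i)) \<noteq> (Wn n \<omega> \<in> (\<Union>i<K. E' i))} < \<eta>"
      by eventually_elim (intro conjI bound K Zm Wm, auto)
    then show ?case by (rule bexI) measurable
  qed
qed

lemma (in prob_space) label_approx_along_convergent: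
  fixes Z :: "'a \<Rightarrow> 'b::metric_space" and e :: "'b \<Rightarrow> nat"
  assumes Zm[measurable]: "\<And>n. Zn n \<in> borel_measurable M" "Z \<in> borel_measurable M"
    and lim: "\<And>\<omega>. \<omega> \<in> space M \<Longrightarrow> (\<lambda>n. Zn n \<omega>) \<longlonglongrightarrow> Z \<omega>"
    and e[measurable]: "e \<in> measurable borel (count_space UNIV)" and k: "\<And>x. e x < k"
    and \<eta>: "0 < \<eta>"
  obtains e' :: "'b \<Rightarrow> nat" where "e' \<in> measurable borel (count_space UNIV)" "\<forall>x. e' x < k"
    "\<forall>\<^sub>F n in sequentially. prob {\<omega>\<in>space M. e (Z \<omega>) \<noteq> e' (Zn n \<omega>)} < \<eta>"
proof -
  define \<delta> where "\<delta> = \<eta> / (real k + 1)"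
  have \<delta>: "\<delta> > 0" "real k * \<delta> < \<eta>" using \<eta> by (auto simp: \<delta>_def field_simps)
  have "\<forall>j. \<exists>E'. E' \<in> sets borel \<and>
    (\<forall>\<^sub>F n in sequentially. prob {\<omega>\<in>space M. (Z \<omega> \<in> e -` {j}) \<noteq> (Zn n \<omega> \<in> E')} < \<delta>)"
  proof
    fix j
    have "e -` {j} \<in> sets borel" using measurable_sets[OF e, of "{j}"] by simp
    then have "\<exists>E'\<in>sets borel. \<forall>\<^sub>F n in sequentially.
      prob {\<omega>\<in>space M. (Z \<omega> \<in> e -` {j}) \<noteq> (Zn n \<omega> \<in> E')} < \<delta> \<and>
      prob {\<omega>\<in>space M. (Z \<omega> \<in> e -` {j}) \<noteq> (Zn n \<omega> \<in> E')} < \<delta>"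
      by (intro borel_set_approx_along_convergent Zm lim \<delta>(1))
    then show "\<exists>E'. E' \<in> sets borel \<and>
      (\<forall>\<^sub>F n in sequentially. prob {\<omega>\<in>space M. (Z \<omega> \<in> e -` {j}) \<noteq> (Zn n \<omega> \<in> E')} < \<delta>)"
      unfolding Bex_def conj_absorb .
  qed
  then obtain E' where "\<forall>j. E' j \<in> sets borel \<and>
    (\<forall>\<^sub>F n in sequentially. prob {\<omega>\<in>space M. (Z \<omega> \<in> e -` {j}) \<noteq> (Zn n \<omega> \<in> E' j)} < \<delta>)"
    by (rule exE[OF choice])
  then have E'[measurable]: "\<And>j. E' j \<in> sets borel"
    and "\<And>j. \<forall>\<^sub>F n in sequentially. prob {\<omega>\<in>space M. (Z \<omega> \<in> e -` {j}) \<noteq> (Zn n \<omega> \<in> E' j)} < \<delta>"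
    by blast+
  then have ev: "\<forall>\<^sub>F n in sequentially. \<forall>j\<in>{..<k}.
      prob {\<omega>\<in>space M. (Z \<omega> \<in> e -` {j}) \<noteq> (Zn n \<omega> \<in> E' j)} < \<delta>"
    by (intro eventually_ball_finite) auto
  \<comment> \<open>The approximating sets \<open>E' j\<close> need neither be disjoint nor cover
    the space, so the least index is taken; the default \<open>k - 1\<close> keeps the label below
    \<open>k\<close>.\<close>
  define e' where "e' x = (LEAST j. j < k \<and> x \<in> E' j \<or> j = k - 1)" for x
  have e'm[measurable]: "e' \<in> measurable borel (count_space UNIV)"
    unfolding e'_def by measurable
  have e'k: "e' x < k" for x
  proof -
    have "e' x \<le> k - 1" unfolding e'_def by (rule Least_le) simp
    then show ?thesis using k[of undefined] by simp
  qed
  have eq: "e' y = e x" if "\<And>j. j < k \<Longrightarrow> e x = j \<longleftrightarrow> y \<in> E' j" for x y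
    unfolding e'_def using that k[of x] by (intro Least_equality) auto
  show ?thesis
  proof (rule that[OF e'm allI[OF e'k]])
    show "\<forall>\<^sub>F n in sequentially. prob {\<omega>\<in>space M. e (Z \<omega>) \<noteq> e' (Zn n \<omega>)} < \<eta>"
      using ev
    proof eventually_elim
      case (elim n)
      define Di where "Di j = {\<omega>\<in>space M. (Z \<omega> \<in> e -` {j}) \<noteq> (Zn n \<omega> \<in> E' j)}" for j
      have [measurable]: "Di j \<in> events" for j unfolding Di_def vimage_singleton_eq by measurable
      have "{\<omega>\<in>space M. e (Z \<omega>) \<noteq> e' (Zn n \<omega>)} \<subseteq> (\<Union>j<k. Di j)"
      proof safe
        fix \<omega> assume "\<omega> \<in> space M" "e (Z \<omega>) \<noteq> e' (Zn n \<omega>)"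
        with eq[of "Z \<omega>" "Zn n \<omega>"] show "\<omega> \<in> (\<Union>j<k. Di j)" by (auto simp: Di_def)
      qed
      then have "prob {\<omega>\<in>space M. e (Z \<omega>) \<noteq> e' (Zn n \<omega>)} \<le> prob (\<Union>j<k. Di j)"
        by (intro finite_measure_mono) auto
      also have "\<dots> \<le> (\<Sum>j<k. prob (Di j))"
        by (intro finite_measure_subadditive_finite) auto
      also have "\<dots> \<le> (\<Sum>j<k. \<delta>)"
        using elim by (intro sum_mono) (auto simp: Di_def intro: less_imp_le)
      finally show ?case using \<delta>(2) by simp
    qed
  qed
qed


section \<open>A discrete Girsanov estimate\<close>

text \<open>\<open>U\<close> is known in \<open>G\<close> and \<open>X\<close> is independent of
  \<open>G\<close>, so their joint law is a product and \<open>X\<close> can be integrated out with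
  \<open>U\<close> frozen. This takes the place of a conditional expectation given
  \<open>G\<close>.\<close>

lemma (in prob_space) nn_integral_indep_gaussian:
  assumes G: "subalgebra M G" and X: "distributed M lborel X (\<lambda>x. ennreal (normal_density 0 \<sigma> x))"
    and ind: "indep_set (sets G) (sets (vimage_algebra (space M) X borel))"
    and U: "U \<in> measurable G S" and \<phi>[measurable]: "\<phi> \<in> borel_measurable (S \<Otimes>\<^sub>M borel)"
  shows "(\<integral>\<^sup>+\<omega>. \<phi> (U \<omega>, X \<omega>) \<partial>M) =
    (\<integral>\<^sup>+\<omega>. \<integral>\<^sup>+x. \<phi> (U \<omega>, x) * ennreal (normal_density 0 \<sigma> x) \<partial>lborel \<partial>M)"
proof -
  have Xm[measurable]: "X \<in> borel_measurable M"
    using X by (simp add: distributed_def)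
  have Um[measurable]: "U \<in> measurable M S"
    using measurable_from_subalg[OF G U] .
  interpret U: prob_space "distr M S U" by (rule prob_space_distr) simp
  interpret X: prob_space "distr M borel X" by (rule prob_space_distr) simp
  have eq: "distr M S U \<Otimes>\<^sub>M distr M borel X = distr M (S \<Otimes>\<^sub>M borel) (\<lambda>x. (U x, X x))"
  proof (rule pair_measure_eqI)
    fix A B assume "A \<in> sets (distr M S U)" "B \<in> sets (distr M borel X)"
    then have AB[measurable]: "A \<in> sets S" "B \<in> sets borel" by auto
    have "U -` A \<inter> space M \<in> sets G"
      using measurable_sets[OF U AB(1)] G by (simp add: subalgebra_def)
    moreover have "X -` B \<inter> space M \<in> sets (vimage_algebra (space M) X borel)"
      using AB(2) by (rule in_vimage_algebra)
    ultimately have "prob ((U -` A \<inter> space M) \<inter> (X -` B \<inter> space M)) =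
        prob (U -` A \<inter> space M) * prob (X -` B \<inter> space M)"
      by (rule indep_setD[OF ind])
    moreover have "(\<lambda>x. (U x, X x)) -` (A \<times> B) \<inter> space M = (U -` A \<inter> space M) \<inter> (X -` B \<inter> space M)"
      by auto
    ultimately show "emeasure (distr M S U) A * emeasure (distr M borel X) B =
        emeasure (distr M (S \<Otimes>\<^sub>M borel) (\<lambda>x. (U x, X x))) (A \<times> B)"
      by (simp add: emeasure_distr emeasure_eq_measure ennreal_mult'[symmetric])
  qed (auto intro: U.sigma_finite_measure_axioms X.sigma_finite_measure_axioms cong: sets_pair_measure_cong)
  have dX: "distr M borel X = density lborel (\<lambda>x. ennreal (normal_density 0 \<sigma> x))"
  proof -
    have "distr M borel X = distr M lborel X" by (rule distr_cong) auto
    then show ?thesis using X by (simp add: distributed_def)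
  qed
  have "(\<integral>\<^sup>+\<omega>. \<phi> (U \<omega>, X \<omega>) \<partial>M) = (\<integral>\<^sup>+p. \<phi> p \<partial>distr M (S \<Otimes>\<^sub>M borel) (\<lambda>x. (U x, X x)))"
    by (subst nn_integral_distr) auto
  also have "\<dots> = (\<integral>\<^sup>+u. \<integral>\<^sup>+x. \<phi> (u, x) \<partial>distr M borel X \<partial>distr M S U)"
    unfolding eq[symmetric] by (subst X.nn_integral_fst) auto
  also have "\<dots> = (\<integral>\<^sup>+\<omega>. \<integral>\<^sup>+x. \<phi> (U \<omega>, x) \<partial>distr M borel X \<partial>M)"
    by (subst nn_integral_distr) auto
  also have "\<dots> = (\<integral>\<^sup>+\<omega>. \<integral>\<^sup>+x. ennreal (normal_density 0 \<sigma> x) * \<phi> (U \<omega>, x) \<partial>lborel \<partial>M)"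
    unfolding dX by (intro nn_integral_cong nn_integral_density) auto
  finally show ?thesis by (simp add: mult.commute)
qed

text \<open>Cameron-Martin in one dimension: completing the square turns the weighted Gaussian
  density at \<open>x\<close> into the density at \<open>x + a * d\<close>, and Lebesgue measure is
  translation invariant.\<close>

lemma nn_integral_gaussian_shift:
  assumes [measurable]: "F \<in> borel_measurable borel" and d: "0 < d"
  shows "(\<integral>\<^sup>+x. ennreal (exp (- a * x - a\<^sup>2 * d / 2)) * F (x + a * d) * ennreal (normal_density 0 (sqrt d) x) \<partial>lborel)
    = (\<integral>\<^sup>+x. F x * ennreal (normal_density 0 (sqrt d) x) \<partial>lborel)"
proof -
  have *: "exp (- a * x - a\<^sup>2 * d / 2) * normal_density 0 (sqrt d) x = normal_density 0 (sqrt d) (x + a * d)" for x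
  proof -
    have "- a * x - a\<^sup>2 * d / 2 - x\<^sup>2 / (2 * d) = - (x + a * d)\<^sup>2 / (2 * d)"
      using d by (simp add: field_simps power2_eq_square)
    then have "exp (- a * x - a\<^sup>2 * d / 2) * exp (- x\<^sup>2 / (2 * d)) = exp (- (x + a * d)\<^sup>2 / (2 * d))"
      by (simp add: mult_exp_exp)
    then show ?thesis using d by (simp add: normal_density_def ac_simps)
  qed
  have "(\<integral>\<^sup>+x. F x * ennreal (normal_density 0 (sqrt d) x) \<partial>lborel)
      = (\<integral>\<^sup>+x. F (a * d + 1 * x) * ennreal (normal_density 0 (sqrt d) (a * d + 1 * x)) \<partial>lborel)"
    by (subst nn_integral_real_affine[of _ 1 "a * d"]) auto
  also have "\<dots> = (\<integral>\<^sup>+x. ennreal (exp (- a * x - a\<^sup>2 * d / 2)) * F (x + a * d) * ennreal (normal_density 0 (sqrt d) x) \<partial>lborel)"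
    by (intro nn_integral_cong) (simp add: *[symmetric] ennreal_mult' ac_simps)
  finally show ?thesis by simp
qed

text \<open>\<open>G k\<close> is the information before step \<open>k\<close>. The drift
  \<open>h k\<close> is predictable: it is known in \<open>G k\<close>, hence independent of the
  increment \<open>X k\<close> of variance \<open>d k\<close> to which \<open>h k * d k\<close> is
  going to be added.\<close>

locale gaussian_steps = prob_space M for M :: "'a measure" +
  fixes G :: "nat \<Rightarrow> 'a measure" and X h :: "nat \<Rightarrow> 'a \<Rightarrow> real" and d :: "nat \<Rightarrow> real" and K :: nat
  assumes sub: "\<And>k. subalgebra M (G k)"
    and mono: "\<And>k. k < K \<Longrightarrow> sets (G k) \<subseteq> sets (G (Suc k))"
    and X_meas: "\<And>k. k < K \<Longrightarrow> X k \<in> borel_measurable (G (Suc k))"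
    and ind: "\<And>k. k < K \<Longrightarrow> indep_set (sets (G k)) (sets (vimage_algebra (space M) (X k) borel))"
    and dist: "\<And>k. k < K \<Longrightarrow> distributed M lborel (X k) (\<lambda>x. ennreal (normal_density 0 (sqrt (d k)) x))"
    and d_pos: "\<And>k. k < K \<Longrightarrow> 0 < d k"
    and h_meas: "\<And>k. k < K \<Longrightarrow> h k \<in> borel_measurable (G k)"
begin

text \<open>The discrete stochastic exponential; weighting by it removes the drift from the shifted
  increments.\<close>

definition likelihood :: "nat \<Rightarrow> 'a \<Rightarrow> real" where
  "likelihood k \<omega> = (\<Prod>j<k. exp (- h j \<omega> * X j \<omega> - (h j \<omega>)\<^sup>2 * d j / 2))"

definition shifted :: "nat \<Rightarrow> 'a \<Rightarrow> nat \<Rightarrow> real" where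
  "shifted k \<omega> = (\<lambda>j. if j < k then X j \<omega> + h j \<omega> * d j else 0)"

definition unshifted :: "nat \<Rightarrow> 'a \<Rightarrow> nat \<Rightarrow> real" where
  "unshifted k \<omega> = (\<lambda>j. if j < k then X j \<omega> else 0)"

lemma sub_G: "i \<le> k \<Longrightarrow> k \<le> K \<Longrightarrow> subalgebra (G k) (G i)"
proof (induction rule: dec_induct)
  case base
  show ?case by (simp add: subalgebra_def)
next
  case (step n)
  then have "subalgebra (G n) (G i)" "sets (G n) \<subseteq> sets (G (Suc n))"
    using mono[of n] by auto
  then show ?case using sub[of n] sub[of "Suc n"] by (auto simp: subalgebra_def)
qed

lemma steps_measurable:
  assumes "j < k" "k \<le> K"
  shows "X j \<in> borel_measurable (G k)" "h j \<in> borel_measurable (G k)"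
  using assms sub_G[of "Suc j" k] sub_G[of j k] X_meas[of j] h_meas[of j]
  by (auto intro: measurable_from_subalg)

lemma likelihood_measurable: "k \<le> K \<Longrightarrow> likelihood k \<in> borel_measurable (G k)"
  unfolding likelihood_def[abs_def]
  by (intro borel_measurable_prod borel_measurable_exp[THEN measurable_compose_rev]
      borel_measurable_diff borel_measurable_times borel_measurable_uminus
      borel_measurable_power borel_measurable_divide borel_measurable_const steps_measurable) auto

lemma likelihood_pos: "0 < likelihood k \<omega>"
  unfolding likelihood_def by (intro prod_pos) auto

lemma shifted_measurable:
  assumes "k \<le> K" shows "shifted k \<in> measurable (G k) (Pi\<^sub>M UNIV (\<lambda>_. borel))"
  unfolding shifted_def[abs_def]
proof (rule measurable_PiM_single')
  fix j
  show "(\<lambda>\<omega>. if j < k then X j \<omega> + h j \<omega> * d j else 0) \<in> borel_measurable (G k)"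
    using steps_measurable[of j k] assms by (cases "j < k") auto
qed auto

lemma unshifted_measurable:
  assumes "k \<le> K" shows "unshifted k \<in> measurable (G k) (Pi\<^sub>M UNIV (\<lambda>_. borel))"
  unfolding unshifted_def[abs_def]
proof (rule measurable_PiM_single')
  fix j
  show "(\<lambda>\<omega>. if j < k then X j \<omega> else 0) \<in> borel_measurable (G k)"
    using steps_measurable[of j k] assms by (cases "j < k") auto
qed auto

text \<open>Induction on the number of steps, for all \<open>f\<close> at once: the last increment
  is integrated out given the past and unshifted by the one-dimensional formula. The event
  \<open>C\<close> is known at the start and rides along; later it carries the message.\<close>

lemma nn_integral_change_of_measure:
  assumes "k \<le> K" and C: "C \<in> sets (G 0)" and "f \<in> borel_measurable (Pi\<^sub>M UNIV (\<lambda>_. borel))"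
  shows "(\<integral>\<^sup>+\<omega>. ennreal (likelihood k \<omega>) * indicator C \<omega> * f (shifted k \<omega>) \<partial>M)
    = (\<integral>\<^sup>+\<omega>. indicator C \<omega> * f (unshifted k \<omega>) \<partial>M)"
  using assms(1,3)
proof (induction k arbitrary: f)
  case 0
  then show ?case by (simp add: likelihood_def shifted_def unshifted_def)
next
  case (Suc k)
  then have k: "k < K" "k \<le> K" by auto
  note [measurable] = Suc.prems(2)
  let ?V = "Pi\<^sub>M UNIV (\<lambda>_::nat. borel :: real measure)"
  let ?n = "\<lambda>x. ennreal (normal_density 0 (sqrt (d k)) x)"
  have CG: "C \<in> sets (G k)" using C sub_G[of 0 k] k by (auto simp: subalgebra_def)
  have upd[measurable]: "(\<lambda>p. (f1 p)(k := f2 p)) \<in> measurable N ?V"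
    if "f1 \<in> measurable N ?V" "f2 \<in> borel_measurable N" for f1 f2 and N :: "'z measure"
    using that by (intro measurable_fun_upd[where J=UNIV]) auto
  \<comment> \<open>\<open>f\<close> averaged over its last coordinate with the driftless Gaussian.
    The induction hypothesis is used for this function.\<close>
  define f' where "f' w = (\<integral>\<^sup>+x. f (w(k := x)) * ?n x \<partial>lborel)" for w
  have [measurable]: "f' \<in> borel_measurable ?V"
    unfolding f'_def by measurable
  define \<phi> where "\<phi> p = (case p of ((c, a, w), x) \<Rightarrow>
      c * (ennreal (exp (- a * x - a\<^sup>2 * d k / 2)) * f (w(k := x + a * d k))))"
    for p :: "(ennreal \<times> real \<times> (nat \<Rightarrow> real)) \<times> real"
  have \<phi>m: "\<phi> \<in> borel_measurable ((borel \<Otimes>\<^sub>M borel \<Otimes>\<^sub>M ?V) \<Otimes>\<^sub>M borel)"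
    unfolding \<phi>_def case_prod_beta by measurable
  define U where "U \<omega> = (ennreal (likelihood k \<omega>) * indicator C \<omega>, h k \<omega>, shifted k \<omega>)" for \<omega>
  have Um: "U \<in> measurable (G k) (borel \<Otimes>\<^sub>M borel \<Otimes>\<^sub>M ?V)"
    unfolding U_def using CG likelihood_measurable[OF k(2)] h_meas[OF k(1)] shifted_measurable[OF k(2)]
    by (intro measurable_Pair borel_measurable_times_ennreal borel_measurable_indicator
        measurable_compose[OF _ measurable_ennreal]) auto
  have "(\<integral>\<^sup>+\<omega>. ennreal (likelihood (Suc k) \<omega>) * indicator C \<omega> * f (shifted (Suc k) \<omega>) \<partial>M) = (\<integral>\<^sup>+\<omega>. \<phi> (U \<omega>, X k \<omega>) \<partial>M)"
  proof (intro nn_integral_cong)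
    fix \<omega>
    have "shifted (Suc k) \<omega> = (shifted k \<omega>)(k := X k \<omega> + h k \<omega> * d k)"
      by (auto simp: shifted_def)
    then show "ennreal (likelihood (Suc k) \<omega>) * indicator C \<omega> * f (shifted (Suc k) \<omega>) = \<phi> (U \<omega>, X k \<omega>)"
      using likelihood_pos[of k \<omega>] by (simp add: \<phi>_def U_def likelihood_def ennreal_mult' ac_simps)
  qed
  also have "\<dots> = (\<integral>\<^sup>+\<omega>. \<integral>\<^sup>+x. \<phi> (U \<omega>, x) * ?n x \<partial>lborel \<partial>M)"
    by (rule nn_integral_indep_gaussian[OF sub dist[OF k(1)] ind[OF k(1)] Um \<phi>m])
  also have "\<dots> = (\<integral>\<^sup>+\<omega>. ennreal (likelihood k \<omega>) * indicator C \<omega> * f' (shifted k \<omega>) \<partial>M)"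
  proof (intro nn_integral_cong)
    fix \<omega> assume \<omega>: "\<omega> \<in> space M"
    have [measurable]: "(\<lambda>x. f ((shifted k \<omega>)(k := x))) \<in> borel_measurable borel"
      by (intro measurable_compose[OF _ Suc.prems(2)] upd) (auto simp: space_PiM)
    have "(\<integral>\<^sup>+x. \<phi> (U \<omega>, x) * ?n x \<partial>lborel) = (\<integral>\<^sup>+x. (ennreal (likelihood k \<omega>) * indicator C \<omega>) *
        (ennreal (exp (- h k \<omega> * x - (h k \<omega>)\<^sup>2 * d k / 2)) * f ((shifted k \<omega>)(k := x + h k \<omega> * d k)) * ?n x) \<partial>lborel)"
      by (simp add: \<phi>_def U_def mult.assoc)
    also have "\<dots> = (ennreal (likelihood k \<omega>) * indicator C \<omega>) *
        (\<integral>\<^sup>+x. ennreal (exp (- h k \<omega> * x - (h k \<omega>)\<^sup>2 * d k / 2)) * f ((shifted k \<omega>)(k := x + h k \<omega> * d k)) * ?n x \<partial>lborel)"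
      by (rule nn_integral_cmult) measurable
    also have "\<dots> = (ennreal (likelihood k \<omega>) * indicator C \<omega>) * f' (shifted k \<omega>)"
      unfolding f'_def
      by (subst nn_integral_gaussian_shift[of "\<lambda>x. f ((shifted k \<omega>)(k := x))", OF _ d_pos[OF k(1)]]) auto
    finally show "(\<integral>\<^sup>+x. \<phi> (U \<omega>, x) * ?n x \<partial>lborel) = ennreal (likelihood k \<omega>) * indicator C \<omega> * f' (shifted k \<omega>)" .
  qed
  also have "\<dots> = (\<integral>\<^sup>+\<omega>. indicator C \<omega> * f' (unshifted k \<omega>) \<partial>M)"
    by (rule Suc.IH) (use k in auto)
  also have "\<dots> = (\<integral>\<^sup>+\<omega>. \<integral>\<^sup>+x. (case ((indicator C \<omega>, unshifted k \<omega>), x) of ((c, w), x) \<Rightarrow> c * f (w(k := x))) * ?n x \<partial>lborel \<partial>M)"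
  proof (intro nn_integral_cong)
    fix \<omega>
    have [measurable]: "(\<lambda>x. f ((unshifted k \<omega>)(k := x))) \<in> borel_measurable borel"
      by (intro measurable_compose[OF _ Suc.prems(2)] upd) (auto simp: space_PiM)
    show "indicator C \<omega> * f' (unshifted k \<omega>) =
       (\<integral>\<^sup>+x. (case ((indicator C \<omega>, unshifted k \<omega>), x) of ((c, w), x) \<Rightarrow> c * f (w(k := x))) * ?n x \<partial>lborel)"
      unfolding f'_def by (subst nn_integral_cmult[symmetric]) (auto simp: mult.assoc)
  qed
  also have "\<dots> = (\<integral>\<^sup>+\<omega>. (case ((indicator C \<omega>, unshifted k \<omega>), X k \<omega>) of ((c, w), x) \<Rightarrow> c * f (w(k := x))) \<partial>M)"
    by (rule nn_integral_indep_gaussian[OF sub dist[OF k(1)] ind[OF k(1)],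
          where S = "borel \<Otimes>\<^sub>M ?V" and U = "\<lambda>\<omega>. (indicator C \<omega>, unshifted k \<omega>)", symmetric])
      (use CG unshifted_measurable[OF k(2)] in \<open>measurable\<close>)
  also have "\<dots> = (\<integral>\<^sup>+\<omega>. indicator C \<omega> * f (unshifted (Suc k) \<omega>) \<partial>M)"
  proof (intro nn_integral_cong)
    fix \<omega>
    have "unshifted (Suc k) \<omega> = (unshifted k \<omega>)(k := X k \<omega>)"
      by (auto simp: unshifted_def)
    then show "(case ((indicator C \<omega>, unshifted k \<omega>), X k \<omega>) of ((c, w), x) \<Rightarrow> c * f (w(k := x)))
      = indicator C \<omega> * f (unshifted (Suc k) \<omega>)" by simp
  qed
  finally show ?case .
qed

text \<open>The square of a factor with drift \<open>a\<close> is
  \<open>exp (a\<^sup>2 * d k)\<close> times the factor with drift \<open>2 * a\<close>, whose mean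
  is 1. Only the sum of the variances enters, so that refining the steps does not worsen the
  bound.\<close>

lemma nn_integral_likelihood_square_le:
  assumes "k \<le> K" and e: "\<And>j \<omega>. j < K \<Longrightarrow> \<omega> \<in> space M \<Longrightarrow> \<bar>h j \<omega>\<bar> \<le> e"
  shows "(\<integral>\<^sup>+\<omega>. ennreal ((likelihood k \<omega>)\<^sup>2) \<partial>M) \<le> ennreal (exp (e\<^sup>2 * (\<Sum>j<k. d j)))"
  using assms(1)
proof (induction k)
  case 0
  then show ?case by (simp add: likelihood_def emeasure_space_1)
next
  case (Suc k)
  then have k: "k < K" "k \<le> K" by auto
  let ?n = "\<lambda>x. ennreal (normal_density 0 (sqrt (d k)) x)"
  define \<phi> where "\<phi> p = (case p of ((c, a), x) \<Rightarrow>
      ennreal c * ennreal (exp (a\<^sup>2 * d k)) * (ennreal (exp (- (2 * a) * x - (2 * a)\<^sup>2 * d k / 2))))"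
    for p :: "(real \<times> real) \<times> real"
  have \<phi>m: "\<phi> \<in> borel_measurable ((borel \<Otimes>\<^sub>M borel) \<Otimes>\<^sub>M borel)"
    unfolding \<phi>_def case_prod_beta by measurable
  define U where "U \<omega> = ((likelihood k \<omega>)\<^sup>2, h k \<omega>)" for \<omega>
  have Um: "U \<in> measurable (G k) (borel \<Otimes>\<^sub>M borel)"
    unfolding U_def using likelihood_measurable[OF k(2)] h_meas[OF k(1)] by measurable
  have "(\<integral>\<^sup>+\<omega>. ennreal ((likelihood (Suc k) \<omega>)\<^sup>2) \<partial>M) = (\<integral>\<^sup>+\<omega>. \<phi> (U \<omega>, X k \<omega>) \<partial>M)"
  proof (intro nn_integral_cong)
    fix \<omega>
    have "(exp (- h k \<omega> * X k \<omega> - (h k \<omega>)\<^sup>2 * d k / 2))\<^sup>2 =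
      exp ((h k \<omega>)\<^sup>2 * d k) * exp (- (2 * h k \<omega>) * X k \<omega> - (2 * h k \<omega>)\<^sup>2 * d k / 2)"
      by (simp add: exp_double[symmetric] mult_exp_exp power2_eq_square algebra_simps)
    then show "ennreal ((likelihood (Suc k) \<omega>)\<^sup>2) = \<phi> (U \<omega>, X k \<omega>)"
      by (simp add: \<phi>_def U_def likelihood_def power_mult_distrib ennreal_mult' mult.assoc)
  qed
  also have "\<dots> = (\<integral>\<^sup>+\<omega>. \<integral>\<^sup>+x. \<phi> (U \<omega>, x) * ?n x \<partial>lborel \<partial>M)"
    by (rule nn_integral_indep_gaussian[OF sub dist[OF k(1)] ind[OF k(1)] Um \<phi>m])
  also have "\<dots> = (\<integral>\<^sup>+\<omega>. ennreal ((likelihood k \<omega>)\<^sup>2) * ennreal (exp ((h k \<omega>)\<^sup>2 * d k)) \<partial>M)"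
  proof (intro nn_integral_cong)
    fix \<omega>
    have "(\<integral>\<^sup>+x. \<phi> (U \<omega>, x) * ?n x \<partial>lborel) = (\<integral>\<^sup>+x. (ennreal ((likelihood k \<omega>)\<^sup>2) * ennreal (exp ((h k \<omega>)\<^sup>2 * d k))) *
        (ennreal (exp (- (2 * h k \<omega>) * x - (2 * h k \<omega>)\<^sup>2 * d k / 2)) * 1 * ?n x) \<partial>lborel)"
      by (simp add: \<phi>_def U_def mult.assoc)
    also have "\<dots> = (ennreal ((likelihood k \<omega>)\<^sup>2) * ennreal (exp ((h k \<omega>)\<^sup>2 * d k))) *
        (\<integral>\<^sup>+x. ennreal (exp (- (2 * h k \<omega>) * x - (2 * h k \<omega>)\<^sup>2 * d k / 2)) * 1 * ?n x \<partial>lborel)"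
      by (rule nn_integral_cmult) measurable
    also have "(\<integral>\<^sup>+x. ennreal (exp (- (2 * h k \<omega>) * x - (2 * h k \<omega>)\<^sup>2 * d k / 2)) * 1 * ?n x \<partial>lborel) = (\<integral>\<^sup>+x. 1 * ?n x \<partial>lborel)"
      by (rule nn_integral_gaussian_shift[of "\<lambda>_. 1", OF _ d_pos[OF k(1)]]) auto
    also have "\<dots> = 1"
    proof -
      have "prob_space (density lborel ?n)"
        using d_pos[OF k(1)] by (intro prob_space_normal_density) auto
      from prob_space.emeasure_space_1[OF this] show ?thesis by (simp add: emeasure_density)
    qed
    finally show "(\<integral>\<^sup>+x. \<phi> (U \<omega>, x) * ?n x \<partial>lborel) = ennreal ((likelihood k \<omega>)\<^sup>2) * ennreal (exp ((h k \<omega>)\<^sup>2 * d k))"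
      by simp
  qed
  also have "\<dots> \<le> (\<integral>\<^sup>+\<omega>. ennreal ((likelihood k \<omega>)\<^sup>2) * ennreal (exp (e\<^sup>2 * d k)) \<partial>M)"
  proof (intro nn_integral_mono mult_left_mono ennreal_leI)
    fix \<omega> assume "\<omega> \<in> space M"
    then have "(h k \<omega>)\<^sup>2 \<le> e\<^sup>2" using e[OF k(1)] by (metis abs_ge_zero power2_abs power_mono)
    then show "exp ((h k \<omega>)\<^sup>2 * d k) \<le> exp (e\<^sup>2 * d k)"
      using d_pos[OF k(1)] by simp
  qed auto
  also have "\<dots> = (\<integral>\<^sup>+\<omega>. ennreal ((likelihood k \<omega>)\<^sup>2) \<partial>M) * ennreal (exp (e\<^sup>2 * d k))"
    using likelihood_measurable[OF k(2)] measurable_from_subalg[OF sub] by (intro nn_integral_multc) measurable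
  also have "\<dots> \<le> ennreal (exp (e\<^sup>2 * (\<Sum>j<k. d j))) * ennreal (exp (e\<^sup>2 * d k))"
    using Suc.IH k by (intro mult_right_mono) auto
  also have "\<dots> = ennreal (exp (e\<^sup>2 * (\<Sum>j<Suc k. d j)))"
    by (simp add: ennreal_mult'[symmetric] mult_exp_exp distrib_left)
  finally show ?case .
qed

text \<open>With R the likelihood, \<open>prob S'\<close> is the integral of R over
  \<open>S\<close>, so the difference is at most the mean of |1 - R|. Since R has mean 1, the mean
  square of 1 - R is the second moment of R minus 1, which explains the root.\<close>

lemma total_variation_shift_le:
  assumes C: "C \<in> sets (G 0)" and E: "E \<in> sets (Pi\<^sub>M UNIV (\<lambda>_. borel))"
    and e: "\<And>j \<omega>. j < K \<Longrightarrow> \<omega> \<in> space M \<Longrightarrow> \<bar>h j \<omega>\<bar> \<le> e"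
  shows "\<bar>prob {\<omega>\<in>C. shifted K \<omega> \<in> E} - prob {\<omega>\<in>C. unshifted K \<omega> \<in> E}\<bar>
    \<le> sqrt (exp (e\<^sup>2 * (\<Sum>j<K. d j)) - 1)"
proof -
  have CM[measurable]: "C \<in> events" using C sub[of 0] by (auto simp: subalgebra_def)
  have [measurable]: "likelihood K \<in> borel_measurable M" "shifted K \<in> measurable M (Pi\<^sub>M UNIV (\<lambda>_. borel))"
    "unshifted K \<in> measurable M (Pi\<^sub>M UNIV (\<lambda>_. borel))"
    using likelihood_measurable shifted_measurable unshifted_measurable
    by (auto intro: measurable_from_subalg[OF sub])
  note [measurable] = E
  define S where "S = {\<omega>\<in>C. shifted K \<omega> \<in> E}"
  define S' where "S' = {\<omega>\<in>C. unshifted K \<omega> \<in> E}"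
  have Seq: "S = C \<inter> (shifted K -` E \<inter> space M)" "S' = C \<inter> (unshifted K -` E \<inter> space M)"
    using sets.sets_into_space[OF CM] by (auto simp: S_def S'_def)
  have [measurable]: "S \<in> events" "S' \<in> events"
    unfolding Seq by measurable
  have R0: "0 \<le> likelihood K \<omega>" for \<omega> using likelihood_pos[of K \<omega>] by simp
  have sq: "(\<integral>\<^sup>+\<omega>. ennreal ((likelihood K \<omega>)\<^sup>2) \<partial>M) \<le> ennreal (exp (e\<^sup>2 * (\<Sum>j<K. d j)))"
    by (rule nn_integral_likelihood_square_le) (use e in auto)
  have iR2: "integrable M (\<lambda>\<omega>. (likelihood K \<omega>)\<^sup>2)"
    using sq by (intro integrableI_nonneg) (auto simp: top_unique less_top[symmetric])
  have ER2: "expectation (\<lambda>\<omega>. (likelihood K \<omega>)\<^sup>2) \<le> exp (e\<^sup>2 * (\<Sum>j<K. d j))"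
    using sq iR2 by (simp add: nn_integral_eq_integral)
  have iR: "integrable M (likelihood K)"
    by (rule square_integrable_imp_integrable) (use iR2 in auto)
  have key: "expectation (\<lambda>\<omega>. likelihood K \<omega> * indicator S \<omega>) = prob S'"
  proof -
    have "(\<integral>\<^sup>+\<omega>. ennreal (likelihood K \<omega> * indicator S \<omega>) \<partial>M) = (\<integral>\<^sup>+\<omega>. ennreal (likelihood K \<omega>) * indicator C \<omega> * indicator E (shifted K \<omega>) \<partial>M)"
      by (intro nn_integral_cong) (auto simp: S_def indicator_def)
    also have "\<dots> = (\<integral>\<^sup>+\<omega>. indicator C \<omega> * indicator E (unshifted K \<omega>) \<partial>M)"
      by (rule nn_integral_change_of_measure[OF _ C]) auto
    also have "\<dots> = (\<integral>\<^sup>+\<omega>. indicator S' \<omega> \<partial>M)"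
      by (intro nn_integral_cong) (auto simp: S'_def indicator_def)
    also have "\<dots> = ennreal (prob S')" by (simp add: emeasure_eq_measure)
    finally show ?thesis
      using R0 by (subst integral_eq_nn_integral) auto
  qed
  have ER: "expectation (likelihood K) = 1"
  proof -
    have "(\<integral>\<^sup>+\<omega>. ennreal (likelihood K \<omega>) \<partial>M) = (\<integral>\<^sup>+\<omega>. ennreal (likelihood K \<omega>) * indicator (space M) \<omega> * 1 \<partial>M)"
      by (intro nn_integral_cong) auto
    also have "\<dots> = (\<integral>\<^sup>+\<omega>. indicator (space M) \<omega> * 1 \<partial>M)"
      by (rule nn_integral_change_of_measure[where f="\<lambda>_. 1"]) (use sub[of 0] sets.top[of "G 0"] in \<open>auto simp: subalgebra_def\<close>)
    also have "\<dots> = 1" by (simp add: emeasure_space_1)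
    finally show ?thesis using R0 by (subst integral_eq_nn_integral) auto
  qed
  have iD: "integrable M (\<lambda>\<omega>. \<bar>1 - likelihood K \<omega>\<bar>)" using iR by auto
  have iD2: "integrable M (\<lambda>\<omega>. \<bar>1 - likelihood K \<omega>\<bar>\<^sup>2)"
    using iR iR2 by (simp add: power2_diff)
  have "expectation (\<lambda>\<omega>. \<bar>1 - likelihood K \<omega>\<bar>\<^sup>2) = 1 + expectation (\<lambda>\<omega>. (likelihood K \<omega>)\<^sup>2) - 2 * expectation (likelihood K)"
    using iR iR2 by (simp add: power2_diff prob_space)
  then have ED2: "expectation (\<lambda>\<omega>. \<bar>1 - likelihood K \<omega>\<bar>\<^sup>2) \<le> exp (e\<^sup>2 * (\<Sum>j<K. d j)) - 1"
    using ER ER2 by simp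
  \<comment> \<open>Jensen's inequality, read off from the nonnegativity of a variance.\<close>
  have "(expectation (\<lambda>\<omega>. \<bar>1 - likelihood K \<omega>\<bar>))\<^sup>2 \<le> expectation (\<lambda>\<omega>. \<bar>1 - likelihood K \<omega>\<bar>\<^sup>2)"
    using variance_eq[OF iD iD2] variance_positive[of "\<lambda>\<omega>. \<bar>1 - likelihood K \<omega>\<bar>"] by simp
  then have "expectation (\<lambda>\<omega>. \<bar>1 - likelihood K \<omega>\<bar>) \<le> sqrt (exp (e\<^sup>2 * (\<Sum>j<K. d j)) - 1)"
    using ED2 by (intro real_le_rsqrt) auto
  moreover have "\<bar>prob S - prob S'\<bar> \<le> expectation (\<lambda>\<omega>. \<bar>1 - likelihood K \<omega>\<bar>)"
  proof -
    have iRS: "integrable M (\<lambda>\<omega>. likelihood K \<omega> * indicator S \<omega>)"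
      using iR by (intro integrable_real_mult_indicator) auto
    have iS: "integrable M (indicat_real S)"
      by (intro integrable_const_bound[where B=1]) auto
    have "prob S - prob S' = expectation (\<lambda>\<omega>. indicator S \<omega> - likelihood K \<omega> * indicator S \<omega>)"
      using iRS iS by (subst Bochner_Integration.integral_diff) (auto simp: key)
    also have "\<bar>\<dots>\<bar> \<le> expectation (\<lambda>\<omega>. \<bar>indicator S \<omega> - likelihood K \<omega> * indicator S \<omega>\<bar>)"
      by (rule integral_abs_bound)
    also have "\<dots> \<le> expectation (\<lambda>\<omega>. \<bar>1 - likelihood K \<omega>\<bar>)"
    proof (rule integral_mono)
      show "integrable M (\<lambda>\<omega>. \<bar>indicator S \<omega> - likelihood K \<omega> * indicator S \<omega>\<bar>)"
        using iRS iS by auto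
    qed (use iD in \<open>auto simp: indicator_def\<close>)
    finally show ?thesis .
  qed
  ultimately show ?thesis by (simp add: S_def S'_def)
qed

end


section \<open>Paths, interpolation and the Euler recursion\<close>

lemma LBINT_eq_integral:
  assumes "continuous_on {a..b} (f :: real \<Rightarrow> real)"
  shows "(LBINT s:{a..b}. f s) = integral {a..b} f"
  using assms by (intro set_borel_integral_eq_integral(2) borel_integrable_atLeastAtMost')

lemma abs_integral_diff_le:
  fixes f h :: "real \<Rightarrow> real"
  assumes "a \<le> b" "continuous_on {a..b} f" "continuous_on {a..b} h"
    and "\<And>s. s \<in> {a..b} \<Longrightarrow> \<bar>f s - h s\<bar> \<le> e"
  shows "\<bar>integral {a..b} f - integral {a..b} h\<bar> \<le> e * (b - a)"
proof -
  have "integral {a..b} f - integral {a..b} h = integral {a..b} (\<lambda>s. f s - h s)"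
    using assms by (intro integral_diff[symmetric] integrable_continuous_real)
  moreover have "norm (integral {a..b} (\<lambda>s. f s - h s)) \<le> e * (b - a)"
    using assms by (intro integral_bound continuous_intros) auto
  ultimately show ?thesis by simp
qed

text \<open>Left endpoints are essential for later use: the drift at the left end of a fine step is
  known before the noise of that step. By uniform continuity the error is at most \<open>e\<close>
  per unit of length, which is carried along the partial sums.\<close>

lemma left_Riemann_sum_tendsto:
  fixes f :: "real \<Rightarrow> real"
  assumes ab: "a < b" and f: "continuous_on {a..b} f"
  shows "(\<lambda>N. \<Sum>j<N. f (a + real j / real N * (b - a)) * ((b - a) / real N)) \<longlonglongrightarrow> (LBINT s:{a..b}. f s)"
  unfolding LBINT_eq_integral[OF f]
proof (rule LIMSEQ_I)
  fix r :: real assume r: "0 < r"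
  define e where "e = r / 2 / (b - a)"
  have e: "e > 0" using r ab by (simp add: e_def)
  have "uniformly_continuous_on {a..b} f"
    using f by (intro compact_uniformly_continuous) auto
  then obtain \<delta> where \<delta>: "\<delta> > 0" "\<And>x y. x \<in> {a..b} \<Longrightarrow> y \<in> {a..b} \<Longrightarrow> dist y x < \<delta> \<Longrightarrow> dist (f y) (f x) < e"
    using e unfolding uniformly_continuous_on_def by metis
  obtain N0 where N0: "real N0 > (b - a) / \<delta>" using reals_Archimedean2 by blast
  have "norm ((\<Sum>j<N. f (a + real j / real N * (b - a)) * ((b - a) / real N)) - integral {a..b} f) < r"
    if N: "N \<ge> Suc N0" for N
  proof -
    define D where "D = (b - a) / real N"
    define s where "s k = a + real k / real N * (b - a)" for k
    have sS: "s (Suc k) = s k + D" for k using N by (simp add: s_def D_def field_simps)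
    have D: "D > 0" "D < \<delta>"
    proof -
      show "D > 0" using N ab by (simp add: D_def)
      have "(b - a) / \<delta> < real N" using N N0 by linarith
      then show "D < \<delta>" using N \<delta>(1) by (simp add: D_def field_simps)
    qed
    have sm: "a \<le> s k" "k \<le> N \<Longrightarrow> s k \<le> b" for k
    proof -
      show "a \<le> s k" using ab by (simp add: s_def)
      assume "k \<le> N"
      then have "real k / real N * (b - a) \<le> 1 * (b - a)"
        using N ab by (intro mult_right_mono) auto
      then show "s k \<le> b" by (simp add: s_def)
    qed
    have "\<bar>integral {a..s k} f - (\<Sum>j<k. f (s j) * D)\<bar> \<le> e * (s k - a)" if "k \<le> N" for k
      using that
    proof (induction k)
      case 0
      then show ?case by (simp add: s_def)
    next
      case (Suc k)
      have in_ab: "s k \<le> s (Suc k)" "s (Suc k) \<le> b" using sS D sm(2)[OF Suc.prems] by auto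
      have fk: "continuous_on {a..s (Suc k)} f" "continuous_on {s k..s (Suc k)} f"
        using f in_ab sm(1)[of k] by (auto intro: continuous_on_subset)
      have "integral {a..s (Suc k)} f = integral {a..s k} f + integral {s k..s (Suc k)} f"
        using fk(1) sm(1)[of k] in_ab
        by (intro Henstock_Kurzweil_Integration.integral_combine[symmetric] integrable_continuous_real) auto
      then have split: "integral {a..s (Suc k)} f - (\<Sum>j<Suc k. f (s j) * D) =
          (integral {a..s k} f - (\<Sum>j<k. f (s j) * D)) + (integral {s k..s (Suc k)} f - f (s k) * D)"
        by simp
      have "\<bar>integral {s k..s (Suc k)} f - integral {s k..s (Suc k)} (\<lambda>_. f (s k))\<bar> \<le> e * (s (Suc k) - s k)"
      proof (rule abs_integral_diff_le)
        fix x assume "x \<in> {s k..s (Suc k)}"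
        then have "dist (f x) (f (s k)) < e"
          using in_ab sm(1)[of k] sS[of k] D by (intro \<delta>(2)) (auto simp: dist_real_def)
        then show "\<bar>f x - f (s k)\<bar> \<le> e" by (simp add: dist_real_def)
      qed (use in_ab fk in auto)
      moreover have "integral {s k..s (Suc k)} (\<lambda>_. f (s k)) = f (s k) * D"
        using in_ab by (simp add: sS mult.commute)
      ultimately have "\<bar>integral {s k..s (Suc k)} f - f (s k) * D\<bar> \<le> e * (s (Suc k) - s k)"
        by (simp only:)
      moreover have "\<bar>integral {a..s k} f - (\<Sum>j<k. f (s j) * D)\<bar> \<le> e * (s k - a)"
        using Suc by simp
      moreover have "e * (s (Suc k) - a) = e * (s k - a) + e * (s (Suc k) - s k)"
        by (simp add: algebra_simps)
      ultimately show ?case unfolding split by linarith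
    qed
    from this[of N] have "\<bar>integral {a..b} f - (\<Sum>j<N. f (s j) * D)\<bar> \<le> e * (b - a)"
      using N by (simp add: s_def)
    also have "e * (b - a) = r / 2"
      using ab unfolding e_def by (intro nonzero_eq_divide_eq[THEN iffD1]) auto
    also have "r / 2 < r" using r by simp
    finally show ?thesis by (simp add: s_def D_def abs_minus_commute)
  qed
  then show "\<exists>no. \<forall>N\<ge>no. norm ((\<Sum>j<N. f (a + real j / real N * (b - a)) * ((b - a) / real N)) - integral {a..b} f) < r"
    by blast
qed

lemma stop_path_cong:
  assumes "0 \<le> t" "\<And>r. r \<in> {0..t} \<Longrightarrow> \<phi> r = \<psi> r"
  shows "stop_path t \<phi> = stop_path t \<psi>"
  unfolding stop_path_def using assms by (intro ext) auto

lemma path_dist_le: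
  assumes "0 \<le> T" "\<And>r. r \<in> {0..T} \<Longrightarrow> \<bar>stop_path s \<phi> r - stop_path t \<psi> r\<bar> \<le> e"
  shows "path_dist T s \<phi> t \<psi> \<le> e"
  unfolding path_dist_def using assms by (intro cSUP_least) auto

lemma continuous_on_stop_path:
  assumes "continuous_on {0..T} \<phi>" "t \<in> {0..T}"
  shows "continuous_on UNIV (stop_path t \<phi>)"
  unfolding stop_path_def using assms
  by (intro continuous_on_compose2[OF assms(1)] continuous_intros) auto

section \<open>Piecewise linear interpolation through grid values\<close>

definition ramp :: "real \<Rightarrow> real \<Rightarrow> real \<Rightarrow> real" where
  "ramp a b t = max 0 (min 1 ((t - a) / (b - a)))"

lemma ramp_left: "a < b \<Longrightarrow> t \<le> a \<Longrightarrow> ramp a b t = 0"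
  using divide_nonpos_pos[of "t - a" "b - a"] by (simp add: ramp_def)

lemma ramp_right: "a < b \<Longrightarrow> b \<le> t \<Longrightarrow> ramp a b t = 1"
  by (simp add: ramp_def le_divide_eq)

text \<open>A sum of increments times clamped ramps is linear in \<open>y\<close> and continuous on
  the whole line, without a case distinction on the step that contains \<open>t\<close>.\<close>

definition interp :: "(nat \<Rightarrow> real) \<Rightarrow> nat \<Rightarrow> (nat \<Rightarrow> real) \<Rightarrow> real \<Rightarrow> real" where
  "interp \<tau> n y t = y 0 + (\<Sum>i<n. (y (Suc i) - y i) * ramp (\<tau> i) (\<tau> (Suc i)) t)"

lemma continuous_on_interp: "continuous_on S (interp \<tau> n y)"
proof -
  have "continuous_on S (\<lambda>t. (t - a) / c)" for a c :: real
    by (cases "c = 0") (auto intro!: continuous_intros)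
  then show ?thesis
    unfolding interp_def[abs_def] ramp_def
    by (intro continuous_on_add continuous_on_sum continuous_on_mult continuous_on_max
        continuous_on_min continuous_on_const)
qed

lemma interp_cong: "(\<And>i. i \<le> n \<Longrightarrow> y i = z i) \<Longrightarrow> interp \<tau> n y = interp \<tau> n z"
  unfolding interp_def[abs_def] by (intro ext arg_cong2[where f="(+)"] sum.cong) auto

text \<open>Dominates the uniform distance of two interpolations while involving only finitely many
  coordinates and neither the time nor the grid.\<close>

definition interp_dist :: "nat \<Rightarrow> (nat \<Rightarrow> real) \<Rightarrow> (nat \<Rightarrow> real) \<Rightarrow> real" where
  "interp_dist n y z = \<bar>y 0 - z 0\<bar> + (\<Sum>i<n. \<bar>(y (Suc i) - y i) - (z (Suc i) - z i)\<bar>)"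

lemma interp_dist_bound: "\<bar>interp \<tau> n y t - interp \<tau> n z t\<bar> \<le> interp_dist n y z"
proof -
  have "interp \<tau> n y t - interp \<tau> n z t = (y 0 - z 0) +
      (\<Sum>i<n. ((y (Suc i) - y i) - (z (Suc i) - z i)) * ramp (\<tau> i) (\<tau> (Suc i)) t)"
    by (simp add: interp_def left_diff_distrib sum_subtractf)
  also have "\<bar>\<dots>\<bar> \<le> \<bar>y 0 - z 0\<bar> + (\<Sum>i<n. \<bar>((y (Suc i) - y i) - (z (Suc i) - z i)) * ramp (\<tau> i) (\<tau> (Suc i)) t\<bar>)"
    by (rule abs_triangle_ineq[THEN order_trans] add_left_mono sum_abs)+
  also have "\<dots> \<le> interp_dist n y z"
    unfolding interp_dist_def abs_mult
    by (intro add_left_mono sum_mono mult_left_le) (auto simp: ramp_def)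
  finally show ?thesis .
qed

lemma interp_dist_tendsto: "((\<lambda>z. interp_dist n z y) \<longlongrightarrow> 0) (at y)"
proof -
  have "continuous_on UNIV (\<lambda>z. interp_dist n z y)"
    unfolding interp_dist_def
    by (intro continuous_on_add continuous_on_sum continuous_on_rabs continuous_on_diff
        continuous_on_const continuous_on_product_coordinates)
  then have "((\<lambda>z. interp_dist n z y) \<longlongrightarrow> interp_dist n y y) (at y)"
    by (simp add: continuous_on_def)
  then show ?thesis by (simp add: interp_dist_def)
qed

text \<open>The tool for measurability: a functional of the node values that is Lipschitz for
  \<open>interp_dist\<close> is continuous in the product topology, and the Borel sets of that
  topology are those of the product sigma-algebra.\<close>

lemma continuous_on_if_interp_dist_bound:
  fixes f :: "(nat \<Rightarrow> real) \<Rightarrow> 'b::metric_space"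
  assumes "\<And>y z. dist (f z) (f y) \<le> K * interp_dist n z y"
  shows "continuous_on UNIV f"
  unfolding continuous_on_def
proof
  fix y :: "nat \<Rightarrow> real"
  have lim: "((\<lambda>z. K * interp_dist n z y) \<longlongrightarrow> K * 0) (at y)"
    by (rule tendsto_mult[OF tendsto_const interp_dist_tendsto])
  have "dist (f z) (f y) \<le> dist (K * interp_dist n z y) (K * 0)" for z
    using assms[of z y] by (simp add: dist_real_def)
  then have "\<forall>\<^sub>F z in at y. dist (f z) (f y) \<le> dist (K * interp_dist n z y) (K * 0)"
    by (rule always_eventually[OF allI])
  from metric_tendsto_imp_tendsto[OF lim this] show "(f \<longlongrightarrow> f y) (at y)" .
qed

context
  fixes T :: real and n :: nat and \<tau> :: "nat \<Rightarrow> real"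
  assumes tp: "time_points T n \<tau>"
begin

lemma time_points_mono: "i \<le> j \<Longrightarrow> j \<le> n \<Longrightarrow> \<tau> i \<le> \<tau> j"
proof (induction rule: dec_induct)
  case (step m)
  then have "\<tau> m < \<tau> (Suc m)" using tp by (simp add: time_points_def)
  with step show ?case by simp
qed simp

lemma time_points_in: "i \<le> n \<Longrightarrow> \<tau> i \<in> {0..T}"
  using time_points_mono[of 0 i] time_points_mono[of i n] tp by (simp add: time_points_def)

lemma time_points_less: "i < n \<Longrightarrow> \<tau> i < \<tau> (Suc i)"
  using tp by (simp add: time_points_def)

lemma time_points_le_mesh: "i < n \<Longrightarrow> \<tau> (Suc i) - \<tau> i \<le> mesh n \<tau>"
  unfolding mesh_def by (intro Max_ge) auto

lemma interp_on:
  assumes i: "i < n" and t: "t \<in> {\<tau> i..\<tau> (Suc i)}"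
  shows "interp \<tau> n y t = y i + (t - \<tau> i) / (\<tau> (Suc i) - \<tau> i) * (y (Suc i) - y i)"
proof -
  have lo: "ramp (\<tau> j) (\<tau> (Suc j)) t = 1" if "j < i" for j
    using time_points_mono[of "Suc j" i] time_points_less[of j] that i t
    by (intro ramp_right) auto
  have hi: "ramp (\<tau> j) (\<tau> (Suc j)) t = 0" if "i < j" "j < n" for j
    using time_points_mono[of "Suc i" j] time_points_less[of j] that i t
    by (intro ramp_left) auto
  have mid: "ramp (\<tau> i) (\<tau> (Suc i)) t = (t - \<tau> i) / (\<tau> (Suc i) - \<tau> i)"
    using time_points_less[OF i] t by (auto simp: ramp_def min_def max_def divide_le_eq)
  let ?h = "\<lambda>j. (y (Suc j) - y j) * ramp (\<tau> j) (\<tau> (Suc j)) t"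
  have "(\<Sum>j<n. ?h j) = (\<Sum>j<Suc i. ?h j)"
    using i hi by (intro sum.mono_neutral_right) auto
  also have "\<dots> = (\<Sum>j<i. y (Suc j) - y j) + ?h i"
    by (simp add: lo)
  also have "(\<Sum>j<i. y (Suc j) - y j) = y i - y 0"
    by (rule sum_lessThan_telescope)
  finally show ?thesis by (simp add: interp_def mid mult.commute)
qed

text \<open>The ramps of later steps have not started by time \<open>\<tau> i\<close>. So a path
  frozen at \<open>\<tau> i\<close> depends only on the nodes up to \<open>i\<close>.\<close>

lemma interp_prefix:
  assumes i: "i \<le> n" and t: "t \<le> \<tau> i"
  shows "interp \<tau> n y t = interp \<tau> i y t"
proof -
  have "ramp (\<tau> j) (\<tau> (Suc j)) t = 0" if "i \<le> j" "j < n" for j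
    using time_points_mono[of i j] time_points_less[of j] that t
    by (intro ramp_left) auto
  then have "(\<Sum>j<n. (y (Suc j) - y j) * ramp (\<tau> j) (\<tau> (Suc j)) t) = (\<Sum>j<i. (y (Suc j) - y j) * ramp (\<tau> j) (\<tau> (Suc j)) t)"
    using i by (intro sum.mono_neutral_right) auto
  then show ?thesis by (simp add: interp_def)
qed

lemma time_points_cover:
  assumes n: "1 \<le> n" and t: "t \<in> {0..T}"
  obtains i where "i < n" "t \<in> {\<tau> i..\<tau> (Suc i)}"
proof -
  define S where "S = {i. i < n \<and> \<tau> i \<le> t}"
  have S: "finite S" "0 \<in> S" using n t tp by (auto simp: S_def time_points_def)
  define i where "i = Max S"
  have i: "i \<in> S" unfolding i_def using S by (intro Max_in) auto
  have "t \<le> \<tau> (Suc i)"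
  proof (rule ccontr)
    assume a: "\<not> t \<le> \<tau> (Suc i)"
    show False
    proof (cases "Suc i < n")
      case True
      then have "Suc i \<in> S" using a by (simp add: S_def)
      then have "Suc i \<le> i" unfolding i_def using S by (intro Max_ge) auto
      then show False by simp
    next
      case False
      then have "Suc i = n" using i by (simp add: S_def)
      then show False using a t tp by (simp add: time_points_def)
    qed
  qed
  with i that show ?thesis by (auto simp: S_def)
qed

text \<open>Within a step the interpolation is a convex combination of two node values, both taken
  at times within one mesh width of \<open>t\<close>.\<close>

lemma interp_approx:
  assumes n: "1 \<le> n" and t: "t \<in> {0..T}"
    and osc: "\<And>x y. x \<in> {0..T} \<Longrightarrow> y \<in> {0..T} \<Longrightarrow> \<bar>x - y\<bar> \<le> mesh n \<tau> \<Longrightarrow> \<bar>\<phi> x - \<phi> y\<bar> \<le> e"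
  shows "\<bar>interp \<tau> n (\<lambda>i. \<phi> (\<tau> i)) t - \<phi> t\<bar> \<le> e"
proof -
  obtain i where i: "i < n" "t \<in> {\<tau> i..\<tau> (Suc i)}" using time_points_cover[OF n t] .
  define lam where "lam = (t - \<tau> i) / (\<tau> (Suc i) - \<tau> i)"
  have l: "0 \<le> lam" "lam \<le> 1"
    using i time_points_less[OF i(1)] by (auto simp: lam_def divide_le_eq)
  have "interp \<tau> n (\<lambda>i. \<phi> (\<tau> i)) t - \<phi> t = (1 - lam) * (\<phi> (\<tau> i) - \<phi> t) + lam * (\<phi> (\<tau> (Suc i)) - \<phi> t)"
    unfolding interp_on[OF i] lam_def[symmetric] by (simp add: algebra_simps)
  also have "\<bar>\<dots>\<bar> \<le> \<bar>(1 - lam) * (\<phi> (\<tau> i) - \<phi> t)\<bar> + \<bar>lam * (\<phi> (\<tau> (Suc i)) - \<phi> t)\<bar>"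
    by (rule abs_triangle_ineq)
  also have "\<dots> = (1 - lam) * \<bar>\<phi> (\<tau> i) - \<phi> t\<bar> + lam * \<bar>\<phi> (\<tau> (Suc i)) - \<phi> t\<bar>"
    using l by (simp add: abs_mult)
  also have "\<dots> \<le> (1 - lam) * e + lam * e"
    using l i time_points_le_mesh[OF i(1)] time_points_in[of i] time_points_in[of "Suc i"] t
    by (intro add_mono mult_left_mono osc) auto
  finally show ?thesis by (simp add: algebra_simps)
qed

end

text \<open>Uniform continuity, for an arbitrary filter because it serves twice: with the mesh as
  \<open>n\<close> grows, and with the distance of two times when one tends to the other.\<close>

lemma eventually_small_oscillation:
  fixes \<phi> :: "real \<Rightarrow> real"
  assumes "(\<delta> \<longlongrightarrow> 0) F" "continuous_on {0..T} \<phi>" "0 < e"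
  shows "\<forall>\<^sub>F n in F. \<forall>x\<in>{0..T}. \<forall>y\<in>{0..T}. \<bar>x - y\<bar> \<le> \<delta> n \<longrightarrow> \<bar>\<phi> x - \<phi> y\<bar> \<le> e"
proof -
  have "uniformly_continuous_on {0..T} \<phi>"
    using assms by (intro compact_uniformly_continuous) auto
  then obtain d where d: "d > 0" "\<And>x y. x \<in> {0..T} \<Longrightarrow> y \<in> {0..T} \<Longrightarrow> dist y x < d \<Longrightarrow> dist (\<phi> y) (\<phi> x) < e"
    using assms(3) unfolding uniformly_continuous_on_def by metis
  have "\<forall>\<^sub>F n in F. \<delta> n < d" using assms(1) d(1) by (rule order_tendstoD)
  then show ?thesis
  proof eventually_elim
    case (elim n)
    show ?case
    proof (intro ballI impI)
      fix x y assume "x \<in> {0..T}" "y \<in> {0..T}" "\<bar>x - y\<bar> \<le> \<delta> n"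
      then show "\<bar>\<phi> x - \<phi> y\<bar> \<le> e" using d(2)[of y x] elim by (simp add: dist_real_def)
    qed
  qed
qed

lemma continuous_C_path_interp:
  assumes "0 \<le> T"
  shows "continuous_on UNIV (\<lambda>y. C_path T (interp \<tau> n y))"
proof (rule continuous_on_if_interp_dist_bound[where K=1 and n=n])
  fix y z
  show "dist (C_path T (interp \<tau> n z)) (C_path T (interp \<tau> n y)) \<le> 1 * interp_dist n z y"
    by (intro dist_bound)
      (simp add: apply_C_path[OF assms continuous_on_interp] stop_path_def dist_real_def interp_dist_bound)
qed

lemma C_path_interp_tendsto:
  assumes T: "0 \<le> T" and tp: "\<And>n. n \<ge> 1 \<Longrightarrow> time_points T n (\<tau> n)"
    and mesh: "(\<lambda>n. mesh n (\<tau> n)) \<longlonglongrightarrow> 0" and \<phi>: "continuous_on {0..T} \<phi>"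
  shows "(\<lambda>n. C_path T (interp (\<tau> n) n (\<lambda>i. \<phi> (\<tau> n i)))) \<longlonglongrightarrow> C_path T \<phi>"
proof (rule metric_LIMSEQ_I)
  fix e :: real assume e: "e > 0"
  from eventually_small_oscillation[OF mesh \<phi> half_gt_zero[OF e]] eventually_ge_at_top[of 1]
  have "\<forall>\<^sub>F n in sequentially. dist (C_path T (interp (\<tau> n) n (\<lambda>i. \<phi> (\<tau> n i)))) (C_path T \<phi>) < e"
  proof eventually_elim
    case (elim n)
    have "dist (C_path T (interp (\<tau> n) n (\<lambda>i. \<phi> (\<tau> n i)))) (C_path T \<phi>) \<le> e / 2"
    proof (rule dist_bound)
      fix r
      show "dist (apply_bcontfun (C_path T (interp (\<tau> n) n (\<lambda>i. \<phi> (\<tau> n i)))) r) (apply_bcontfun (C_path T \<phi>) r) \<le> e / 2"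
        unfolding apply_C_path[OF T continuous_on_interp] apply_C_path[OF T \<phi>] stop_path_def dist_real_def
        by (rule interp_approx[OF tp]) (use elim T e in auto)
    qed
    then show ?case using e by simp
  qed
  then show "\<exists>no. \<forall>n\<ge>no. dist (C_path T (interp (\<tau> n) n (\<lambda>i. \<phi> (\<tau> n i)))) (C_path T \<phi>) < e"
    by (simp add: eventually_sequentially)
qed

section \<open>The drift functional along continuous paths\<close>

locale lipschitz_drift =
  fixes T L :: real and A :: "'m set" and g :: "real \<Rightarrow> 'm \<Rightarrow> (real \<Rightarrow> real) \<Rightarrow> real"
  assumes T_pos: "0 < T" and L_pos: "0 < L"
    and Lipschitz: "\<And>s1 s2 t1 t2 m \<phi> \<psi>. s1 \<in> {0..T} \<Longrightarrow> s2 \<in> {0..T} \<Longrightarrow> t1 \<in> {0..T} \<Longrightarrow> t2 \<in> {0..T} \<Longrightarrow>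
      m \<in> A \<Longrightarrow> continuous_on {0..T} \<phi> \<Longrightarrow> continuous_on {0..T} \<psi> \<Longrightarrow>
      \<bar>g s1 m (stop_path s2 \<phi>) - g t1 m (stop_path t2 \<psi>)\<bar> \<le> L * (\<bar>s1 - t1\<bar> + path_dist T s2 \<phi> t2 \<psi>)"
begin

lemma g_diff_le:
  assumes "s1 \<in> {0..T}" "s2 \<in> {0..T}" "t1 \<in> {0..T}" "t2 \<in> {0..T}" "m \<in> A"
    "continuous_on {0..T} \<phi>" "continuous_on {0..T} \<psi>"
    and "\<And>r. r \<in> {0..T} \<Longrightarrow> \<bar>stop_path s2 \<phi> r - stop_path t2 \<psi> r\<bar> \<le> e"
  shows "\<bar>g s1 m (stop_path s2 \<phi>) - g t1 m (stop_path t2 \<psi>)\<bar> \<le> L * (\<bar>s1 - t1\<bar> + e)"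
proof -
  have "path_dist T s2 \<phi> t2 \<psi> \<le> e" using T_pos assms(8) by (intro path_dist_le) auto
  then have "L * (\<bar>s1 - t1\<bar> + path_dist T s2 \<phi> t2 \<psi>) \<le> L * (\<bar>s1 - t1\<bar> + e)" using L_pos by simp
  with Lipschitz[OF assms(1-7)] show ?thesis by linarith
qed

text \<open>Time moves in two places: the explicit argument of \<open>g\<close> costs the distance
  of the times, and the stopping costs the oscillation of the path between them. With
  \<open>e' = e / (4 * L)\<close> both together stay below \<open>e\<close>.\<close>

lemma continuous_on_g_path:
  assumes m: "m \<in> A" and \<phi>: "continuous_on {0..T} \<phi>"
  shows "continuous_on {0..T} (\<lambda>s. g s m (stop_path s \<phi>))"
  unfolding continuous_on_def
proof
  fix s assume s: "s \<in> {0..T}"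
  let ?F = "at s within {0..T}"
  have t0: "((\<lambda>x. \<bar>x - s\<bar>) \<longlongrightarrow> 0) ?F"
    by (auto intro!: tendsto_eq_intros)
  show "((\<lambda>s. g s m (stop_path s \<phi>)) \<longlongrightarrow> g s m (stop_path s \<phi>)) ?F"
  proof (rule tendstoI)
    fix e :: real assume e: "e > 0"
    define e' where "e' = e / (4 * L)"
    have e': "e' > 0" using e L_pos by (simp add: e'_def)
    from eventually_small_oscillation[OF t0 \<phi> e'] order_tendstoD(2)[OF t0 e']
    have "\<forall>\<^sub>F x in ?F. x \<in> {0..T} \<longrightarrow> dist (g x m (stop_path x \<phi>)) (g s m (stop_path s \<phi>)) < e"
    proof eventually_elim
      case (elim x)
      show ?case
      proof
        assume x: "x \<in> {0..T}"
        have "\<bar>g x m (stop_path x \<phi>) - g s m (stop_path s \<phi>)\<bar> \<le> L * (\<bar>x - s\<bar> + e')"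
        proof (rule g_diff_le)
          fix r assume "r \<in> {0..T}"
          then show "\<bar>stop_path x \<phi> r - stop_path s \<phi> r\<bar> \<le> e'"
            unfolding stop_path_def using elim x s by (intro elim(1)[rule_format]) auto
        qed (use x s m \<phi> in auto)
        also have "\<dots> \<le> L * (e' + e')" using elim L_pos by simp
        also have "\<dots> < e" using e L_pos by (simp add: e'_def)
        finally show "dist (g x m (stop_path x \<phi>)) (g s m (stop_path s \<phi>)) < e"
          by (simp add: dist_real_def)
      qed
    qed
    then show "\<forall>\<^sub>F x in ?F. dist (g x m (stop_path x \<phi>)) (g s m (stop_path s \<phi>)) < e"
      by (simp add: eventually_at_filter)
  qed
qed

lemma continuous_on_g_time:
  assumes m: "m \<in> A" and \<phi>: "continuous_on {0..T} \<phi>" and t: "t \<in> {0..T}"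
  shows "continuous_on {0..T} (\<lambda>s. g s m (stop_path t \<phi>))"
proof -
  have "L-lipschitz_on {0..T} (\<lambda>s. g s m (stop_path t \<phi>))"
  proof (rule lipschitz_onI)
    fix x y assume "x \<in> {0..T}" "y \<in> {0..T}"
    then show "dist (g x m (stop_path t \<phi>)) (g y m (stop_path t \<phi>)) \<le> L * dist x y"
      using g_diff_le[of x t y t m \<phi> \<phi> 0] m \<phi> t by (simp add: dist_real_def)
  qed (use L_pos in simp)
  then show ?thesis by (rule lipschitz_on_continuous_on)
qed

lemma g_interp_measurable:
  assumes "m \<in> A" "s \<in> {0..T}" "t \<in> {0..T}"
  shows "(\<lambda>y. g s m (stop_path t (interp \<tau> n y))) \<in> borel_measurable (Pi\<^sub>M UNIV (\<lambda>_. borel))"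
proof -
  have "continuous_on UNIV (\<lambda>y. g s m (stop_path t (interp \<tau> n y)))"
  proof (rule continuous_on_if_interp_dist_bound[where K=L and n=n])
    fix y z
    have "\<bar>g s m (stop_path t (interp \<tau> n z)) - g s m (stop_path t (interp \<tau> n y))\<bar> \<le> L * (\<bar>s - s\<bar> + interp_dist n z y)"
      using assms by (intro g_diff_le continuous_on_interp) (auto simp: stop_path_def interp_dist_bound)
    then show "dist (g s m (stop_path t (interp \<tau> n z))) (g s m (stop_path t (interp \<tau> n y))) \<le> L * interp_dist n z y"
      by (simp add: dist_real_def)
  qed
  then show ?thesis
    by (simp add: borel_measurable_continuous_onI measurable_cong_sets[OF sets_PiM_equal_borel refl])
qed

text \<open>Measurability in the sample point comes from the Lipschitz condition alone: the stopped
  path is a uniform limit of interpolations through finitely many of its values, and on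
  interpolations \<open>g\<close> is continuous in the nodes.\<close>

lemma g_path_measurable:
  assumes tp: "\<And>n. n \<ge> 1 \<Longrightarrow> time_points T n (\<tau> n)" and mesh: "(\<lambda>n. mesh n (\<tau> n)) \<longlonglongrightarrow> 0"
    and m: "m \<in> A" and s: "s \<in> {0..T}" and t: "t \<in> {0..T}"
    and cont: "\<And>\<omega>. \<omega> \<in> space N \<Longrightarrow> continuous_on {0..T} (\<lambda>r. Y r \<omega>)"
    and meas: "\<And>r. r \<in> {0..t} \<Longrightarrow> Y r \<in> borel_measurable N"
  shows "(\<lambda>\<omega>. g s m (stop_path t (\<lambda>r. Y r \<omega>))) \<in> borel_measurable N"
proof -
  \<comment> \<open>The path is stopped before it is sampled, so grid times beyond \<open>t\<close>
    return the value at \<open>t\<close> and nothing after \<open>t\<close> is consulted.\<close>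
  define y where "y n \<omega> = (\<lambda>j. stop_path t (\<lambda>r. Y r \<omega>) (\<tau> n j))" for n \<omega>
  have y_meas: "y n \<in> measurable N (Pi\<^sub>M UNIV (\<lambda>_. borel))" for n
    unfolding y_def[abs_def] stop_path_def using t by (intro measurable_PiM_single' meas) auto
  show ?thesis
  proof (rule borel_measurable_LIMSEQ_metric)
    show "(\<lambda>\<omega>. g s m (stop_path t (interp (\<tau> n) n (y n \<omega>)))) \<in> borel_measurable N" for n
      by (rule measurable_compose[OF y_meas g_interp_measurable[OF m s t]])
    fix \<omega> assume \<omega>: "\<omega> \<in> space N"
    let ?\<psi> = "stop_path t (\<lambda>r. Y r \<omega>)"
    have \<psi>: "continuous_on {0..T} ?\<psi>"
      using continuous_on_stop_path[OF cont[OF \<omega>] t] by (rule continuous_on_subset) auto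
    show "(\<lambda>n. g s m (stop_path t (interp (\<tau> n) n (y n \<omega>)))) \<longlonglongrightarrow> g s m (stop_path t (\<lambda>r. Y r \<omega>))"
    proof (rule tendstoI)
      fix e :: real assume e: "e > 0"
      define e' where "e' = e / (2 * L)"
      have e': "e' > 0" using e L_pos by (simp add: e'_def)
      from eventually_small_oscillation[OF mesh \<psi> e'] eventually_ge_at_top[of 1]
      show "\<forall>\<^sub>F n in sequentially. dist (g s m (stop_path t (interp (\<tau> n) n (y n \<omega>)))) (g s m (stop_path t (\<lambda>r. Y r \<omega>))) < e"
      proof eventually_elim
        case (elim n)
        have "\<bar>g s m (stop_path t (interp (\<tau> n) n (y n \<omega>))) - g s m (stop_path t (\<lambda>r. Y r \<omega>))\<bar> \<le> L * (\<bar>s - s\<bar> + e')"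
        proof (rule g_diff_le)
          fix r assume r: "r \<in> {0..T}"
          have "\<bar>interp (\<tau> n) n (\<lambda>i. ?\<psi> (\<tau> n i)) (max 0 (min r t)) - ?\<psi> (max 0 (min r t))\<bar> \<le> e'"
            by (rule interp_approx[OF tp]) (use elim r t in auto)
          then show "\<bar>stop_path t (interp (\<tau> n) n (y n \<omega>)) r - stop_path t (\<lambda>r. Y r \<omega>) r\<bar> \<le> e'"
            using t unfolding y_def by (simp add: stop_path_def min.assoc max_min_distrib2)
        qed (use m s t cont[OF \<omega>] continuous_on_interp in auto)
        also have "\<dots> < e" using e L_pos by (simp add: e'_def)
        finally show ?case by (simp add: dist_real_def)
      qed
    qed
  qed
qed

section \<open>The Euler recursion as a map of message and noise increments\<close>

definition drift :: "(nat \<Rightarrow> real) \<Rightarrow> 'm \<Rightarrow> nat \<Rightarrow> (nat \<Rightarrow> real) \<Rightarrow> real" where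
  "drift \<tau> m i y = (LBINT s:{\<tau> i..\<tau> (Suc i)}. g s m (stop_path (\<tau> i) (interp \<tau> i y)))"

text \<open>For a fixed message both \<open>Y\<close> and its approximation are images under this
  deterministic map, with different increments \<open>x\<close>; an estimate between the laws of the
  increments thereby passes to the grid values. Entries not yet computed are 0.\<close>

primrec euler_vec :: "(nat \<Rightarrow> real) \<Rightarrow> 'm \<Rightarrow> (nat \<Rightarrow> real) \<Rightarrow> nat \<Rightarrow> nat \<Rightarrow> real" where
  "euler_vec \<tau> m x 0 = (\<lambda>_. 0)"
| "euler_vec \<tau> m x (Suc i) = (euler_vec \<tau> m x i)
     (Suc i := euler_vec \<tau> m x i i + drift \<tau> m i (euler_vec \<tau> m x i) + x i)"

lemma drift_cong: "(\<And>j. j \<le> i \<Longrightarrow> y j = z j) \<Longrightarrow> drift \<tau> m i y = drift \<tau> m i z"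
  unfolding drift_def using interp_cong[of i y z \<tau>] by simp

lemma euler_vec_unique:
  assumes "y 0 = 0" "\<And>i. i < n \<Longrightarrow> y (Suc i) = y i + drift \<tau> m i y + x i"
    and "i \<le> n"
  shows "euler_vec \<tau> m x n i = y i"
proof -
  have "\<forall>i\<le>k. euler_vec \<tau> m x k i = y i" if "k \<le> n" for k
    using that
  proof (induction k)
    case (Suc k)
    then have IH: "\<forall>i\<le>k. euler_vec \<tau> m x k i = y i" by simp
    then have "drift \<tau> m k (euler_vec \<tau> m x k) = drift \<tau> m k y" by (intro drift_cong) auto
    then show ?case using IH Suc.prems assms(2)[of k] by (auto simp: le_Suc_eq)
  qed (use assms(1) in auto)
  with assms(3) show ?thesis by simp
qed

lemma drift_measurable:
  assumes tp: "time_points T n \<tau>" and m: "m \<in> A" and i: "i < n"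
  shows "drift \<tau> m i \<in> borel_measurable (Pi\<^sub>M UNIV (\<lambda>_. borel))"
proof -
  have sub: "{\<tau> i..\<tau> (Suc i)} \<subseteq> {0..T}" and ti: "\<tau> i \<in> {0..T}" and lt: "\<tau> i < \<tau> (Suc i)"
    using time_points_in[OF tp, of i] time_points_in[OF tp, of "Suc i"] time_points_less[OF tp i] i by auto
  have cont: "continuous_on {\<tau> i..\<tau> (Suc i)} (\<lambda>s. g s m (stop_path (\<tau> i) (interp \<tau> i y)))" for y
    using continuous_on_g_time[OF m continuous_on_interp ti] sub by (rule continuous_on_subset)
  have "continuous_on UNIV (drift \<tau> m i)"
  proof (rule continuous_on_if_interp_dist_bound[where K="L * (\<tau> (Suc i) - \<tau> i)" and n=i])
    fix y z
    have "\<bar>drift \<tau> m i z - drift \<tau> m i y\<bar> \<le> (L * interp_dist i z y) * (\<tau> (Suc i) - \<tau> i)"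
      unfolding drift_def LBINT_eq_integral[OF cont]
    proof (rule abs_integral_diff_le[OF _ cont cont])
      fix s assume "s \<in> {\<tau> i..\<tau> (Suc i)}"
      then have "\<bar>g s m (stop_path (\<tau> i) (interp \<tau> i z)) - g s m (stop_path (\<tau> i) (interp \<tau> i y))\<bar>
          \<le> L * (\<bar>s - s\<bar> + interp_dist i z y)"
        using sub ti m by (intro g_diff_le continuous_on_interp) (auto simp: stop_path_def interp_dist_bound)
      then show "\<bar>g s m (stop_path (\<tau> i) (interp \<tau> i z)) - g s m (stop_path (\<tau> i) (interp \<tau> i y))\<bar>
          \<le> L * interp_dist i z y" by simp
    qed (use lt in simp)
    then show "dist (drift \<tau> m i z) (drift \<tau> m i y) \<le> L * (\<tau> (Suc i) - \<tau> i) * interp_dist i z y"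
      by (simp add: dist_real_def mult_ac)
  qed
  then show ?thesis
    by (simp add: borel_measurable_continuous_onI measurable_cong_sets[OF sets_PiM_equal_borel refl])
qed

lemma euler_vec_measurable:
  assumes tp: "time_points T n \<tau>" and m: "m \<in> A" and "k \<le> n"
  shows "(\<lambda>x. euler_vec \<tau> m x k) \<in> measurable (Pi\<^sub>M UNIV (\<lambda>_. borel)) (Pi\<^sub>M UNIV (\<lambda>_. borel))"
  using assms(3)
proof (induction k)
  case (Suc k)
  then have [measurable]: "(\<lambda>x. euler_vec \<tau> m x k) \<in> measurable (Pi\<^sub>M UNIV (\<lambda>_. borel)) (Pi\<^sub>M UNIV (\<lambda>_. borel))"
    by simp
  note [measurable] = drift_measurable[OF tp m, of k]
  show ?case unfolding euler_vec.simps
    by (rule measurable_fun_upd[where J=UNIV]) (use Suc.prems in \<open>auto\<close>)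
qed (simp add: space_PiM)

end


section \<open>The feedback channel\<close>

lemma tendsto_fun:
  fixes f :: "'c \<Rightarrow> 'i \<Rightarrow> 'b::topological_space"
  assumes "\<And>i. ((\<lambda>n. f n i) \<longlongrightarrow> l i) G"
  shows "(f \<longlongrightarrow> l) G"
proof -
  have "limitin (product_topology (\<lambda>_. euclidean) UNIV) f l G"
    using assms by (simp add: limitin_componentwise limitin_canonical_iff)
  then show ?thesis by (simp add: euclidean_product_topology limitin_canonical_iff)
qed

lemma (in prob_space) prob_diff_le_prob_neq:
  assumes C: "C \<in> events" and p: "{\<omega>\<in>space M. p \<omega>} \<in> events" and q: "{\<omega>\<in>space M. q \<omega>} \<in> events"
  shows "\<bar>prob {\<omega>\<in>C. p \<omega>} - prob {\<omega>\<in>C. q \<omega>}\<bar> \<le> prob {\<omega>\<in>C. p \<omega> \<noteq> q \<omega>}"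
proof -
  have eq: "{\<omega>\<in>C. p \<omega>} = C \<inter> {\<omega>\<in>space M. p \<omega>}" "{\<omega>\<in>C. q \<omega>} = C \<inter> {\<omega>\<in>space M. q \<omega>}"
    "{\<omega>\<in>C. p \<omega> \<noteq> q \<omega>} = ({\<omega>\<in>C. p \<omega>} - {\<omega>\<in>C. q \<omega>}) \<union> ({\<omega>\<in>C. q \<omega>} - {\<omega>\<in>C. p \<omega>})"
    using sets.sets_into_space[OF C] by auto
  have m: "{\<omega>\<in>C. p \<omega>} \<in> events" "{\<omega>\<in>C. q \<omega>} \<in> events"
    unfolding eq(1,2) using C p q by auto
  have d: "{\<omega>\<in>C. p \<omega> \<noteq> q \<omega>} \<in> events" unfolding eq(3) using m by auto
  have "prob {\<omega>\<in>C. p \<omega>} \<le> prob ({\<omega>\<in>C. q \<omega>} \<union> {\<omega>\<in>C. p \<omega> \<noteq> q \<omega>})"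
    using m d by (intro finite_measure_mono) auto
  also have "\<dots> \<le> prob {\<omega>\<in>C. q \<omega>} + prob {\<omega>\<in>C. p \<omega> \<noteq> q \<omega>}"
    using m d by (intro measure_Un_le) auto
  finally have 1: "prob {\<omega>\<in>C. p \<omega>} \<le> prob {\<omega>\<in>C. q \<omega>} + prob {\<omega>\<in>C. p \<omega> \<noteq> q \<omega>}" .
  have "prob {\<omega>\<in>C. q \<omega>} \<le> prob ({\<omega>\<in>C. p \<omega>} \<union> {\<omega>\<in>C. p \<omega> \<noteq> q \<omega>})"
    using m d by (intro finite_measure_mono) auto
  also have "\<dots> \<le> prob {\<omega>\<in>C. p \<omega>} + prob {\<omega>\<in>C. p \<omega> \<noteq> q \<omega>}"
    using m d by (intro measure_Un_le) auto
  finally show ?thesis using 1 by linarith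
qed

locale feedback_channel = prob_space P + lipschitz_drift T L A g
  for P :: "'a measure" and T L :: real and A :: "'m set"
    and g :: "real \<Rightarrow> 'm \<Rightarrow> (real \<Rightarrow> real) \<Rightarrow> real" +
  fixes F :: "real \<Rightarrow> 'a measure" and B Y :: "real \<Rightarrow> 'a \<Rightarrow> real" and M :: "'a \<Rightarrow> 'm"
    and \<tau> :: "nat \<Rightarrow> nat \<Rightarrow> real" and Yn :: "nat \<Rightarrow> real \<Rightarrow> 'a \<Rightarrow> real"
  assumes usual: "usual_conditions P F"
    and brownian: "brownian_motion P F B"
    and finite_A: "finite A"
    and M_meas: "M \<in> measurable P (count_space A)"
    and M_indep: "independent_of_process P (count_space A) M B"
    and solution: "strong_solution P T (count_space A) g M B Y"
    and tp: "\<And>n. n \<ge> 1 \<Longrightarrow> time_points T n (\<tau> n)"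
    and mesh_0: "(\<lambda>n. mesh n (\<tau> n)) \<longlonglongrightarrow> 0"
    and euler: "\<And>n \<omega>. n \<ge> 1 \<Longrightarrow> \<omega> \<in> space P \<Longrightarrow>
      euler_maruyama g n (\<tau> n) (M \<omega>) (\<lambda>t. B t \<omega>) (\<lambda>t. Yn n t \<omega>)"
begin

section \<open>The completed filtration of message and noise\<close>

abbreviation "\<sigma>M \<equiv> sets (vimage_algebra (space P) M (count_space A))"
abbreviation "aug \<equiv> augmented_filtration P (count_space A) M B"

lemma F_filtration: "filtration (space P) F"
  using usual unfolding usual_conditions_def by (rule conjunct1)

lemma F_sub: "subalgebra P (F t)"
proof -
  have "sets (F t) \<subseteq> events" using usual unfolding usual_conditions_def by blast
  then show ?thesis using filtration.space_F[OF F_filtration] by (simp add: subalgebra_def)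
qed

lemma F_mono: "s \<le> t \<Longrightarrow> sets (F s) \<subseteq> sets (F t)"
  by (rule filtration.sets_F_mono[OF F_filtration])

lemma B_F: "0 \<le> t \<Longrightarrow> B t \<in> borel_measurable (F t)"
  using brownian by (simp add: brownian_motion_def)

lemma B_meas: "0 \<le> t \<Longrightarrow> B t \<in> borel_measurable P"
  using measurable_from_subalg[OF F_sub B_F] .

lemma \<sigma>M_events: "\<sigma>M \<subseteq> events"
  by (intro sets_image_in_sets M_meas refl)

definition aug_generator :: "real \<Rightarrow> 'a set set" where
  "aug_generator t = \<sigma>M \<union> (\<Union>r\<in>{0..t}. sets (vimage_algebra (space P) (B r) borel)) \<union> null_sets P"

lemma aug_generator_events: "aug_generator t \<subseteq> events"
  unfolding aug_generator_def
proof (intro Un_least UN_least \<sigma>M_events)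
  fix r assume "r \<in> {0..t}"
  then show "sets (vimage_algebra (space P) (B r) borel) \<subseteq> events"
    by (intro sets_image_in_sets B_meas refl) simp
qed auto

lemma aug_generator_Pow: "aug_generator t \<subseteq> Pow (space P)"
  using aug_generator_events sets.space_closed by (rule order_trans)

lemma aug_eq: "aug t = sigma (space P) (aug_generator t)"
  by (simp add: augmented_filtration_def aug_generator_def)

lemma space_aug: "space (aug t) = space P"
  unfolding aug_eq by (rule space_measure_of[OF aug_generator_Pow])

lemma sets_aug: "sets (aug t) = sigma_sets (space P) (aug_generator t)"
  unfolding aug_eq by (rule sets_measure_of[OF aug_generator_Pow])

lemma aug_sub: "subalgebra P (aug t)"
  unfolding subalgebra_def space_aug sets_aug
  by (intro conjI refl sets.sigma_sets_subset aug_generator_events)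

lemma aug_mono:
  assumes "s \<le> t" shows "sets (aug s) \<subseteq> sets (aug t)"
proof -
  have "aug_generator s \<subseteq> aug_generator t"
    unfolding aug_generator_def using assms by (intro Un_mono UN_mono order_refl) auto
  then show ?thesis unfolding sets_aug by (rule sigma_sets_mono')
qed

lemma aug_mono_measurable: "s \<le> t \<Longrightarrow> f \<in> borel_measurable (aug s) \<Longrightarrow> f \<in> borel_measurable (aug t)"
  using aug_mono[of s t] by (auto simp: space_aug measurable_def)

lemma \<sigma>M_aug: "\<sigma>M \<subseteq> sets (aug t)"
  unfolding sets_aug by (auto simp: aug_generator_def)

lemma B_aug: "0 \<le> r \<Longrightarrow> r \<le> t \<Longrightarrow> B r \<in> borel_measurable (aug t)"
proof (rule measurableI)
  fix E :: "real set" assume "0 \<le> r" "r \<le> t" "E \<in> sets borel"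
  then have "B r -` E \<inter> space P \<in> aug_generator t"
    by (auto simp: aug_generator_def intro!: in_vimage_algebra bexI[of _ r])
  then show "B r -` E \<inter> space (aug t) \<in> sets (aug t)"
    by (simp add: sets_aug space_aug)
qed simp

text \<open>This supplies the independence that the Gaussian steps require: \<open>Y\<close> is
  adapted to \<open>aug\<close>, which knows the message besides the past noise, and increments of
  \<open>B\<close> must still be fresh relative to it.\<close>

lemma increment_indep_aug:
  assumes s: "0 \<le> s" "s < t"
  shows "indep_set (sets (aug s)) (sets (vimage_algebra (space P) (\<lambda>\<omega>. B t \<omega> - B s \<omega>) borel))"
proof -
  let ?path = "\<lambda>\<omega>. \<lambda>t\<in>{0..}. B t \<omega>"
  let ?V = "vimage_algebra (space P) ?path (Pi\<^sub>M {0..} (\<lambda>_. borel))"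
  let ?I = "vimage_algebra (space P) (\<lambda>\<omega>. B t \<omega> - B s \<omega>) borel"
  have coord: "B r \<in> borel_measurable ?V" if "0 \<le> r" for r
  proof -
    have "?path \<in> measurable ?V (Pi\<^sub>M {0..} (\<lambda>_. borel))"
      by (rule measurable_vimage_algebra1) (auto simp: space_PiM)
    then have "(\<lambda>\<omega>. ?path \<omega> r) \<in> borel_measurable ?V"
      by (rule measurable_compose[OF _ measurable_component_singleton]) (use that in simp)
    then show ?thesis using that by simp
  qed
  have I_V: "sets ?I \<subseteq> sets ?V"
    using coord[of t] coord[of s] s by (intro sets_image_in_sets) auto
  have M_V: "indep_set \<sigma>M (sets ?V)"
    using M_indep by (simp add: independent_of_process_def)
  have F_I: "indep_set (sets (F s)) (sets ?I)"
    using brownian s by (simp add: brownian_motion_def)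
  \<comment> \<open>\<open>M\<close> is not assumed \<open>F 0\<close>-measurable: an event of \<open>H\<close> is independent of the increment by the
    Brownian property, and its intersection with an event of the increment is independent of \<open>M\<close>.\<close>
  define H where "H = sets (F s) \<inter> sets ?V"
  \<comment> \<open>The third factor brings in the null sets while keeping the family closed under
    intersection, so that independence extends to the generated sigma-algebra.\<close>
  define gen where "gen = {a \<inter> b \<inter> c | a b c. a \<in> \<sigma>M \<and> b \<in> H \<and> c \<in> insert (space P) (null_sets P)}"
  have HP: "H \<subseteq> events" using F_sub[of s] by (auto simp: H_def subalgebra_def)
  have genI: "x \<in> gen" if "x = a \<inter> b \<inter> c" "a \<in> \<sigma>M" "b \<in> H" "c \<in> insert (space P) (null_sets P)" for x a b c
    using that unfolding gen_def by blast
  have top: "space P \<in> \<sigma>M" "space P \<in> H"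
    using sets.top[of "vimage_algebra (space P) M (count_space A)"] sets.top[of ?V]
      sets.top[of "F s", unfolded filtration.space_F[OF F_filtration]]
    by (auto simp: H_def)
  have gen_events: "gen \<subseteq> events"
    using \<sigma>M_events HP by (auto simp: gen_def)
  have ind: "indep_set gen (sets ?I)"
    unfolding indep_sets2_eq
  proof (intro conjI ballI)
    show "gen \<subseteq> events" by fact
    show "sets ?I \<subseteq> events" using indep_setD_ev2[OF F_I] .
    fix x d assume "x \<in> gen" and d: "d \<in> sets ?I"
    then obtain a b c where x: "x = a \<inter> b \<inter> c" "a \<in> \<sigma>M" "b \<in> H" "c \<in> insert (space P) (null_sets P)"
      by (auto simp: gen_def)
    have de: "d \<in> events" using d indep_setD_ev2[OF F_I] by auto
    have abe: "a \<in> events" "b \<in> events" using x \<sigma>M_events HP by auto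
    show "prob (x \<inter> d) = prob x * prob d"
    proof (cases "c \<in> null_sets P")
      case True
      then have "x \<in> null_sets P" "x \<inter> d \<in> null_sets P"
        using abe de unfolding x(1) by (auto intro: null_set_Int1 null_set_Int2)
      then show ?thesis by (simp add: measure_eq_0_null_sets)
    next
      case False
      then have xab: "x = a \<inter> b" using x abe sets.sets_into_space[of b P] by auto
      have "prob (x \<inter> d) = prob (a \<inter> (b \<inter> d))" by (simp add: xab Int_assoc)
      also have "\<dots> = prob a * prob (b \<inter> d)"
        using x d I_V by (intro indep_setD[OF M_V]) (auto simp: H_def)
      also have "prob (b \<inter> d) = prob b * prob d"
        using x d by (intro indep_setD[OF F_I]) (auto simp: H_def)
      also have "prob a * (prob b * prob d) = prob (a \<inter> b) * prob d"
        using x by (subst indep_setD[OF M_V]) (auto simp: H_def)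
      finally show ?thesis by (simp add: xab)
    qed
  qed
  have "Int_stable gen"
  proof (rule Int_stableI)
    fix x y assume "x \<in> gen" "y \<in> gen"
    then obtain a b c a' b' c' where x: "x = a \<inter> b \<inter> c" "a \<in> \<sigma>M" "b \<in> H" "c \<in> insert (space P) (null_sets P)"
      and y: "y = a' \<inter> b' \<inter> c'" "a' \<in> \<sigma>M" "b' \<in> H" "c' \<in> insert (space P) (null_sets P)"
      unfolding gen_def by blast
    show "x \<inter> y \<in> gen"
    proof (rule genI)
      show "x \<inter> y = (a \<inter> a') \<inter> (b \<inter> b') \<inter> (c \<inter> c')" using x y by auto
      show "c \<inter> c' \<in> insert (space P) (null_sets P)"
        using x(4) y(4) by (auto intro: null_set_Int1 null_set_Int2)
    qed (use x y in \<open>auto simp: H_def\<close>)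
  qed
  then have "indep_set (sigma_sets (space P) gen) (sigma_sets (space P) (sets ?I))"
    by (intro indep_set_sigma_sets[OF ind]) (auto simp: Int_stable_def)
  moreover have "sigma_sets (space P) (sets ?I) = sets ?I"
    using sets.sigma_sets_eq[of ?I] by simp
  moreover have "sets (aug s) \<subseteq> sigma_sets (space P) gen"
    unfolding sets_aug
  proof (rule sigma_sets_mono)
    show "aug_generator s \<subseteq> sigma_sets (space P) gen"
    proof
      fix x assume "x \<in> aug_generator s"
      then consider "x \<in> \<sigma>M" | r where "r \<in> {0..s}" "x \<in> sets (vimage_algebra (space P) (B r) borel)" | "x \<in> null_sets P"
        by (auto simp: aug_generator_def)
      then have "x \<in> gen"
      proof cases
        case 1
        then show ?thesis using top \<sigma>M_events sets.sets_into_space[of x P] by (intro genI[of _ x "space P" "space P"]) auto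
      next
        case 2
        have "B r \<in> borel_measurable (F s)"
          using B_F[of r] F_mono[of r s] F_sub[of r] F_sub[of s] 2 by (auto simp: measurable_def subalgebra_def)
        then have "sets (vimage_algebra (space P) (B r) borel) \<subseteq> sets (F s)"
          using F_sub[of s] by (intro sets_image_in_sets) (auto simp: subalgebra_def)
        moreover have "sets (vimage_algebra (space P) (B r) borel) \<subseteq> sets ?V"
          using 2 coord[of r] by (intro sets_image_in_sets) auto
        ultimately have "x \<in> H" using 2 by (auto simp: H_def)
        then show ?thesis using top HP sets.sets_into_space[of x P] by (intro genI[of _ "space P" x "space P"]) auto
      next
        case 3
        then show ?thesis using top sets.sets_into_space[of x P] by (intro genI[of _ "space P" "space P" x]) auto
      qed
      then show "x \<in> sigma_sets (space P) gen" by auto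
    qed
  qed
  ultimately show ?thesis
    unfolding indep_sets2_eq by (metis subset_iff)
qed

lemma increment_gaussian:
  "0 \<le> s \<Longrightarrow> s < t \<Longrightarrow> distributed P lborel (\<lambda>\<omega>. B t \<omega> - B s \<omega>) (\<lambda>x. ennreal (normal_density 0 (sqrt (t - s)) x))"
  using brownian by (simp add: brownian_motion_def)

section \<open>The output process, the drift gap and the tilted noise\<close>

lemma Y_cont: "\<omega> \<in> space P \<Longrightarrow> continuous_on {0..T} (\<lambda>t. Y t \<omega>)"
  using solution by (simp add: strong_solution_def)

lemma Y_aug: "r \<in> {0..T} \<Longrightarrow> r \<le> t \<Longrightarrow> Y r \<in> borel_measurable (aug t)"
  using solution by (intro aug_mono_measurable[of r t]) (auto simp: strong_solution_def)

lemma Y_meas: "r \<in> {0..T} \<Longrightarrow> Y r \<in> borel_measurable P"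
  using measurable_from_subalg[OF aug_sub Y_aug[of r r]] by simp

text \<open>
  \<open>drift_gap\<close> is the difference, at a time of the \<open>i\<close>-th step, between the true drift along \<open>Y\<close>
  and the drift which the Euler scheme would use if it had seen \<open>Y\<close> on the grid.
\<close>

definition drift_gap :: "nat \<Rightarrow> 'm \<Rightarrow> nat \<Rightarrow> real \<Rightarrow> 'a \<Rightarrow> real" where
  "drift_gap n m i s \<omega> = g s m (stop_path s (\<lambda>r. Y r \<omega>))
     - g s m (stop_path (\<tau> n i) (interp (\<tau> n) i (\<lambda>j. Y (\<tau> n j) \<omega>)))"

definition clip :: "real \<Rightarrow> real \<Rightarrow> real" where
  "clip e x = max (- e) (min e x)"

lemma clip_abs_le: "0 \<le> e \<Longrightarrow> \<bar>clip e x\<bar> \<le> e"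
  by (auto simp: clip_def)

lemma clip_id: "\<bar>x\<bar> \<le> e \<Longrightarrow> clip e x = x"
  by (auto simp: clip_def)

lemma grid_interval:
  assumes "1 \<le> n" "i < n"
  shows "{\<tau> n i..\<tau> n (Suc i)} \<subseteq> {0..T}" "\<tau> n i \<in> {0..T}" "\<tau> n (Suc i) \<in> {0..T}" "\<tau> n i < \<tau> n (Suc i)"
  using time_points_in[OF tp[OF assms(1)], of i] time_points_in[OF tp[OF assms(1)], of "Suc i"]
    time_points_less[OF tp[OF assms(1)], of i] assms by auto

lemma drift_gap_continuous:
  assumes n: "1 \<le> n" "i < n" and m: "m \<in> A" and \<omega>: "\<omega> \<in> space P"
  shows "continuous_on {\<tau> n i..\<tau> n (Suc i)} (\<lambda>s. drift_gap n m i s \<omega>)"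
  unfolding drift_gap_def
proof (rule continuous_on_diff)
  show "continuous_on {\<tau> n i..\<tau> n (Suc i)} (\<lambda>s. g s m (stop_path s (\<lambda>r. Y r \<omega>)))"
    using continuous_on_g_path[OF m Y_cont[OF \<omega>]] grid_interval(1)[OF n] by (rule continuous_on_subset)
  show "continuous_on {\<tau> n i..\<tau> n (Suc i)} (\<lambda>s. g s m (stop_path (\<tau> n i) (interp (\<tau> n) i (\<lambda>j. Y (\<tau> n j) \<omega>))))"
    using continuous_on_g_time[OF m continuous_on_interp grid_interval(2)[OF n]] grid_interval(1)[OF n]
    by (rule continuous_on_subset)
qed

lemma continuous_on_clip: "continuous_on S f \<Longrightarrow> continuous_on S (\<lambda>x. clip e (f x))"
  unfolding clip_def by (intro continuous_intros)

lemma drift_gap_aug: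
  assumes n: "1 \<le> n" "i < n" and m: "m \<in> A" and s: "s \<in> {\<tau> n i..\<tau> n (Suc i)}"
  shows "drift_gap n m i s \<in> borel_measurable (aug s)"
proof -
  have sT: "s \<in> {0..T}" using s grid_interval(1)[OF n] by auto
  have "(\<lambda>\<omega>. g s m (stop_path s (\<lambda>r. Y r \<omega>))) \<in> borel_measurable (aug s)"
    by (rule g_path_measurable[OF tp mesh_0 m sT sT]) (use sT Y_cont Y_aug in \<open>auto simp: space_aug\<close>)
  moreover have "(\<lambda>\<omega>. g s m (stop_path (\<tau> n i) (interp (\<tau> n) i (\<lambda>j. Y (\<tau> n j) \<omega>)))) \<in> borel_measurable (aug s)"
  proof -
    \<comment> \<open>Among the nodes only those up to \<open>i\<close> are known at time
      \<open>s\<close>. The others are set to 0, which an interpolation over \<open>i\<close> steps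
      does not see.\<close>
    define y where "y \<omega> = (\<lambda>j. if j \<le> i then Y (\<tau> n j) \<omega> else 0)" for \<omega>
    have "Y (\<tau> n j) \<in> borel_measurable (aug s)" if "j \<le> i" for j
      using that n s time_points_in[OF tp[OF n(1)], of j] time_points_mono[OF tp[OF n(1)], of j i]
      by (intro Y_aug) auto
    then have "y \<in> measurable (aug s) (Pi\<^sub>M UNIV (\<lambda>_. borel))"
      unfolding y_def[abs_def]
    proof (intro measurable_PiM_single')
      fix j
      show "(\<lambda>\<omega>. if j \<le> i then Y (\<tau> n j) \<omega> else 0) \<in> borel_measurable (aug s)"
        using \<open>\<And>j. j \<le> i \<Longrightarrow> Y (\<tau> n j) \<in> borel_measurable (aug s)\<close>[of j] by (cases "j \<le> i") auto
    qed (auto simp: space_PiM)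
    from measurable_compose[OF this g_interp_measurable[OF m sT grid_interval(2)[OF n]]]
    have "(\<lambda>\<omega>. g s m (stop_path (\<tau> n i) (interp (\<tau> n) i (y \<omega>)))) \<in> borel_measurable (aug s)" .
    moreover have "interp (\<tau> n) i (y \<omega>) = interp (\<tau> n) i (\<lambda>j. Y (\<tau> n j) \<omega>)" for \<omega>
      by (rule interp_cong) (simp add: y_def)
    ultimately show ?thesis by simp
  qed
  ultimately show ?thesis unfolding drift_gap_def[abs_def] by (rule borel_measurable_diff)
qed

definition noise :: "nat \<Rightarrow> 'a \<Rightarrow> nat \<Rightarrow> real" where
  "noise n \<omega> = (\<lambda>i. if i < n then B (\<tau> n (Suc i)) \<omega> - B (\<tau> n i) \<omega> else 0)"

text \<open>The message is a parameter \<open>m\<close> instead of \<open>M \<omega>\<close>: laws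
  are compared for each \<open>m\<close> separately, and the link with \<open>Y\<close> is drawn
  only where \<open>M \<omega> = m\<close>.\<close>

definition tilted_noise :: "nat \<Rightarrow> 'm \<Rightarrow> real \<Rightarrow> 'a \<Rightarrow> nat \<Rightarrow> real" where
  "tilted_noise n m e \<omega> = (\<lambda>i. if i < n then B (\<tau> n (Suc i)) \<omega> - B (\<tau> n i) \<omega>
     + (LBINT s:{\<tau> n i..\<tau> n (Suc i)}. clip e (drift_gap n m i s \<omega>)) else 0)"

text \<open>The drift integral is replaced by a left Riemann sum with \<open>N\<close> terms per
  grid step, each term being predictable for the refined grid.\<close>

definition step_tilted_noise :: "nat \<Rightarrow> 'm \<Rightarrow> real \<Rightarrow> nat \<Rightarrow> 'a \<Rightarrow> nat \<Rightarrow> real" where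
  "step_tilted_noise n m e N \<omega> = (\<lambda>i. if i < n then B (\<tau> n (Suc i)) \<omega> - B (\<tau> n i) \<omega>
     + (\<Sum>j<N. clip e (drift_gap n m i (\<tau> n i + real j / real N * (\<tau> n (Suc i) - \<tau> n i)) \<omega>)
          * ((\<tau> n (Suc i) - \<tau> n i) / real N)) else 0)"

lemma fine_point_in:
  fixes a b :: real
  assumes "a < b" "j \<le> N" "0 < N"
  shows "a + real j / real N * (b - a) \<in> {a..b}"
proof -
  have "real j / real N * (b - a) \<le> 1 * (b - a)"
    using assms by (intro mult_right_mono) auto
  then show ?thesis using assms by simp
qed

lemma step_tilted_noise_measurable:
  assumes n: "1 \<le> n" and m: "m \<in> A"
  shows "step_tilted_noise n m e N \<in> measurable P (Pi\<^sub>M UNIV (\<lambda>_. borel))"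
  unfolding step_tilted_noise_def[abs_def]
proof (rule measurable_PiM_single')
  fix i
  show "(\<lambda>\<omega>. if i < n then B (\<tau> n (Suc i)) \<omega> - B (\<tau> n i) \<omega>
     + (\<Sum>j<N. clip e (drift_gap n m i (\<tau> n i + real j / real N * (\<tau> n (Suc i) - \<tau> n i)) \<omega>)
          * ((\<tau> n (Suc i) - \<tau> n i) / real N)) else 0) \<in> borel_measurable P"
  proof (cases "i < n")
    case True
    have dg: "drift_gap n m i (\<tau> n i + real j / real N * (\<tau> n (Suc i) - \<tau> n i)) \<in> borel_measurable P"
      if "j < N" for j
      using fine_point_in[OF grid_interval(4)[OF n True], of j N] that
      by (intro measurable_from_subalg[OF aug_sub drift_gap_aug[OF n True m]]) auto
    note [simp] = B_meas[of "\<tau> n (Suc i)"] B_meas[of "\<tau> n i"]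
    show ?thesis unfolding clip_def if_P[OF True]
      by (intro borel_measurable_add borel_measurable_diff borel_measurable_sum borel_measurable_times
          borel_measurable_max borel_measurable_min borel_measurable_const dg) (use grid_interval[OF n True] in auto)
  qed simp
qed (auto simp: space_PiM)

lemma step_tilted_noise_tendsto:
  assumes n: "1 \<le> n" and m: "m \<in> A" and \<omega>: "\<omega> \<in> space P"
  shows "(\<lambda>N. step_tilted_noise n m e N \<omega> i) \<longlonglongrightarrow> tilted_noise n m e \<omega> i"
proof (cases "i < n")
  case True
  have "continuous_on {\<tau> n i..\<tau> n (Suc i)} (\<lambda>s. clip e (drift_gap n m i s \<omega>))"
    by (intro continuous_on_clip drift_gap_continuous[OF n True m \<omega>])
  from left_Riemann_sum_tendsto[OF grid_interval(4)[OF n True] this] show ?thesis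
    using True unfolding step_tilted_noise_def tilted_noise_def by (simp add: tendsto_add)
qed (simp add: step_tilted_noise_def tilted_noise_def)

text \<open>The integral inherits measurability from its Riemann sums, so it is enough that the
  drift gap is measurable at each fixed time.\<close>

lemma tilted_noise_measurable:
  assumes n: "1 \<le> n" and m: "m \<in> A"
  shows "tilted_noise n m e \<in> measurable P (Pi\<^sub>M UNIV (\<lambda>_. borel))"
proof -
  have "(\<lambda>\<omega>. tilted_noise n m e \<omega> i) \<in> borel_measurable P" for i
  proof (rule borel_measurable_LIMSEQ_real[OF step_tilted_noise_tendsto[OF n m]])
    show "(\<lambda>\<omega>. step_tilted_noise n m e N \<omega> i) \<in> borel_measurable P" for N
      by (rule measurable_compose[OF step_tilted_noise_measurable[OF n m] measurable_component_singleton]) simp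
  qed
  then show ?thesis by (intro measurable_PiM_single') (auto simp: space_PiM)
qed

lemma noise_measurable: "1 \<le> n \<Longrightarrow> noise n \<in> measurable P (Pi\<^sub>M UNIV (\<lambda>_. borel))"
  unfolding noise_def[abs_def]
proof (rule measurable_PiM_single')
  fix i assume n: "1 \<le> n"
  show "(\<lambda>\<omega>. if i < n then B (\<tau> n (Suc i)) \<omega> - B (\<tau> n i) \<omega> else 0) \<in> borel_measurable P"
    using grid_interval[OF n, of i] B_meas[of "\<tau> n (Suc i)"] B_meas[of "\<tau> n i"] by (cases "i < n") auto
qed (auto simp: space_PiM)

definition tv_bound :: "real \<Rightarrow> real" where
  "tv_bound e = sqrt (exp (e\<^sup>2 * T) - 1)"

text \<open>Girsanov is applied to the \<open>n * N\<close> steps of the refined grid and the result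
  is pushed forward to the \<open>n\<close> grid increments. The variances of the fine increments
  sum to \<open>T\<close>, so the bound is free of \<open>n\<close> and \<open>N\<close>.\<close>

lemma step_tilted_noise_tv:
  assumes n: "1 \<le> n" and m: "m \<in> A" and e: "0 \<le> e" and N: "0 < N"
    and C: "C \<in> sets (aug 0)" and E: "E \<in> sets (Pi\<^sub>M UNIV (\<lambda>_. borel))"
  shows "\<bar>prob {\<omega>\<in>C. step_tilted_noise n m e N \<omega> \<in> E} - prob {\<omega>\<in>C. noise n \<omega> \<in> E}\<bar> \<le> tv_bound e"
proof -
  define w where "w i = \<tau> n (Suc i) - \<tau> n i" for i
  \<comment> \<open>For a fine index \<open>k = j + i * N\<close> the quotient is the grid step and
    the remainder the position inside it. At \<open>k = n * N\<close> the remainder is 0, so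
    \<open>w n\<close>, which reads a value beyond the last grid point, is multiplied by 0.\<close>
  define s where "s k = \<tau> n (k div N) + real (k mod N) / real N * w (k div N)" for k
  have s_mult: "s (i * N) = \<tau> n i" for i using N by (simp add: s_def)
  have s_block: "s (j + i * N) = \<tau> n i + real j / real N * w i" if "j < N" for i j
    using N that by (simp add: s_def)
  have s_Suc: "s (Suc k) - s k = w (k div N) / real N" for k
  proof (cases "Suc (k mod N) = N")
    case True
    then have "Suc k div N = Suc (k div N)" "Suc k mod N = 0" using N by (auto simp: div_Suc mod_Suc)
    then have "s (Suc k) = \<tau> n (k div N) + w (k div N)" by (simp add: s_def w_def)
    moreover have "real (k mod N) / real N = 1 - 1 / real N"
    proof -
      have "real (k mod N) = real N - 1" using True by linarith
      then show ?thesis using N by (simp add: field_simps)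
    qed
    then have "s k = \<tau> n (k div N) + (1 - 1 / real N) * w (k div N)" by (simp add: s_def)
    ultimately show ?thesis by (simp add: left_diff_distrib)
  next
    case False
    then have "Suc k div N = k div N" "Suc k mod N = Suc (k mod N)" by (auto simp: div_Suc mod_Suc)
    then show ?thesis using N by (simp add: s_def field_simps)
  qed
  have blk: "k div N < n" if "k < n * N" for k
    using that N by (simp add: less_mult_imp_div_less)
  have s_in: "s k \<in> {\<tau> n (k div N)..\<tau> n (Suc (k div N))}" if "k < n * N" for k
    using fine_point_in[OF grid_interval(4)[OF n blk[OF that]], of "k mod N" N] N
    by (simp add: s_def w_def less_imp_le)
  have s_less: "s k < s (Suc k)" if "k < n * N" for k
  proof -
    have "0 < w (k div N) / real N" using grid_interval(4)[OF n blk[OF that]] N by (simp add: w_def)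
    then show ?thesis using s_Suc[of k] by linarith
  qed
  have s0: "s 0 = 0" and sK: "s (n * N) = T"
    using s_mult[of 0] s_mult[of n] tp[OF n] by (auto simp: time_points_def)
  have s_nonneg: "0 \<le> s k" if "k \<le> n * N" for k
    using that
  proof (induction k)
    case (Suc k)
    then show ?case using s_less[of k] by simp
  qed (simp add: s0)
  define X where "X k \<omega> = B (s (Suc k)) \<omega> - B (s k) \<omega>" for k \<omega>
  define h where "h k \<omega> = clip e (drift_gap n m (k div N) (s k) \<omega>)" for k \<omega>
  define d where "d k = s (Suc k) - s k" for k
  interpret gaussian_steps P "\<lambda>k. aug (s k)" X h d "n * N"
  proof
    fix k
    show "subalgebra P (aug (s k))" by (rule aug_sub)
    assume k: "k < n * N"
    note sk = s_nonneg[of k] s_less[OF k] k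
    show "sets (aug (s k)) \<subseteq> sets (aug (s (Suc k)))" using sk by (intro aug_mono) auto
    show "X k \<in> borel_measurable (aug (s (Suc k)))"
      unfolding X_def[abs_def] using sk by (intro borel_measurable_diff B_aug) auto
    show "indep_set (sets (aug (s k))) (sets (vimage_algebra (space P) (X k) borel))"
      unfolding X_def[abs_def] using sk by (intro increment_indep_aug) auto
    show "distributed P lborel (X k) (\<lambda>x. ennreal (normal_density 0 (sqrt (d k)) x))"
      unfolding X_def[abs_def] d_def using sk by (intro increment_gaussian) auto
    show "0 < d k" using sk by (simp add: d_def)
    show "h k \<in> borel_measurable (aug (s k))"
      using drift_gap_aug[OF n blk[OF k] m s_in[OF k]]
      unfolding h_def[abs_def] clip_def by measurable
  qed
  \<comment> \<open>Summing each block of \<open>N\<close> fine coordinates returns the grid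
    increments: the noise telescopes and the drift becomes the Riemann sum. The estimate holds for
    every event, in particular for preimages under this map.\<close>
  define collapse :: "(nat \<Rightarrow> real) \<Rightarrow> nat \<Rightarrow> real" where
    "collapse w = (\<lambda>i. if i < n then \<Sum>j<N. w (j + i * N) else 0)" for w
  have collapse_meas: "collapse \<in> measurable (Pi\<^sub>M UNIV (\<lambda>_. borel)) (Pi\<^sub>M UNIV (\<lambda>_. borel))"
    unfolding collapse_def[abs_def]
  proof (rule measurable_PiM_single')
    fix i
    show "(\<lambda>w :: nat \<Rightarrow> real. if i < n then \<Sum>j<N. w (j + i * N) else 0) \<in> borel_measurable (Pi\<^sub>M UNIV (\<lambda>_. borel))"
      by (cases "i < n") auto
  qed (auto simp: space_PiM)
  have idx: "j + i * N < n * N" if "i < n" "j < N" for i j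
  proof -
    have "j + i * N < Suc i * N" using that by simp
    also have "\<dots> \<le> n * N" using that by (intro mult_right_mono) auto
    finally show ?thesis .
  qed
  have sumX: "(\<Sum>j<N. X (j + i * N) \<omega>) = B (\<tau> n (Suc i)) \<omega> - B (\<tau> n i) \<omega>" for i \<omega>
  proof -
    have "(\<Sum>j<N. X (j + i * N) \<omega>) = (\<Sum>j<N. B (s (Suc j + i * N)) \<omega> - B (s (j + i * N)) \<omega>)"
      by (simp add: X_def)
    also have "\<dots> = B (s (N + i * N)) \<omega> - B (s (0 + i * N)) \<omega>"
      by (rule sum_lessThan_telescope)
    also have "s (N + i * N) = \<tau> n (Suc i)" using s_mult[of "Suc i"] by simp
    finally show ?thesis by (simp add: s_mult)
  qed
  have d_block: "d (j + i * N) = w i / real N" if "j < N" for i j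
    using s_Suc[of "j + i * N"] that by (simp add: d_def)
  have cs: "collapse (shifted (n * N) \<omega>) = step_tilted_noise n m e N \<omega>" for \<omega>
  proof
    fix i
    show "collapse (shifted (n * N) \<omega>) i = step_tilted_noise n m e N \<omega> i"
    proof (cases "i < n")
      case True
      have "collapse (shifted (n * N) \<omega>) i = (\<Sum>j<N. X (j + i * N) \<omega> + h (j + i * N) \<omega> * d (j + i * N))"
        using True idx[OF True] by (simp add: collapse_def shifted_def)
      also have "\<dots> = (\<Sum>j<N. X (j + i * N) \<omega>) + (\<Sum>j<N. h (j + i * N) \<omega> * d (j + i * N))"
        by (rule sum.distrib)
      also have "(\<Sum>j<N. h (j + i * N) \<omega> * d (j + i * N)) =
          (\<Sum>j<N. clip e (drift_gap n m i (\<tau> n i + real j / real N * (\<tau> n (Suc i) - \<tau> n i)) \<omega>)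
          * ((\<tau> n (Suc i) - \<tau> n i) / real N))"
        by (intro sum.cong refl) (simp add: h_def d_block s_block, simp add: w_def)
      finally show ?thesis using True by (simp add: sumX step_tilted_noise_def)
    qed (simp add: collapse_def step_tilted_noise_def)
  qed
  have cu: "collapse (unshifted (n * N) \<omega>) = noise n \<omega>" for \<omega>
  proof
    fix i
    show "collapse (unshifted (n * N) \<omega>) i = noise n \<omega> i"
      using idx[of i] by (cases "i < n") (simp_all add: collapse_def unshifted_def sumX noise_def)
  qed
  have E': "collapse -` E \<in> sets (Pi\<^sub>M UNIV (\<lambda>_. borel))"
    using measurable_sets[OF collapse_meas E] by (simp add: space_PiM)
  have sumd: "(\<Sum>j<n * N. d j) = T"
    unfolding d_def sum_lessThan_telescope using s0 sK by simp
  have "\<bar>prob {\<omega>\<in>C. shifted (n * N) \<omega> \<in> collapse -` E} - prob {\<omega>\<in>C. unshifted (n * N) \<omega> \<in> collapse -` E}\<bar>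
    \<le> sqrt (exp (e\<^sup>2 * (\<Sum>j<n * N. d j)) - 1)"
    by (rule total_variation_shift_le[OF _ E']) (use C s0 e clip_abs_le in \<open>auto simp: h_def\<close>)
  then show ?thesis by (simp add: cs cu sumd tv_bound_def)
qed

text \<open>Since \<open>step_tilted_noise\<close> converges only pointwise, its probability of
  lying in \<open>E\<close> need not converge. A set \<open>E'\<close> is taken whose occurrence for
  the approximation is close to that of \<open>E\<close> for the limit; the plain noise, as a
  constant sequence, must be served by the same \<open>E'\<close>.\<close>

lemma tilted_noise_tv:
  assumes n: "1 \<le> n" and m: "m \<in> A" and e: "0 \<le> e"
    and C: "C \<in> sets (aug 0)" and E: "E \<in> sets (Pi\<^sub>M UNIV (\<lambda>_. borel))"
  shows "\<bar>prob {\<omega>\<in>C. tilted_noise n m e \<omega> \<in> E} - prob {\<omega>\<in>C. noise n \<omega> \<in> E}\<bar> \<le> tv_bound e"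
proof (rule field_le_epsilon)
  fix \<eta> :: real assume \<eta>: "\<eta> > 0"
  have CP: "C \<in> events" using C aug_sub[of 0] by (auto simp: subalgebra_def)
  have PB: "sets (Pi\<^sub>M UNIV (\<lambda>_::nat. borel :: real measure)) = sets borel" by (rule sets_PiM_equal_borel)
  note mB = measurable_cong_sets[OF refl PB, THEN equalityD1, THEN subsetD]
  note mW = mB[OF step_tilted_noise_measurable[OF n m, of e]] mB[OF tilted_noise_measurable[OF n m, of e]]
    mB[OF noise_measurable[OF n]]
  have lim: "(\<lambda>N. step_tilted_noise n m e N \<omega>) \<longlonglongrightarrow> tilted_noise n m e \<omega>" if "\<omega> \<in> space P" for \<omega>
    using step_tilted_noise_tendsto[OF n m that] by (intro tendsto_fun)
  have "E \<in> sets borel" using E PB by simp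
  then obtain E' where E': "E' \<in> sets borel" and
    ev: "\<forall>\<^sub>F N in sequentially.
      prob {\<omega>\<in>space P. (tilted_noise n m e \<omega> \<in> E) \<noteq> (step_tilted_noise n m e N \<omega> \<in> E')} < \<eta> / 2 \<and>
      prob {\<omega>\<in>space P. (noise n \<omega> \<in> E) \<noteq> (noise n \<omega> \<in> E')} < \<eta> / 2"
    using borel_set_approx_along_convergent[OF mW(1) mW(2) mW(3) mW(3) lim tendsto_const, of E "\<eta>/2"] \<eta> by auto
  from eventually_happens'[OF sequentially_bot eventually_conj[OF ev eventually_gt_at_top[of 0]]]
  obtain N where N: "0 < N"
    "prob {\<omega>\<in>space P. (tilted_noise n m e \<omega> \<in> E) \<noteq> (step_tilted_noise n m e N \<omega> \<in> E')} < \<eta> / 2"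
    "prob {\<omega>\<in>space P. (noise n \<omega> \<in> E) \<noteq> (noise n \<omega> \<in> E')} < \<eta> / 2" by blast
  have close: "\<bar>prob {\<omega>\<in>C. V \<omega> \<in> E} - prob {\<omega>\<in>C. W \<omega> \<in> E'}\<bar> < \<eta> / 2"
    if [measurable]: "V \<in> borel_measurable P" "W \<in> borel_measurable P"
      and lt: "prob {\<omega>\<in>space P. (V \<omega> \<in> E) \<noteq> (W \<omega> \<in> E')} < \<eta> / 2" for V W
  proof -
    note [measurable] = \<open>E \<in> sets borel\<close> E'
    have "\<bar>prob {\<omega>\<in>C. V \<omega> \<in> E} - prob {\<omega>\<in>C. W \<omega> \<in> E'}\<bar> \<le> prob {\<omega>\<in>C. (V \<omega> \<in> E) \<noteq> (W \<omega> \<in> E')}"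
      by (intro prob_diff_le_prob_neq CP) measurable
    also have "\<dots> \<le> prob {\<omega>\<in>space P. (V \<omega> \<in> E) \<noteq> (W \<omega> \<in> E')}"
      using sets.sets_into_space[OF CP] by (intro finite_measure_mono) (auto, measurable)
    finally show ?thesis using lt by linarith
  qed
  have "\<bar>prob {\<omega>\<in>C. step_tilted_noise n m e N \<omega> \<in> E'} - prob {\<omega>\<in>C. noise n \<omega> \<in> E'}\<bar> \<le> tv_bound e"
    using step_tilted_noise_tv[OF n m e N(1) C] E' PB by simp
  with close[OF mW(2) mW(1) N(2)] close[OF mW(3) mW(3) N(3)]
  show "\<bar>prob {\<omega>\<in>C. tilted_noise n m e \<omega> \<in> E} - prob {\<omega>\<in>C. noise n \<omega> \<in> E}\<bar> \<le> tv_bound e + \<eta>"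
    by linarith
qed

section \<open>Comparison of the laws of the grid values\<close>

definition Y_grid :: "nat \<Rightarrow> 'a \<Rightarrow> nat \<Rightarrow> real" where
  "Y_grid n \<omega> = (\<lambda>i\<in>{0..n}. Y (\<tau> n i) \<omega>)"

lemma Y_grid_measurable: "1 \<le> n \<Longrightarrow> Y_grid n \<in> measurable P (Pi\<^sub>M {0..n} (\<lambda>_. borel))"
  unfolding Y_grid_def[abs_def] using time_points_in[OF tp, of n]
  by (intro measurable_restrict Y_meas) auto

definition euler_grid :: "nat \<Rightarrow> 'm \<Rightarrow> (nat \<Rightarrow> real) \<Rightarrow> nat \<Rightarrow> real" where
  "euler_grid n m x = (\<lambda>i\<in>{0..n}. euler_vec (\<tau> n) m x n i)"

lemma euler_grid_measurable:
  assumes "1 \<le> n" "m \<in> A"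
  shows "euler_grid n m \<in> measurable (Pi\<^sub>M UNIV (\<lambda>_. borel)) (Pi\<^sub>M {0..n} (\<lambda>_. borel))"
  unfolding euler_grid_def[abs_def]
  by (intro measurable_restrict measurable_compose[OF euler_vec_measurable[OF tp[OF assms(1)] assms(2) order_refl]
      measurable_component_singleton]) auto

lemma Y_grid_eq_euler_grid:
  assumes n: "1 \<le> n" and \<omega>: "\<omega> \<in> space P" and m: "M \<omega> \<in> A"
    and Y0: "Y 0 \<omega> = 0"
    and sol: "\<And>t. t \<in> {0..T} \<Longrightarrow> Y t \<omega> = (LBINT s:{0..t}. g s (M \<omega>) (stop_path s (\<lambda>r. Y r \<omega>))) + B t \<omega>"
    and small: "\<And>i s. i < n \<Longrightarrow> s \<in> {\<tau> n i..\<tau> n (Suc i)} \<Longrightarrow> \<bar>drift_gap n (M \<omega>) i s \<omega>\<bar> \<le> e"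
  shows "Y_grid n \<omega> = euler_grid n (M \<omega>) (tilted_noise n (M \<omega>) e \<omega>)"
proof -
  let ?G = "\<lambda>s. g s (M \<omega>) (stop_path s (\<lambda>r. Y r \<omega>))"
  let ?y = "\<lambda>j. Y (\<tau> n j) \<omega>"
  have G: "continuous_on {0..T} ?G" by (rule continuous_on_g_path[OF m Y_cont[OF \<omega>]])
  have "euler_vec (\<tau> n) (M \<omega>) (tilted_noise n (M \<omega>) e \<omega>) n i = ?y i" if "i \<le> n" for i
  proof (rule euler_vec_unique[OF _ _ that])
    show "?y 0 = 0" using tp[OF n] Y0 by (simp add: time_points_def)
    fix i assume i: "i < n"
    note gi = grid_interval[OF n i]
    let ?I = "{\<tau> n i..\<tau> n (Suc i)}"
    let ?H = "\<lambda>s. g s (M \<omega>) (stop_path (\<tau> n i) (interp (\<tau> n) i ?y))"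
    have H: "continuous_on ?I ?H"
      using continuous_on_g_time[OF m continuous_on_interp gi(2)] gi(1) by (rule continuous_on_subset)
    have GI: "continuous_on ?I ?G" using G gi(1) by (rule continuous_on_subset)
    have G0: "continuous_on {0..t} ?G" if "t \<in> {0..T}" for t
      using G that by (auto intro: continuous_on_subset)
    have "integral {0..\<tau> n i} ?G + integral ?I ?G = integral {0..\<tau> n (Suc i)} ?G"
      using gi G0[OF gi(3)] by (intro Henstock_Kurzweil_Integration.integral_combine integrable_continuous_real) auto
    then have "?y (Suc i) - ?y i = integral ?I ?G + (B (\<tau> n (Suc i)) \<omega> - B (\<tau> n i) \<omega>)"
      using sol[OF gi(2)] sol[OF gi(3)] LBINT_eq_integral[OF G0[OF gi(2)]] LBINT_eq_integral[OF G0[OF gi(3)]]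
      by linarith
    moreover have "integral ?I ?G = integral ?I ?H + integral ?I (\<lambda>s. clip e (drift_gap n (M \<omega>) i s \<omega>))"
    proof -
      have "integral ?I (\<lambda>s. clip e (drift_gap n (M \<omega>) i s \<omega>)) = integral ?I (\<lambda>s. ?G s - ?H s)"
        by (rule Henstock_Kurzweil_Integration.integral_cong)
          (simp only: clip_id[OF small[OF i]], simp add: drift_gap_def)
      also have "\<dots> = integral ?I ?G - integral ?I ?H"
        using GI H by (intro integral_diff integrable_continuous_real)
      finally show ?thesis by simp
    qed
    moreover have "drift (\<tau> n) (M \<omega>) i ?y = integral ?I ?H"
      unfolding drift_def by (rule LBINT_eq_integral[OF H])
    moreover have "tilted_noise n (M \<omega>) e \<omega> i = B (\<tau> n (Suc i)) \<omega> - B (\<tau> n i) \<omega>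
        + integral ?I (\<lambda>s. clip e (drift_gap n (M \<omega>) i s \<omega>))"
      using i LBINT_eq_integral[OF continuous_on_clip[OF drift_gap_continuous[OF n i m \<omega>]], of e]
      by (simp add: tilted_noise_def)
    ultimately show "?y (Suc i) = ?y i + drift (\<tau> n) (M \<omega>) i ?y + tilted_noise n (M \<omega>) e \<omega> i"
      by linarith
  qed
  then show ?thesis unfolding Y_grid_def euler_grid_def by (intro restrict_ext) auto
qed

text \<open>Two errors meet, each bounded by the oscillation of the path over one mesh width:
  stopping at \<open>\<tau> n i\<close> instead of \<open>s\<close>, and interpolating. Together
  they cost \<open>L * (2 * e')\<close>, whence \<open>e' = e / (2 * L)\<close>.\<close>

lemma eventually_drift_gap_small:
  assumes m: "m \<in> A" and \<omega>: "\<omega> \<in> space P" and e: "0 < e"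
  shows "\<forall>\<^sub>F n in sequentially. \<forall>i<n. \<forall>s\<in>{\<tau> n i..\<tau> n (Suc i)}. \<bar>drift_gap n m i s \<omega>\<bar> \<le> e"
proof -
  define e' where "e' = e / (2 * L)"
  have e': "e' > 0" "L * (2 * e') = e" using e L_pos by (auto simp: e'_def)
  from eventually_small_oscillation[OF mesh_0 Y_cont[OF \<omega>] e'(1)] eventually_ge_at_top[of 1]
  show ?thesis
  proof eventually_elim
    case (elim n)
    note osc = elim(1)[rule_format]
    show ?case
    proof (intro allI impI ballI)
      fix i s assume i: "i < n" and s: "s \<in> {\<tau> n i..\<tau> n (Suc i)}"
      note gi = grid_interval[OF elim(2) i]
      have sT: "s \<in> {0..T}" using gi(1) s by auto
      have "\<bar>g s m (stop_path s (\<lambda>r. Y r \<omega>)) - g s m (stop_path (\<tau> n i) (interp (\<tau> n) i (\<lambda>j. Y (\<tau> n j) \<omega>)))\<bar>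
          \<le> L * (\<bar>s - s\<bar> + 2 * e')"
      proof (rule g_diff_le[OF sT sT sT gi(2) m Y_cont[OF \<omega>] continuous_on_interp])
        fix r assume r: "r \<in> {0..T}"
        define q where "q = max 0 (min r (\<tau> n i))"
        have q: "q \<in> {0..T}" "q \<le> \<tau> n i" using r gi(2) by (auto simp: q_def)
        have "\<bar>Y (max 0 (min r s)) \<omega> - Y q \<omega>\<bar> \<le> e'"
          using time_points_le_mesh[OF tp[OF elim(2)] i] r s sT gi(2) unfolding q_def by (intro osc) auto
        moreover have "\<bar>interp (\<tau> n) n (\<lambda>j. Y (\<tau> n j) \<omega>) q - Y q \<omega>\<bar> \<le> e'"
          by (rule interp_approx[OF tp[OF elim(2)] elim(2) q(1)]) (rule osc)
        moreover have "interp (\<tau> n) n (\<lambda>j. Y (\<tau> n j) \<omega>) q = interp (\<tau> n) i (\<lambda>j. Y (\<tau> n j) \<omega>) q"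
          using i q(2) by (intro interp_prefix[OF tp[OF elim(2)]]) auto
        ultimately show "\<bar>stop_path s (\<lambda>r. Y r \<omega>) r - stop_path (\<tau> n i) (interp (\<tau> n) i (\<lambda>j. Y (\<tau> n j) \<omega>)) r\<bar> \<le> 2 * e'"
          unfolding stop_path_def q_def[symmetric] by linarith
      qed
      then show "\<bar>drift_gap n m i s \<omega>\<bar> \<le> e" using e'(2) by (simp add: drift_gap_def)
    qed
  qed
qed

text \<open>The failure of the exact Euler representation where the message is \<open>m\<close>.
  Writing it coordinatewise over \<open>{0..n}\<close> exhibits it as built from finitely many
  events; outside that range the two restricted vectors agree anyway.\<close>

definition bad_event :: "nat \<Rightarrow> 'm \<Rightarrow> real \<Rightarrow> 'a set" where
  "bad_event n m e = {\<omega>\<in>space P. M \<omega> = m \<and> (\<exists>i\<in>{0..n}. Y_grid n \<omega> i \<noteq> euler_grid n m (tilted_noise n m e \<omega>) i)}"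

lemma message_event: "m \<in> A \<Longrightarrow> {\<omega>\<in>space P. M \<omega> = m} \<in> \<sigma>M"
proof -
  assume "m \<in> A"
  then have "M -` {m} \<inter> space P \<in> \<sigma>M" by (intro in_vimage_algebra) auto
  moreover have "M -` {m} \<inter> space P = {\<omega>\<in>space P. M \<omega> = m}" by auto
  ultimately show ?thesis by simp
qed

lemma euler_tilted_measurable:
  assumes "1 \<le> n" "m \<in> A"
  shows "(\<lambda>\<omega>. euler_grid n m (tilted_noise n m e \<omega>)) \<in> measurable P (Pi\<^sub>M {0..n} (\<lambda>_. borel))"
  by (rule measurable_compose[OF tilted_noise_measurable[OF assms] euler_grid_measurable[OF assms]])

lemma bad_event_events:
  assumes n: "1 \<le> n" and m: "m \<in> A"
  shows "bad_event n m e \<in> events"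
proof -
  have "(\<lambda>\<omega>. Y_grid n \<omega> i) \<in> borel_measurable P"
    "(\<lambda>\<omega>. euler_grid n m (tilted_noise n m e \<omega>) i) \<in> borel_measurable P" if "i \<in> {0..n}" for i
    using that Y_grid_measurable[OF n] euler_tilted_measurable[OF n m]
    by (auto intro: measurable_compose[OF _ measurable_component_singleton])
  then have "{\<omega>\<in>space P. Y_grid n \<omega> i \<noteq> euler_grid n m (tilted_noise n m e \<omega>) i} \<in> events" if "i \<in> {0..n}" for i
    using that by (intro borel_measurable_neq) auto
  then have "{\<omega>\<in>space P. M \<omega> = m} \<inter> (\<Union>i\<in>{0..n}. {\<omega>\<in>space P. Y_grid n \<omega> i \<noteq> euler_grid n m (tilted_noise n m e \<omega>) i}) \<in> events"
    using message_event[OF m] \<sigma>M_events by (intro sets.Int sets.finite_UN) auto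
  moreover have "bad_event n m e = {\<omega>\<in>space P. M \<omega> = m} \<inter> (\<Union>i\<in>{0..n}. {\<omega>\<in>space P. Y_grid n \<omega> i \<noteq> euler_grid n m (tilted_noise n m e \<omega>) i})"
    by (auto simp: bad_event_def)
  ultimately show ?thesis by simp
qed

lemma bad_event_tendsto:
  assumes m: "m \<in> A" and e: "0 < e"
  shows "(\<lambda>n. prob (bad_event n m e)) \<longlonglongrightarrow> 0"
proof -
  \<comment> \<open>The index is shifted because a grid, and with it measurability of the event, is
    available only from \<open>n = 1\<close> on.\<close>
  have "(\<lambda>n. prob (bad_event (Suc n) m e)) \<longlonglongrightarrow> 0"
  proof (rule prob_tendsto_0_if_eventually_notin)
    have "AE \<omega> in P. Y 0 \<omega> = 0 \<and> (\<forall>t\<in>{0..T}. Y t \<omega> =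
        (LBINT s:{0..t}. g s (M \<omega>) (stop_path s (\<lambda>r. Y r \<omega>))) + B t \<omega>)"
      using solution by (simp add: strong_solution_def)
    then show "AE \<omega> in P. \<forall>\<^sub>F n in sequentially. \<omega> \<notin> bad_event (Suc n) m e"
    proof (rule AE_mp, intro AE_I2 impI)
      fix \<omega> assume \<omega>: "\<omega> \<in> space P" and sol: "Y 0 \<omega> = 0 \<and> (\<forall>t\<in>{0..T}. Y t \<omega> =
        (LBINT s:{0..t}. g s (M \<omega>) (stop_path s (\<lambda>r. Y r \<omega>))) + B t \<omega>)"
      have "\<forall>\<^sub>F n in sequentially. \<omega> \<notin> bad_event n m e"
        using eventually_drift_gap_small[OF m \<omega> e] eventually_ge_at_top[of 1]
      proof eventually_elim
        case (elim n)
        show ?case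
        proof (cases "M \<omega> = m")
          case True
          then have "Y_grid n \<omega> = euler_grid n m (tilted_noise n m e \<omega>)"
            using Y_grid_eq_euler_grid[OF elim(2) \<omega>, of e] m sol elim(1) by simp
          then show ?thesis by (simp add: bad_event_def)
        qed (simp add: bad_event_def)
      qed
      then show "\<forall>\<^sub>F n in sequentially. \<omega> \<notin> bad_event (Suc n) m e"
        by (rule eventually_compose_filterlim[OF _ filterlim_Suc])
    qed
  qed (use bad_event_events m in auto)
  then show ?thesis by (rule LIMSEQ_imp_Suc)
qed

lemma tv_bound_tendsto: "(tv_bound \<longlongrightarrow> 0) (at_right 0)"
proof -
  have "((\<lambda>e. sqrt (exp (e\<^sup>2 * T) - 1)) \<longlongrightarrow> sqrt (exp (0\<^sup>2 * T) - 1)) (at_right 0)"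
    by (intro tendsto_intros)
  then show ?thesis unfolding tv_bound_def[abs_def] by simp
qed

definition Yn_grid :: "nat \<Rightarrow> 'a \<Rightarrow> nat \<Rightarrow> real" where
  "Yn_grid n \<omega> = (\<lambda>i\<in>{0..n}. Yn n (\<tau> n i) \<omega>)"

lemma Yn_grid_eq_euler_grid:
  assumes n: "1 \<le> n" and \<omega>: "\<omega> \<in> space P"
  shows "Yn_grid n \<omega> = euler_grid n (M \<omega>) (noise n \<omega>)"
proof -
  let ?y = "\<lambda>j. Yn n (\<tau> n j) \<omega>"
  note em = euler[OF n \<omega>, unfolded euler_maruyama_def]
  have path: "Yn n t \<omega> = interp (\<tau> n) n ?y t" if t: "t \<in> {0..T}" for t
  proof -
    obtain i where i: "i < n" "t \<in> {\<tau> n i..\<tau> n (Suc i)}" using time_points_cover[OF tp[OF n] n t] .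
    then show ?thesis unfolding interp_on[OF tp[OF n] i] using em by blast
  qed
  have "euler_vec (\<tau> n) (M \<omega>) (noise n \<omega>) n i = ?y i" if "i \<le> n" for i
  proof (rule euler_vec_unique[OF _ _ that])
    show "?y 0 = 0" using em tp[OF n] by (simp add: time_points_def)
    fix i assume i: "i < n"
    note gi = grid_interval[OF n i]
    have "stop_path (\<tau> n i) (\<lambda>t. Yn n t \<omega>) = stop_path (\<tau> n i) (interp (\<tau> n) i ?y)"
    proof (rule stop_path_cong)
      fix r assume "r \<in> {0..\<tau> n i}"
      then show "Yn n r \<omega> = interp (\<tau> n) i ?y r"
        using path[of r] interp_prefix[OF tp[OF n], of i r ?y] gi(2) i by auto
    qed (use gi(2) in auto)
    then have "drift (\<tau> n) (M \<omega>) i ?y = (LBINT s:{\<tau> n i..\<tau> n (Suc i)}. g s (M \<omega>) (stop_path (\<tau> n i) (\<lambda>t. Yn n t \<omega>)))"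
      by (simp add: drift_def)
    moreover have "?y (Suc i) = ?y i + (LBINT s:{\<tau> n i..\<tau> n (Suc i)}. g s (M \<omega>) (stop_path (\<tau> n i) (\<lambda>t. Yn n t \<omega>)))
        + B (\<tau> n (Suc i)) \<omega> - B (\<tau> n i) \<omega>"
      using em i by blast
    ultimately show "?y (Suc i) = ?y i + drift (\<tau> n) (M \<omega>) i ?y + noise n \<omega> i"
      using i by (simp add: noise_def)
  qed
  then show ?thesis unfolding Yn_grid_def euler_grid_def by (intro restrict_ext) auto
qed

lemma M_in_A: "\<omega> \<in> space P \<Longrightarrow> M \<omega> \<in> A"
  using measurable_space[OF M_meas] by simp

lemma noise_preimage_events:
  assumes n: "1 \<le> n" and m: "m \<in> A" and E: "E \<in> sets (Pi\<^sub>M {0..n} (\<lambda>_. borel))"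
  shows "{\<omega>\<in>space P. noise n \<omega> \<in> euler_grid n m -` E} \<in> events"
  using measurable_sets[OF measurable_compose[OF noise_measurable[OF n] euler_grid_measurable[OF n m]] E]
  by (simp add: vimage_def Int_def conj_commute)

text \<open>Measurability follows from the recursion: on each of the finitely many events
  \<open>M = m\<close> the grid values are a measurable function of the noise increments.\<close>

lemma Yn_grid_measurable:
  assumes n: "1 \<le> n"
  shows "Yn_grid n \<in> measurable P (Pi\<^sub>M {0..n} (\<lambda>_. borel))"
proof (rule measurableI)
  fix E assume E: "E \<in> sets (Pi\<^sub>M {0..n} (\<lambda>_. borel :: real measure))"
  have "Yn_grid n -` E \<inter> space P =
      (\<Union>m\<in>A. {\<omega>\<in>space P. M \<omega> = m} \<inter> {\<omega>\<in>space P. noise n \<omega> \<in> euler_grid n m -` E})"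
    using M_in_A Yn_grid_eq_euler_grid[OF n] by auto
  also have "\<dots> \<in> events"
    using finite_A message_event \<sigma>M_events noise_preimage_events[OF n _ E]
    by (intro sets.finite_UN sets.Int) auto
  finally show "Yn_grid n -` E \<inter> space P \<in> events" .
qed (simp add: Yn_grid_def space_PiM PiE_def)

text \<open>\<open>C\<close> is split by the value of the message. For fixed \<open>m\<close> both
  grid vectors are images under the same map \<open>euler_grid n m\<close>, of the noise and of the
  tilted noise, apart from the bad event; the two costs are summed over the alphabet.\<close>

lemma grid_tv_le:
  assumes n: "1 \<le> n" and e: "0 \<le> e" and C: "C \<in> \<sigma>M" and E: "E \<in> sets (Pi\<^sub>M {0..n} (\<lambda>_. borel))"
  shows "\<bar>prob {\<omega>\<in>C. Yn_grid n \<omega> \<in> E} - prob {\<omega>\<in>C. Y_grid n \<omega> \<in> E}\<bar>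
    \<le> (\<Sum>m\<in>A. tv_bound e + prob (bad_event n m e))"
proof -
  define Cm where "Cm m = {\<omega>\<in>space P. M \<omega> = m} \<inter> C" for m
  have Cm: "Cm m \<in> \<sigma>M" if "m \<in> A" for m
    unfolding Cm_def using message_event[OF that] C by (rule sets.Int)
  have CP: "C \<in> events" "C \<subseteq> space P" using C \<sigma>M_events sets.sets_into_space[of C P] by auto
  have decomp: "prob {\<omega>\<in>C. V \<omega> \<in> E} = (\<Sum>m\<in>A. prob {\<omega>\<in>Cm m. V \<omega> \<in> E})"
    if V: "V \<in> measurable P (Pi\<^sub>M {0..n} (\<lambda>_. borel))" for V
  proof -
    have "{\<omega>\<in>Cm m. V \<omega> \<in> E} \<in> events" if "m \<in> A" for m
    proof -
      have "{\<omega>\<in>Cm m. V \<omega> \<in> E} = Cm m \<inter> (V -` E \<inter> space P)" by (auto simp: Cm_def)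
      then show ?thesis using Cm[OF that] \<sigma>M_events measurable_sets[OF V E] by auto
    qed
    then have "prob (\<Union>m\<in>A. {\<omega>\<in>Cm m. V \<omega> \<in> E}) = (\<Sum>m\<in>A. prob {\<omega>\<in>Cm m. V \<omega> \<in> E})"
      using finite_A by (intro finite_measure_finite_Union) (auto simp: disjoint_family_on_def Cm_def)
    moreover have "(\<Union>m\<in>A. {\<omega>\<in>Cm m. V \<omega> \<in> E}) = {\<omega>\<in>C. V \<omega> \<in> E}"
      using M_in_A CP by (auto simp: Cm_def)
    ultimately show ?thesis by simp
  qed
  have each: "\<bar>prob {\<omega>\<in>Cm m. Yn_grid n \<omega> \<in> E} - prob {\<omega>\<in>Cm m. Y_grid n \<omega> \<in> E}\<bar> \<le> tv_bound e + prob (bad_event n m e)"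
    if m: "m \<in> A" for m
  proof -
    have CmP: "Cm m \<in> events" using Cm[OF m] \<sigma>M_events by auto
    have E': "euler_grid n m -` E \<in> sets (Pi\<^sub>M UNIV (\<lambda>_. borel))"
      using measurable_sets[OF euler_grid_measurable[OF n m] E] by (simp add: space_PiM)
    have "{\<omega>\<in>Cm m. Yn_grid n \<omega> \<in> E} = {\<omega>\<in>Cm m. noise n \<omega> \<in> euler_grid n m -` E}"
      using Yn_grid_eq_euler_grid[OF n] by (auto simp: Cm_def)
    moreover have "\<bar>prob {\<omega>\<in>Cm m. tilted_noise n m e \<omega> \<in> euler_grid n m -` E}
        - prob {\<omega>\<in>Cm m. noise n \<omega> \<in> euler_grid n m -` E}\<bar> \<le> tv_bound e"
      using Cm[OF m] \<sigma>M_aug by (intro tilted_noise_tv[OF n m e _ E']) auto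
    moreover have "\<bar>prob {\<omega>\<in>Cm m. Y_grid n \<omega> \<in> E} - prob {\<omega>\<in>Cm m. euler_grid n m (tilted_noise n m e \<omega>) \<in> E}\<bar>
        \<le> prob (bad_event n m e)"
    proof -
      have p: "{\<omega>\<in>space P. Y_grid n \<omega> \<in> E} \<in> events" "{\<omega>\<in>space P. euler_grid n m (tilted_noise n m e \<omega>) \<in> E} \<in> events"
        using measurable_sets[OF Y_grid_measurable[OF n] E] measurable_sets[OF euler_tilted_measurable[OF n m] E]
        by (simp_all add: vimage_def Int_def conj_commute)
      have "\<bar>prob {\<omega>\<in>Cm m. Y_grid n \<omega> \<in> E} - prob {\<omega>\<in>Cm m. euler_grid n m (tilted_noise n m e \<omega>) \<in> E}\<bar>
        \<le> prob {\<omega>\<in>Cm m. (Y_grid n \<omega> \<in> E) \<noteq> (euler_grid n m (tilted_noise n m e \<omega>) \<in> E)}"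
        by (rule prob_diff_le_prob_neq[OF CmP p])
      also have "\<dots> \<le> prob (bad_event n m e)"
      proof (rule finite_measure_mono[OF subsetI bad_event_events[OF n m]])
        fix \<omega> assume "\<omega> \<in> {\<omega>\<in>Cm m. (Y_grid n \<omega> \<in> E) \<noteq> (euler_grid n m (tilted_noise n m e \<omega>) \<in> E)}"
        then have \<omega>: "\<omega> \<in> Cm m" and ne: "(Y_grid n \<omega> \<in> E) \<noteq> (euler_grid n m (tilted_noise n m e \<omega>) \<in> E)"
          by auto
        have "\<exists>i\<in>{0..n}. Y_grid n \<omega> i \<noteq> euler_grid n m (tilted_noise n m e \<omega>) i"
        proof (rule ccontr)
          assume "\<not> ?thesis"
          then have "Y_grid n \<omega> = euler_grid n m (tilted_noise n m e \<omega>)"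
            unfolding Y_grid_def euler_grid_def by (intro restrict_ext) auto
          with ne show False by simp
        qed
        with \<omega> show "\<omega> \<in> bad_event n m e" by (auto simp: bad_event_def Cm_def)
      qed
      finally show ?thesis .
    qed
    ultimately show ?thesis by (simp add: vimage_def)
  qed
  have "prob {\<omega>\<in>C. Yn_grid n \<omega> \<in> E} - prob {\<omega>\<in>C. Y_grid n \<omega> \<in> E} =
      (\<Sum>m\<in>A. prob {\<omega>\<in>Cm m. Yn_grid n \<omega> \<in> E} - prob {\<omega>\<in>Cm m. Y_grid n \<omega> \<in> E})"
    by (simp add: decomp[OF Yn_grid_measurable[OF n]] decomp[OF Y_grid_measurable[OF n]] sum_subtractf)
  also have "\<bar>\<dots>\<bar> \<le> (\<Sum>m\<in>A. tv_bound e + prob (bad_event n m e))"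
    by (rule order_trans[OF sum_abs]) (intro sum_mono each)
  finally show ?thesis .
qed

text \<open>The order of choices matters: \<open>e\<close> comes before \<open>n\<close>, because
  the bad events vanish only for fixed \<open>e\<close>. Each message spends at most
  \<open>2 * c'\<close>, and the 1 added to \<open>card A\<close> keeps the denominator
  positive.\<close>

lemma eventually_grid_tv_le:
  assumes c: "0 < c"
  shows "\<forall>\<^sub>F n in sequentially. 1 \<le> n \<and> (\<forall>C\<in>\<sigma>M. \<forall>E\<in>sets (Pi\<^sub>M {0..n} (\<lambda>_. borel)).
    \<bar>prob {\<omega>\<in>C. Yn_grid n \<omega> \<in> E} - prob {\<omega>\<in>C. Y_grid n \<omega> \<in> E}\<bar> \<le> c)"
proof -
  define c' where "c' = c / (2 * (real (card A) + 1))"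
  have c': "c' > 0" using c by (simp add: c'_def)
  have c'2: "real (card A) * (c' + c') \<le> c"
  proof -
    have "c' + c' = c / (real (card A) + 1)"
      using field_sum_of_halves[of "c / (real (card A) + 1)"] by (simp add: c'_def mult.commute)
    then show ?thesis using c c' by (simp add: field_simps)
  qed
  have "\<forall>\<^sub>F e in at_right 0. 0 < e \<and> tv_bound e < c'"
    using eventually_at_right_less order_tendstoD(2)[OF tv_bound_tendsto c'] by (rule eventually_conj)
  then obtain e where e: "0 < e" "tv_bound e < c'"
    using eventually_happens' trivial_limit_at_right_real by blast
  have "\<forall>\<^sub>F n in sequentially. \<forall>m\<in>A. prob (bad_event n m e) < c'"
    using finite_A order_tendstoD(2)[OF bad_event_tendsto[OF _ e(1)] c'] by (intro eventually_ball_finite) auto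
  then show ?thesis using eventually_ge_at_top[of 1]
  proof eventually_elim
    case (elim n)
    have "(\<Sum>m\<in>A. tv_bound e + prob (bad_event n m e)) \<le> (\<Sum>m\<in>A. c' + c')"
      using elim(1) e(2) by (intro sum_mono add_mono) (auto intro: less_imp_le)
    also have "\<dots> \<le> c" using c'2 by simp
    finally have "(\<Sum>m\<in>A. tv_bound e + prob (bad_event n m e)) \<le> c" .
    then show ?case
      using elim(2) e(1) by (intro conjI ballI order_trans[OF grid_tv_le]) auto
  qed
qed

section \<open>Passing between grid values and the path\<close>

abbreviation "Y_path \<equiv> \<lambda>\<omega>. C_path T (\<lambda>t. Y t \<omega>)"

text \<open>Grid vectors live on \<open>{0..n}\<close> only; they are extended by 0 so that the
  continuity of the interpolation map on full sequences applies. The interpolation reads no index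
  above \<open>n\<close>.\<close>

definition grid_path :: "nat \<Rightarrow> (nat \<Rightarrow> real) \<Rightarrow> real \<Rightarrow>\<^sub>C real" where
  "grid_path n y = C_path T (interp (\<tau> n) n (\<lambda>i. if i \<le> n then y i else 0))"

lemma grid_path_measurable: "grid_path n \<in> borel_measurable (Pi\<^sub>M {0..n} (\<lambda>_. borel))"
proof -
  have "(\<lambda>y i. if i \<le> n then y i else 0 :: real) \<in> measurable (Pi\<^sub>M {0..n} (\<lambda>_. borel)) (Pi\<^sub>M UNIV (\<lambda>_. borel))"
  proof (rule measurable_PiM_single')
    fix i
    show "(\<lambda>y. if i \<le> n then y i else 0 :: real) \<in> borel_measurable (Pi\<^sub>M {0..n} (\<lambda>_. borel))"
      by (cases "i \<le> n") auto
  qed (auto simp: space_PiM)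
  moreover have "(\<lambda>y. C_path T (interp (\<tau> n) n y)) \<in> borel_measurable (Pi\<^sub>M UNIV (\<lambda>_. borel))"
    using continuous_C_path_interp[of T "\<tau> n" n] T_pos
    by (simp add: borel_measurable_continuous_onI measurable_cong_sets[OF sets_PiM_equal_borel refl])
  ultimately show ?thesis
    unfolding grid_path_def[abs_def] by (rule measurable_compose)
qed

lemma grid_path_Y_measurable: "(\<lambda>\<omega>. grid_path (Suc n) (Y_grid (Suc n) \<omega>)) \<in> borel_measurable P"
  by (rule measurable_compose[OF Y_grid_measurable grid_path_measurable]) simp

lemma grid_path_Y_tendsto:
  assumes "\<omega> \<in> space P"
  shows "(\<lambda>n. grid_path (Suc n) (Y_grid (Suc n) \<omega>)) \<longlonglongrightarrow> Y_path \<omega>"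
proof -
  have "grid_path n (Y_grid n \<omega>) = C_path T (interp (\<tau> n) n (\<lambda>i. Y (\<tau> n i) \<omega>))" for n
    unfolding grid_path_def by (intro arg_cong[where f="C_path T"] interp_cong) (simp add: Y_grid_def)
  then have "(\<lambda>n. grid_path n (Y_grid n \<omega>)) \<longlonglongrightarrow> Y_path \<omega>"
    using C_path_interp_tendsto[OF less_imp_le[OF T_pos] tp mesh_0 Y_cont[OF assms]] by simp
  then show ?thesis by (rule LIMSEQ_Suc)
qed

lemma path_measurable: "Y_path \<in> borel_measurable P"
  by (rule borel_measurable_LIMSEQ_metric[OF grid_path_Y_measurable grid_path_Y_tendsto])

text \<open>Sampling is a measurable map of the path space, so a label of the grid values is also a
  label of the path. This is the data processing step.\<close>

definition eval_grid :: "nat \<Rightarrow> (real \<Rightarrow>\<^sub>C real) \<Rightarrow> nat \<Rightarrow> real" where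
  "eval_grid n f = (\<lambda>i\<in>{0..n}. apply_bcontfun f (\<tau> n i))"

lemma eval_grid_measurable: "eval_grid n \<in> measurable borel (Pi\<^sub>M {0..n} (\<lambda>_. borel))"
  unfolding eval_grid_def[abs_def]
proof (rule measurable_restrict)
  fix i
  have "1-lipschitz_on UNIV (\<lambda>f :: real \<Rightarrow>\<^sub>C real. apply_bcontfun f (\<tau> n i))"
    by (intro lipschitz_onI) (auto intro: dist_bounded)
  then show "(\<lambda>f :: real \<Rightarrow>\<^sub>C real. apply_bcontfun f (\<tau> n i)) \<in> borel_measurable borel"
    by (intro borel_measurable_continuous_onI lipschitz_on_continuous_on)
qed

lemma eval_grid_path:
  assumes n: "1 \<le> n" and \<omega>: "\<omega> \<in> space P"
  shows "eval_grid n (Y_path \<omega>) = Y_grid n \<omega>"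
  unfolding eval_grid_def Y_grid_def
  using apply_C_path[OF less_imp_le[OF T_pos] Y_cont[OF \<omega>]] time_points_in[OF tp[OF n]]
  by (intro restrict_ext) (auto simp: stop_path_def)

lemma label_sum_cong:
  assumes "\<And>\<omega>. \<omega> \<in> space P \<Longrightarrow> l \<omega> = l' \<omega>"
  shows "label_sum P \<xi> k l = label_sum P \<xi> k l'"
proof -
  have "{\<omega>\<in>space P. l \<omega> = j} = {\<omega>\<in>space P. l' \<omega> = j}" for j using assms by auto
  then show ?thesis by (simp add: label_sum_def)
qed

lemma space_in_\<sigma>M: "space P \<in> \<sigma>M"
  using sets.top[of "vimage_algebra (space P) M (count_space A)"] by simp

lemma finite_partition_subset: "finite_partition P (count_space A) M \<xi> \<Longrightarrow> finite \<xi> \<and> \<xi> \<subseteq> \<sigma>M"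
  by (simp add: finite_partition_def)

text \<open>Bounds the number of cells of every message partition at once; its cardinality is the
  \<open>N\<close> of the modulus.\<close>

lemma finite_\<sigma>M: "finite \<sigma>M"
proof -
  have "\<sigma>M = {M -` E \<inter> space P | E. E \<in> sets (count_space A)}"
    using M_in_A by (intro sets_vimage_algebra2) auto
  also have "\<dots> = (\<lambda>E. M -` E \<inter> space P) ` Pow A" by auto
  finally show ?thesis using finite_A by simp
qed

lemma grid_label_measurable:
  assumes "1 \<le> n" "e \<in> measurable (Pi\<^sub>M {0..n} (\<lambda>_. borel)) (count_space UNIV)"
  shows "(\<lambda>\<omega>. e (Y_grid n \<omega>)) \<in> measurable P (count_space UNIV)"
    "(\<lambda>\<omega>. e (Yn_grid n \<omega>)) \<in> measurable P (count_space UNIV)"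
  using measurable_compose[OF Y_grid_measurable[OF assms(1)] assms(2)]
    measurable_compose[OF Yn_grid_measurable[OF assms(1)] assms(2)] by auto

lemma label_preimage:
  assumes "e \<in> measurable (Pi\<^sub>M {0..n} (\<lambda>_. borel)) (count_space UNIV)"
  shows "e -` J \<inter> space (Pi\<^sub>M {0..n} (\<lambda>_. borel :: real measure)) \<in> sets (Pi\<^sub>M {0..n} (\<lambda>_. borel))"
  using assms by (rule measurable_sets) simp

lemma grid_label_tv:
  assumes n: "1 \<le> n" and C: "C \<in> \<sigma>M" and e: "e \<in> measurable (Pi\<^sub>M {0..n} (\<lambda>_. borel)) (count_space UNIV)"
    and tv: "\<forall>C\<in>\<sigma>M. \<forall>E\<in>sets (Pi\<^sub>M {0..n} (\<lambda>_. borel)).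
      \<bar>prob {\<omega>\<in>C. Yn_grid n \<omega> \<in> E} - prob {\<omega>\<in>C. Y_grid n \<omega> \<in> E}\<bar> \<le> c"
  shows "\<bar>prob {\<omega>\<in>C. e (Yn_grid n \<omega>) \<in> J} - prob {\<omega>\<in>C. e (Y_grid n \<omega>) \<in> J}\<bar> \<le> c"
proof -
  let ?S = "Pi\<^sub>M {0..n} (\<lambda>_. borel :: real measure)"
  have "Yn_grid n \<omega> \<in> space ?S" "Y_grid n \<omega> \<in> space ?S" for \<omega>
    by (auto simp: space_PiM Yn_grid_def Y_grid_def)
  then have "{\<omega>\<in>C. e (Yn_grid n \<omega>) \<in> J} = {\<omega>\<in>C. Yn_grid n \<omega> \<in> e -` J \<inter> space ?S}"
    "{\<omega>\<in>C. e (Y_grid n \<omega>) \<in> J} = {\<omega>\<in>C. Y_grid n \<omega> \<in> e -` J \<inter> space ?S}" by auto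
  with tv[rule_format, OF C label_preimage[OF e, of J]] show ?thesis by (simp only:)
qed

section \<open>Upper and lower bounds for the information of the scheme\<close>

abbreviation "I_grid n \<equiv> mutual_info P (count_space A) (Pi\<^sub>M {0..n} (\<lambda>_. borel)) M (Yn_grid n)"
abbreviation "I_path \<equiv> mutual_info P (count_space A) borel M Y_path"

text \<open>A bound for every output partition of the scheme is required, with \<open>n\<close>
  chosen before the partition. A label of the scheme is applied to the grid values of
  \<open>Y\<close>, which changes its sum by a uniformly small amount, and is then a label of the
  path.\<close>

lemma eventually_I_grid_less:
  assumes a: "I_path < a"
  shows "\<forall>\<^sub>F n in sequentially. I_grid n < a"
proof -
  \<comment> \<open>The room between \<open>b'\<close> and \<open>b\<close> pays for exchanging the
    two grid vectors; \<open>b\<close> stays strictly below \<open>a\<close> because taking the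
    supremum gives only a weak inequality.\<close>
  obtain b where b: "I_path < ereal b" "ereal b < a" using ereal_dense2[OF a] by auto
  obtain b' where b': "I_path < ereal b'" "b' < b" using ereal_dense2[OF b(1)] by auto
  have "0 < b - b'" using b' by simp
  from label_sum_modulus_exists[OF this] obtain c where c: "0 < c" and "label_sum_modulus (card \<sigma>M) (b - b') c" .
  note uc = label_sum_modulusD[OF this(2)]
  from eventually_grid_tv_le[OF c] show ?thesis
  proof eventually_elim
    case (elim n)
    then have n: "1 \<le> n" and tv: "\<forall>C\<in>\<sigma>M. \<forall>E\<in>sets (Pi\<^sub>M {0..n} (\<lambda>_. borel)).
      \<bar>prob {\<omega>\<in>C. Yn_grid n \<omega> \<in> E} - prob {\<omega>\<in>C. Y_grid n \<omega> \<in> E}\<bar> \<le> c" by auto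
    have "I_grid n \<le> ereal b"
      unfolding mutual_info_def
    proof (rule SUP_least, clarify)
      fix \<xi> \<zeta> assume \<xi>: "finite_partition P (count_space A) M \<xi>"
        and \<zeta>: "finite_partition P (Pi\<^sub>M {0..n} (\<lambda>_. borel)) (Yn_grid n) \<zeta>"
      obtain e and k :: nat where e: "e \<in> measurable (Pi\<^sub>M {0..n} (\<lambda>_. borel)) (count_space UNIV)" "\<forall>x. e x < k"
        and sum: "\<forall>\<xi>. label_sum P \<xi> k (\<lambda>\<omega>. e (Yn_grid n \<omega>)) = (\<Sum>a\<in>\<xi>. \<Sum>b\<in>\<zeta>.
          prob (a \<inter> b) * ln (prob (a \<inter> b) / (prob a * prob b)))"
        using finite_partition_label[OF \<zeta> Yn_grid_measurable[OF n]] .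
      have \<xi>s: "finite \<xi>" "\<xi> \<subseteq> \<sigma>M" using finite_partition_subset[OF \<xi>] by auto
      have "label_sum P \<xi> k (\<lambda>\<omega>. e (Yn_grid n \<omega>)) \<le> label_sum P \<xi> k (\<lambda>\<omega>. e (Y_grid n \<omega>)) + (b - b')"
      proof (rule uc)
        fix a J assume "a \<in> insert (space P) \<xi>"
        then have "a \<in> \<sigma>M" using \<xi>s space_in_\<sigma>M by auto
        then show "\<bar>prob {\<omega>\<in>a. e (Yn_grid n \<omega>) \<in> J} - prob {\<omega>\<in>a. e (Y_grid n \<omega>) \<in> J}\<bar> \<le> c"
          by (rule grid_label_tv[OF n _ e(1) tv])
      qed (use grid_label_measurable[OF n e(1)] e(2) \<xi>s \<sigma>M_events card_mono[OF finite_\<sigma>M] in auto)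
      moreover have "label_sum P \<xi> k (\<lambda>\<omega>. e (Y_grid n \<omega>)) = label_sum P \<xi> k (\<lambda>\<omega>. e (eval_grid n (Y_path \<omega>)))"
        by (rule label_sum_cong) (simp add: eval_grid_path[OF n])
      moreover have "ereal (label_sum P \<xi> k (\<lambda>\<omega>. (\<lambda>x. e (eval_grid n x)) (Y_path \<omega>))) \<le> I_path"
        by (rule label_sum_le_mutual_info[OF \<xi> path_measurable measurable_compose[OF eval_grid_measurable e(1)] spec[OF e(2)]])
      then have "ereal (label_sum P \<xi> k (\<lambda>\<omega>. e (eval_grid n (Y_path \<omega>)))) < ereal b'"
        using b'(1) by (rule le_less_trans)
      ultimately have "label_sum P \<xi> k (\<lambda>\<omega>. e (Yn_grid n \<omega>)) \<le> b" by simp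
      then show "ereal (\<Sum>a\<in>\<xi>. \<Sum>b\<in>\<zeta>. prob (a \<inter> b) * ln (prob (a \<inter> b) / (prob a * prob b))) \<le> ereal b"
        by (simp add: sum)
    qed
    then show ?case using b(2) by (rule le_less_trans)
  qed
qed

text \<open>Here one nearly optimal pair of partitions is enough, so infinite path information is
  covered as well. Its path label has to be traded for one that reads only the grid.\<close>

lemma eventually_I_grid_greater:
  assumes a: "a < I_path"
  shows "\<forall>\<^sub>F n in sequentially. a < I_grid n"
proof -
  obtain \<xi> \<zeta> where \<xi>: "finite_partition P (count_space A) M \<xi>" and \<zeta>: "finite_partition P borel Y_path \<zeta>"
    and a': "a < ereal (\<Sum>a\<in>\<xi>. \<Sum>b\<in>\<zeta>. prob (a \<inter> b) * ln (prob (a \<inter> b) / (prob a * prob b)))"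
    using a unfolding mutual_info_def less_SUP_iff by auto
  obtain e and k :: nat where e: "e \<in> measurable borel (count_space UNIV)" "\<forall>x. e x < k"
    and sum: "\<forall>\<xi>. label_sum P \<xi> k (\<lambda>\<omega>. e (Y_path \<omega>)) = (\<Sum>a\<in>\<xi>. \<Sum>b\<in>\<zeta>.
      prob (a \<inter> b) * ln (prob (a \<inter> b) / (prob a * prob b)))"
    using finite_partition_label[OF \<zeta> path_measurable] .
  have "a < ereal (label_sum P \<xi> k (\<lambda>\<omega>. e (Y_path \<omega>)))" using a' by (simp add: sum)
  then obtain b where b: "a < ereal b" "b < label_sum P \<xi> k (\<lambda>\<omega>. e (Y_path \<omega>))"
    using ereal_dense2 by fastforce
  \<comment> \<open>The surplus is halved because the modulus is used twice: from the path to the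
    grid values of \<open>Y\<close>, and from these to the scheme.\<close>
  define \<epsilon> where "\<epsilon> = (label_sum P \<xi> k (\<lambda>\<omega>. e (Y_path \<omega>)) - b) / 2"
  have "0 < \<epsilon>" using b by (simp add: \<epsilon>_def)
  from label_sum_modulus_exists[OF this] obtain c where c: "0 < c" and "label_sum_modulus (card \<sigma>M) \<epsilon> c" .
  note uc = label_sum_modulusD[OF this(2)]
  have \<xi>s: "finite \<xi>" "\<xi> \<subseteq> \<sigma>M" "\<xi> \<subseteq> events" "card \<xi> \<le> card \<sigma>M"
    using finite_partition_subset[OF \<xi>] \<sigma>M_events card_mono[OF finite_\<sigma>M] by auto
  have a_events: "x \<in> \<sigma>M" "x \<in> events" if "x \<in> insert (space P) \<xi>" for x
    using that \<xi>s space_in_\<sigma>M by auto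
  \<comment> \<open>A single new label serves all large \<open>n\<close>; read on the interpolated
    grid values it differs from the old one on the path with probability below \<open>c\<close>,
    which also bounds the total variation.\<close>
  obtain e' :: "(real \<Rightarrow>\<^sub>C real) \<Rightarrow> nat" where e': "e' \<in> measurable borel (count_space UNIV)" "\<forall>x. e' x < k"
    and near: "\<forall>\<^sub>F n in sequentially. prob {\<omega>\<in>space P. e (Y_path \<omega>) \<noteq> e' (grid_path (Suc n) (Y_grid (Suc n) \<omega>))} < c"
    using label_approx_along_convergent[OF grid_path_Y_measurable path_measurable grid_path_Y_tendsto e(1) spec[OF e(2)] c] .
  have "\<forall>\<^sub>F n in sequentially. prob {\<omega>\<in>space P. e (Y_path \<omega>) \<noteq> e' (grid_path n (Y_grid n \<omega>))} < c"
    using near eventually_sequentially_Suc[of "\<lambda>n. prob {\<omega>\<in>space P. e (Y_path \<omega>) \<noteq> e' (grid_path n (Y_grid n \<omega>))} < c"] by (rule iffD1[rotated])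
  with eventually_grid_tv_le[OF c] show ?thesis
  proof eventually_elim
    case (elim n)
    then have n: "1 \<le> n" and tv: "\<forall>C\<in>\<sigma>M. \<forall>E\<in>sets (Pi\<^sub>M {0..n} (\<lambda>_. borel)).
      \<bar>prob {\<omega>\<in>C. Yn_grid n \<omega> \<in> E} - prob {\<omega>\<in>C. Y_grid n \<omega> \<in> E}\<bar> \<le> c"
      and nr: "prob {\<omega>\<in>space P. e (Y_path \<omega>) \<noteq> e' (grid_path n (Y_grid n \<omega>))} < c" by auto
    define f where "f y = e' (grid_path n y)" for y
    have f: "f \<in> measurable (Pi\<^sub>M {0..n} (\<lambda>_. borel)) (count_space UNIV)"
      unfolding f_def by (rule measurable_compose[OF grid_path_measurable e'(1)])
    have fk: "f y < k" for y by (simp add: f_def e'(2))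
    have lm: "(\<lambda>\<omega>. e (Y_path \<omega>)) \<in> measurable P (count_space UNIV)"
      by (rule measurable_compose[OF path_measurable e(1)])
    note fm = grid_label_measurable[OF n f]
    have pre: "{\<omega>\<in>space P. l \<omega> \<in> J} \<in> events" if "l \<in> measurable P (count_space UNIV)" for l :: "'a \<Rightarrow> nat" and J
      using measurable_sets[OF that, of J] by (simp add: vimage_def Int_def conj_commute)
    have neq: "{\<omega>\<in>space P. e (Y_path \<omega>) \<noteq> f (Y_grid n \<omega>)} \<in> events"
    proof -
      have "{\<omega>\<in>space P. e (Y_path \<omega>) \<noteq> f (Y_grid n \<omega>)} =
          (\<Union>j. {\<omega>\<in>space P. e (Y_path \<omega>) \<in> {j}} - {\<omega>\<in>space P. f (Y_grid n \<omega>) \<in> {j}})"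
        by auto
      also have "\<dots> \<in> events" using pre[OF lm] pre[OF fm(1)] by (intro sets.countable_UN image_subsetI sets.Diff)
      finally show ?thesis .
    qed
    have "label_sum P \<xi> k (\<lambda>\<omega>. e (Y_path \<omega>)) \<le> label_sum P \<xi> k (\<lambda>\<omega>. f (Y_grid n \<omega>)) + \<epsilon>"
    proof (rule uc[OF lm fm(1) spec[OF e(2)] fk \<xi>s(1,3,4)])
      fix x J assume "x \<in> insert (space P) \<xi>"
      note x = a_events[OF this]
      have "\<bar>prob {\<omega>\<in>x. e (Y_path \<omega>) \<in> J} - prob {\<omega>\<in>x. f (Y_grid n \<omega>) \<in> J}\<bar>
          \<le> prob {\<omega>\<in>x. (e (Y_path \<omega>) \<in> J) \<noteq> (f (Y_grid n \<omega>) \<in> J)}"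
        by (rule prob_diff_le_prob_neq[OF x(2) pre[OF lm] pre[OF fm(1)]])
      also have "\<dots> \<le> prob {\<omega>\<in>space P. e (Y_path \<omega>) \<noteq> f (Y_grid n \<omega>)}"
        using sets.sets_into_space[OF x(2)] by (intro finite_measure_mono neq) auto
      finally show "\<bar>prob {\<omega>\<in>x. e (Y_path \<omega>) \<in> J} - prob {\<omega>\<in>x. f (Y_grid n \<omega>) \<in> J}\<bar> \<le> c"
        using nr by (simp add: f_def)
    qed
    also have "label_sum P \<xi> k (\<lambda>\<omega>. f (Y_grid n \<omega>)) \<le> label_sum P \<xi> k (\<lambda>\<omega>. f (Yn_grid n \<omega>)) + \<epsilon>"
    proof (rule uc[OF fm(1) fm(2) fk fk \<xi>s(1,3,4)])
      fix x J assume "x \<in> insert (space P) \<xi>"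
      from grid_label_tv[OF n a_events(1)[OF this] f tv, of J]
      show "\<bar>prob {\<omega>\<in>x. f (Y_grid n \<omega>) \<in> J} - prob {\<omega>\<in>x. f (Yn_grid n \<omega>) \<in> J}\<bar> \<le> c"
        by (simp add: abs_minus_commute)
    qed
    finally have "b \<le> label_sum P \<xi> k (\<lambda>\<omega>. f (Yn_grid n \<omega>))"
      by (simp add: \<epsilon>_def field_simps)
    moreover have "ereal (label_sum P \<xi> k (\<lambda>\<omega>. f (Yn_grid n \<omega>))) \<le> I_grid n"
      by (rule label_sum_le_mutual_info[OF \<xi> Yn_grid_measurable[OF n] f fk])
    ultimately have "ereal b \<le> I_grid n" by (metis ereal_less_eq(3) order_trans)
    with b(1) show ?case by (rule less_le_trans)
  qed
qed

lemma I_grid_tendsto: "I_grid \<longlonglongrightarrow> I_path"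
  by (intro order_tendstoI eventually_I_grid_less eventually_I_grid_greater)

end

theorem theorem3p6:
  fixes P :: "'a measure" and F :: "real \<Rightarrow> 'a measure"
    and B Y :: "real \<Rightarrow> 'a \<Rightarrow> real"
    and A :: "'m set" and M :: "'a \<Rightarrow> 'm"
    and g :: "real \<Rightarrow> 'm \<Rightarrow> (real \<Rightarrow> real) \<Rightarrow> real"
    and T :: real
    and \<tau> :: "nat \<Rightarrow> nat \<Rightarrow> real"
    and Yn :: "nat \<Rightarrow> real \<Rightarrow> 'a \<Rightarrow> real"
  assumes "prob_space P"
    and "usual_conditions P F"
    and "brownian_motion P F B"
    and "finite A"
    and "M \<in> measurable P (count_space A)"
    and "independent_of_process P (count_space A) M B"
    and "T > 0"
    and "uniform_Lipschitz T A g"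
    and "uniform_linear_growth T A g"
    and "strong_solution P T (count_space A) g M B Y"
    and "\<And>n. n \<ge> 1 \<Longrightarrow> time_points T n (\<tau> n)"
    and "(\<lambda>n. mesh n (\<tau> n)) \<longlonglongrightarrow> 0"
    and "\<And>n \<omega>. n \<ge> 1 \<Longrightarrow> \<omega> \<in> space P \<Longrightarrow>
      euler_maruyama g n (\<tau> n) (M \<omega>) (\<lambda>t. B t \<omega>) (\<lambda>t. Yn n t \<omega>)"
  shows "(\<lambda>n. mutual_info P (count_space A) (Pi\<^sub>M {0..n} (\<lambda>_. borel)) M
            (\<lambda>\<omega>. \<lambda>i\<in>{0..n}. Yn n (\<tau> n i) \<omega>))
         \<longlonglongrightarrow> mutual_info P (count_space A) borel M (\<lambda>\<omega>. C_path T (\<lambda>t. Y t \<omega>))"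
proof -
  obtain L where L: "L > 0" and Lip: "\<forall>s1\<in>{0..T}. \<forall>s2\<in>{0..T}. \<forall>t1\<in>{0..T}. \<forall>t2\<in>{0..T}. \<forall>m\<in>A. \<forall>\<phi> \<psi>.
      continuous_on {0..T} \<phi> \<longrightarrow> continuous_on {0..T} \<psi> \<longrightarrow>
      \<bar>g s1 m (stop_path s2 \<phi>) - g t1 m (stop_path t2 \<psi>)\<bar> \<le> L * (\<bar>s1 - t1\<bar> + path_dist T s2 \<phi> t2 \<psi>)"
    using assms(8) unfolding uniform_Lipschitz_def by blast
  interpret prob_space P by fact
  interpret lipschitz_drift T L A g
    by unfold_locales (use assms(7) L Lip in blast)+
  interpret feedback_channel P T L A g F B Y M \<tau> Yn
    by unfold_locales (fact assms)+
  have "Yn_grid n = (\<lambda>\<omega>. \<lambda>i\<in>{0..n}. Yn n (\<tau> n i) \<omega>)" for n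
    by (intro ext) (simp add: Yn_grid_def)
  with I_grid_tendsto show ?thesis by simp
qed

end
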